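(* Let $n,k,q$ be integers with $1\le q\le k\le n$. If $F\in L^1(\mathfrak{M}_{n,q})$, then $$\int_{\mathfrak{M}_{n,q}} F(\mathbf{x})\, d\mathbf{x}= \frac{\sigma_{n,q}}{\sigma_{k,q}} \int_{G_{n,k}} d\xi \int_{\xi^q} F(\mathbf{x})\, |\mathbf{x}|_q^{\,n-k}\, d_\xi \mathbf{x},$$ where $\mathbf{x}=(x_1,\ldots,x_q)$ and $d_\xi\mathbf{x}=d_\xi x_1\cdots d_\xi x_q$ stands for the usual Lebesgue integration over $\xi^q$.
   Context: $\mathfrak{M}_{n,q}$ is the space of real $n\times q$ matrices $\mathbf{x}=(x_1,\ldots,x_q)=(x_{i,j})$ with columns $x_1,\dots,x_q\in\mathbb{R}^n$, identified with $(\mathbb{R}^n)^q$ and equipped with Lebesgue measure $d\mathbf{x}=\prod_{i=1}^n\prod_{j=1}^q dx_{i,j}$; $L^1(\mathfrak{M}_{n,q})$ is taken with respect to this measure. For $\mathbf{x}\in\mathfrak{M}_{n,q}$, $|\mathbf{x}|_q=(\det(\mathbf{x}^T\mathbf{x}))^{1/2}$ (the $q$-dimensional volume of the parallelepiped spanned by the columns). $G_{n,k}$ is the Grassmann manifold of $k$-dimensional linear subspaces $\xi$ of $\mathbb{R}^n$, and $d\xi$ is the $O(n)$-invariant probability measure on it. For $\xi\in G_{n,k}$, $\xi^q=\xi\times\cdots\times\xi$ ($q$ copies), and $d_\xi x_j$ is Lebesgue measure on $\xi$ (with the Euclidean structure induced from $\mathbb{R}^n$). For integers $m\ge q\ge1$,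 $$\sigma_{m,q}=\frac{2^q\pi^{mq/2}}{\Gamma_q(m/2)},\qquad \Gamma_q(\alpha)=\pi^{q(q-1)/4}\prod_{j=0}^{q-1}\Gamma(\alpha-j/2),$$ where $\Gamma$ is the Euler gamma function ($\sigma_{m,q}$ is the total mass of the normalized invariant measure on the Stiefel manifold of orthonormal $q$-frames in $\mathbb{R}^m$). *)

theory Defs
  imports "HOL-Probability.Probability"
begin

text \<open>
  Matrices with \<open>n\<close> rows and \<open>q\<close> columns are elements of \<^typ>\<open>real ^ 'q ^ 'n\<close>, where
  \<open>n = CARD('n)\<close> and \<open>q = CARD('q)\<close>; Lebesgue measure on them is \<^const>\<open>lebesgue\<close>.
\<close>

definition matrix_of_columns :: "('q \<Rightarrow> real ^ 'n) \<Rightarrow> real ^ 'q ^ 'n" where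
  "matrix_of_columns x = (\<chi> i j. x j $ i)"

definition column_volume :: "real ^ 'q ^ 'n \<Rightarrow> real" where
  "column_volume A = sqrt (det (transpose A ** A))"


definition grassmannian :: "nat \<Rightarrow> (real ^ 'n) set set" where
  "grassmannian k = {\<xi>. subspace \<xi> \<and> dim \<xi> = k}"

text \<open>
  The manifold topology on the Grassmannian is the one induced by identifying a subspace
  with the matrix of the orthogonal projection onto it. On a subspace, that projection is
  \<^const>\<open>closest_point\<close>.
\<close>

definition grassmann_topology :: "nat \<Rightarrow> (real ^ 'n) set topology" where
  "grassmann_topology k =
     pullback_topology (grassmannian k) (\<lambda>\<xi>. matrix (closest_point \<xi>)) euclidean"

definition grassmann_borel :: "nat \<Rightarrow> (real ^ 'n) set measure" where
  "grassmann_borel k = sigma (grassmannian k) {U. openin (grassmann_topology k) U}"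

definition invariant_grassmann_measure :: "nat \<Rightarrow> (real ^ 'n) set measure \<Rightarrow> bool" where
  "invariant_grassmann_measure k \<mu> \<longleftrightarrow>
     prob_space \<mu> \<and> sets \<mu> = sets (grassmann_borel k) \<and>
     (\<forall>T :: real ^ 'n \<Rightarrow> real ^ 'n. orthogonal_transformation T \<longrightarrow> distr \<mu> \<mu> (\<lambda>\<xi>. T ` \<xi>) = \<mu>)"


definition orthonormal_basis_of :: "(real ^ 'n) set \<Rightarrow> (real ^ 'n) set \<Rightarrow> bool" where
  "orthonormal_basis_of \<xi> B \<longleftrightarrow>
     pairwise orthogonal B \<and> (\<forall>b\<in>B. norm b = 1) \<and> span B = \<xi>"

text \<open>
  Lebesgue measure on the Borel sets of a subspace: as for \<^const>\<open>lborel\<close>, the image of the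
  product measure under orthonormal coordinates. By rotation invariance, it does not
  depend on the basis chosen.
\<close>

definition lborel_subspace :: "(real ^ 'n) set \<Rightarrow> (real ^ 'n) measure" where
  "lborel_subspace \<xi> =
     (let B = (SOME B. orthonormal_basis_of \<xi> B)
      in distr (\<Pi>\<^sub>M b\<in>B. lborel) (restrict_space borel \<xi>) (\<lambda>c. \<Sum>b\<in>B. c b *\<^sub>R b))"

text \<open>
  Lebesgue measure on the \<open>q\<close>-fold power of a subspace. A point is the family of its \<open>q\<close>
  components, indexed by \<open>'q\<close>.
\<close>

definition lebesgue_subspace_power :: "(real ^ 'n) set \<Rightarrow> ('q::finite \<Rightarrow> real ^ 'n) measure" where
  "lebesgue_subspace_power \<xi> = completion (\<Pi>\<^sub>M j\<in>(UNIV :: 'q set). lborel_subspace \<xi>)"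


definition multivariate_Gamma :: "nat \<Rightarrow> real \<Rightarrow> real" where
  "multivariate_Gamma q \<alpha> =
     pi powr (real q * (real q - 1) / 4) * (\<Prod>j<q. Gamma (\<alpha> - real j / 2))"

definition stiefel_mass :: "nat \<Rightarrow> nat \<Rightarrow> real" where
  "stiefel_mass m q = 2 ^ q * pi powr (real m * real q / 2) / multivariate_Gamma q (real m / 2)"

end

theory Submission
  imports Defs
begin

text \<open>
  Both sides of the formula are measures on matrices that are invariant under the rotations
  \<open>x \<mapsto> T x\<close>. They are compared in two steps.

  Suppose first that the integrand is itself rotation invariant. Then the inner integral is the
  same for every subspace, and one fixed \<open>\<xi>\<close> is enough. The columns are moved from the whole
  space into \<open>\<xi>\<close> one after the other (\<open>nn_integral_columns_subspace\<close>). When \<open>j\<close> columns are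
  already in \<open>\<xi>\<close> and span \<open>V\<close>, the integrand depends on the next column only through its
  component in \<open>V\<close> and its distance \<open>r\<close> to \<open>V\<close>. In polar coordinates around \<open>V\<close> the densities
  of \<open>r\<close> are proportional to \<open>r ^ (n - j - 1)\<close> in the whole space and to \<open>r ^ (k - j - 1)\<close> in
  \<open>\<xi>\<close>, so the passage costs a factor \<open>r ^ (n - k)\<close> and the quotient of two sphere areas
  (\<open>nn_integral_lborel_eq_subspace\<close>). The successive distances multiply to the volume of the
  columns, since a Gram determinant grows by the squared distance (\<open>det_gram_insert\<close>), and
  the quotients of sphere areas multiply to the quotient of the masses of the Stiefel manifolds
  (\<open>stiefel_mass_eq_prod\<close>).

  A general integrand is averaged over a random rotation. An explicit one is the Gram-Schmidt
  orthogonalisation of independent uniform points of the unit ball: rotating the points rotates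
  the frame. The average is rotation invariant (\<open>frame_average_invariant\<close>) and the averaging
  changes neither side of the formula; on the right-hand side this uses the invariance of the
  measure on the Grassmannian (\<open>nn_integral_grassmann_average\<close>).

  Measurability in \<open>\<xi>\<close> rests on one device: an integral over \<open>\<xi>\<close> equals an integral over the
  whole space of the integrand composed with the projection, weighted by a probability density
  in the orthogonal directions (\<open>nn_integral_coordinates_subspace\<close>). This expression depends
  on \<open>\<xi>\<close> only through the projection matrix. It also writes Lebesgue measure on matrices as the
  image of a measure with density on a product space (\<open>lborel_eq_grassmann_distr\<close>), from which
  Fubini's theorem gives the statement for integrable functions. A Lebesgue measurable integrand
  is replaced by a Borel measurable one, and the exceptional null set is negligible on almost
  every fibre by the formula itself (\<open>AE_columns_grassmann\<close>).
\<close>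

section \<open>Orthogonal projection onto a subspace\<close>

text \<open>
  On a subspace the nearest point is characterised by Pythagoras as the point with orthogonal
  residual. Linearity and the behaviour under rotations follow from this uniqueness, without
  choosing a basis.
\<close>

lemma closest_point_subspace_eqI:
  fixes y :: "'a::euclidean_space"
  assumes "subspace S" "p \<in> S" and orth: "\<And>w. w \<in> S \<Longrightarrow> (y - p) \<bullet> w = 0"
  shows "closest_point S y = p"
proof (rule closest_point_unique[symmetric])
  show "convex S" "closed S"
    using assms(1) by (auto simp: subspace_imp_convex closed_subspace)
  show "\<forall>z\<in>S. dist y p \<le> dist y z"
  proof
    fix z assume "z \<in> S"
    then have "(y - p) \<bullet> (p - z) = 0"
      using assms by (simp add: subspace_diff)
    then have "(norm (y - z))\<^sup>2 = (norm (y - p))\<^sup>2 + (norm (p - z))\<^sup>2"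
      using norm_add_Pythagorean[of "y - p" "p - z"] by (simp add: orthogonal_def)
    then have "(norm (y - p))\<^sup>2 \<le> (norm (y - z))\<^sup>2"
      by simp
    then show "dist y p \<le> dist y z"
      by (simp add: dist_norm)
  qed
qed (use assms in auto)

lemma closest_point_subspace:
  fixes y :: "'a::euclidean_space"
  assumes "subspace S"
  shows closest_point_mem_subspace: "closest_point S y \<in> S"
    and closest_point_residual_orthogonal: "w \<in> S \<Longrightarrow> (y - closest_point S y) \<bullet> w = 0"
proof -
  obtain p z where pz: "p \<in> span S" "\<And>w. w \<in> span S \<Longrightarrow> orthogonal z w" "y = p + z"
    using orthogonal_subspace_decomp_exists[of S y] by metis
  have S: "span S = S"
    using assms by simp
  have *: "closest_point S y = p"
    using pz unfolding S
    by (intro closest_point_subspace_eqI[OF assms]) (auto simp: orthogonal_def)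
  show "closest_point S y \<in> S" using * pz S by simp
  show "(y - closest_point S y) \<bullet> w = 0" if "w \<in> S"
    using that pz unfolding S * by (auto simp: orthogonal_def)
qed

lemma linear_closest_point:
  fixes S :: "'a::euclidean_space set"
  assumes S: "subspace S"
  shows "linear (closest_point S)"
proof (rule linearI)
  note m = closest_point_mem_subspace[OF S] and o = closest_point_residual_orthogonal[OF S]
  fix x y :: 'a and c :: real
  show "closest_point S (x + y) = closest_point S x + closest_point S y"
  proof (rule closest_point_subspace_eqI[OF S])
    fix w assume "w \<in> S"
    then show "(x + y - (closest_point S x + closest_point S y)) \<bullet> w = 0"
      using o[of w x] o[of w y] by (simp add: inner_diff_left inner_add_left)
  qed (use m S in \<open>auto simp: subspace_add\<close>)
  show "closest_point S (c *\<^sub>R x) = c *\<^sub>R closest_point S x"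
  proof (rule closest_point_subspace_eqI[OF S])
    fix w assume "w \<in> S"
    then show "(c *\<^sub>R x - c *\<^sub>R closest_point S x) \<bullet> w = 0"
      using o[of w x] by (simp add: inner_diff_left)
  qed (use m S in \<open>auto simp: subspace_scale\<close>)
qed

lemma closest_point_subspace_self: "subspace S \<Longrightarrow> x \<in> S \<Longrightarrow> closest_point S x = (x :: 'a::euclidean_space)"
  by (rule closest_point_self)

lemma borel_measurable_closest_point[measurable]:
  fixes S :: "'a::euclidean_space set"
  assumes "subspace S"
  shows "closest_point S \<in> borel_measurable borel"
  using linear_closest_point[OF assms]
  by (intro borel_measurable_continuous_onI linear_continuous_on) (simp add: linear_conv_bounded_linear)

lemma closest_point_orthogonal_image:
  fixes T :: "'a::euclidean_space \<Rightarrow> 'a"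
  assumes S: "subspace S" and T: "orthogonal_transformation T"
  shows "closest_point (T ` S) (T y) = T (closest_point S y)"
proof (rule closest_point_subspace_eqI)
  have lin: "linear T" using T by (rule orthogonal_transformation_linear)
  show "subspace (T ` S)" using lin S by (rule linear_subspace_image)
  show "T (closest_point S y) \<in> T ` S" using closest_point_mem_subspace[OF S] by auto
  fix w assume "w \<in> T ` S"
  then obtain v where v: "v \<in> S" "w = T v" by auto
  have "(T y - T (closest_point S y)) \<bullet> w = T (y - closest_point S y) \<bullet> T v"
    using lin v by (simp add: linear_diff)
  also have "\<dots> = (y - closest_point S y) \<bullet> v"
    using T by (simp add: orthogonal_transformation_def)
  finally show "(T y - T (closest_point S y)) \<bullet> w = 0"
    using closest_point_residual_orthogonal[OF S v(1)] by simp
qed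

section \<open>Rotation invariance of Lebesgue measure\<close>

lemma borel_measurable_orthogonal_transformation:
  fixes T :: "'a::euclidean_space \<Rightarrow> 'a"
  assumes "orthogonal_transformation T"
  shows "T \<in> borel_measurable borel"
  using orthogonal_transformation_linear[OF assms]
  by (intro borel_measurable_continuous_onI linear_continuous_on) (simp add: linear_conv_bounded_linear)

lemma nn_integral_lborel_translate:
  fixes f :: "'a::euclidean_space \<Rightarrow> ennreal"
  assumes [measurable]: "f \<in> borel_measurable borel"
  shows "(\<integral>\<^sup>+x. f (x + a) \<partial>lborel) = (\<integral>\<^sup>+x. f x \<partial>lborel)"
proof -
  have "(\<integral>\<^sup>+x. f x \<partial>lborel) = (\<integral>\<^sup>+x. f x \<partial>distr lborel borel ((+) a))"
    by (simp add: lborel_distr_plus)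
  also have "\<dots> = (\<integral>\<^sup>+x. f (x + a) \<partial>lborel)"
    by (subst nn_integral_distr) (auto simp: add.commute)
  finally show ?thesis ..
qed

lemma nn_integral_lborel_reflect:
  fixes f :: "'a::euclidean_space \<Rightarrow> ennreal"
  assumes [measurable]: "f \<in> borel_measurable borel"
  shows "(\<integral>\<^sup>+x. f (a - x) \<partial>lborel) = (\<integral>\<^sup>+x. f x \<partial>lborel)"
proof -
  have *: "lborel = distr lborel borel (\<lambda>x. a + (-1) *\<^sub>R x :: 'a)"
    using lborel_affine[of "-1" a] by (simp add: density_1)
  have "(\<integral>\<^sup>+x. f x \<partial>lborel) = (\<integral>\<^sup>+x. f x \<partial>distr lborel borel (\<lambda>x. a + (-1) *\<^sub>R x))"
    using * by simp
  also have "\<dots> = (\<integral>\<^sup>+x. f (a - x) \<partial>lborel)"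
    by (subst nn_integral_distr) auto
  finally show ?thesis ..
qed

text \<open>
  The uniqueness argument for translation-invariant measures: the double integral of
  \<open>f (T x) g (y)\<close> is evaluated in two ways. Shifting \<open>y\<close> by \<open>T x\<close>, and then \<open>x\<close> by
  the \<open>T\<close>-preimage of \<open>y\<close>, moves the variable \<open>y\<close> from \<open>g\<close> to \<open>f\<close>, so that \<open>f \<circ> T\<close> and
  \<open>f\<close> have integrals in the same ratio as \<open>g \<circ> T\<close> and \<open>g\<close>. The unit ball as \<open>g\<close> is
  \<open>T\<close>-invariant, which makes this ratio one.
\<close>

lemma nn_integral_lborel_orthogonal:
  fixes T :: "'a::euclidean_space \<Rightarrow> 'a" and f :: "'a \<Rightarrow> ennreal"
  assumes T: "orthogonal_transformation T" and [measurable]: "f \<in> borel_measurable borel"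
  shows "(\<integral>\<^sup>+x. f (T x) \<partial>lborel) = (\<integral>\<^sup>+x. f x \<partial>lborel)"
proof -
  have [measurable]: "T \<in> borel_measurable borel"
    by (rule borel_measurable_orthogonal_transformation[OF T])
  have lin: "linear T" using T by (rule orthogonal_transformation_linear)
  define g :: "'a \<Rightarrow> ennreal" where "g = indicator (cball 0 1)"
  have [measurable]: "g \<in> borel_measurable borel"
    unfolding g_def by (intro borel_measurable_indicator) simp
  have gT: "g (T x) = g x" for x
    using T by (simp add: g_def indicator_def orthogonal_transformation_norm)
  define v where "v = (\<integral>\<^sup>+x. g x \<partial>lborel)"
  have v: "v = ennreal (unit_ball_vol (real DIM('a)))"
    by (simp add: v_def g_def emeasure_cball)
  have "(\<integral>\<^sup>+x. f (T x) \<partial>lborel) * v = (\<integral>\<^sup>+x. f (T x) * (\<integral>\<^sup>+y. g (y + T x) \<partial>lborel) \<partial>lborel)"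
    by (simp add: nn_integral_lborel_translate v_def nn_integral_multc)
  also have "\<dots> = (\<integral>\<^sup>+x. (\<integral>\<^sup>+y. f (T x) * g (y + T x) \<partial>lborel) \<partial>lborel)"
    by (intro nn_integral_cong) (simp add: nn_integral_cmult)
  also have "\<dots> = (\<integral>\<^sup>+y. (\<integral>\<^sup>+x. f (T x) * g (y + T x) \<partial>lborel) \<partial>lborel)"
    by (rule lborel_pair.Fubini') simp
  also have "\<dots> = (\<integral>\<^sup>+y. (\<integral>\<^sup>+x. f (T x - y) * g (T x) \<partial>lborel) \<partial>lborel)"
  proof (rule nn_integral_cong)
    fix y :: 'a
    have Ti: "T (inv T y) = y"
      using orthogonal_transformation_surj[OF T] by (simp add: surj_f_inv_f)
    show "(\<integral>\<^sup>+x. f (T x) * g (y + T x) \<partial>lborel) = (\<integral>\<^sup>+x. f (T x - y) * g (T x) \<partial>lborel)"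
      using nn_integral_lborel_translate[of "\<lambda>x. f (T x - y) * g (T x)" "inv T y"] lin
      by (simp add: linear_add Ti add.commute)
  qed
  also have "\<dots> = (\<integral>\<^sup>+x. (\<integral>\<^sup>+y. f (T x - y) * g (T x) \<partial>lborel) \<partial>lborel)"
    by (rule lborel_pair.Fubini') simp
  also have "\<dots> = (\<integral>\<^sup>+x. (\<integral>\<^sup>+y. f (T x - y) \<partial>lborel) * g (T x) \<partial>lborel)"
    by (intro nn_integral_cong) (simp add: nn_integral_multc)
  also have "\<dots> = (\<integral>\<^sup>+x. f x \<partial>lborel) * v"
    by (simp add: nn_integral_lborel_reflect gT v_def nn_integral_cmult)
  finally have "(\<integral>\<^sup>+x. f (T x) \<partial>lborel) * v / v = (\<integral>\<^sup>+x. f x \<partial>lborel) * v / v"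
    by simp
  moreover have "unit_ball_vol (real DIM('a)) > 0"
    by (rule unit_ball_vol_pos) simp
  then have "v \<noteq> 0" "v \<noteq> \<top>"
    unfolding v by (auto simp del: unit_ball_vol_pos)
  ultimately show ?thesis
    by (simp add: ennreal_mult_divide_eq)
qed

section \<open>Coordinates with respect to an orthonormal basis\<close>

abbreviation orthonormal :: "'a::euclidean_space set \<Rightarrow> bool" where
  "orthonormal B \<equiv> pairwise orthogonal B \<and> (\<forall>b\<in>B. norm b = 1)"

abbreviation lin_comb :: "'a::euclidean_space set \<Rightarrow> ('a \<Rightarrow> real) \<Rightarrow> 'a" where
  "lin_comb B c \<equiv> (\<Sum>b\<in>B. c b *\<^sub>R b)"

lemma orthonormal_independent:
  assumes "orthonormal B"
  shows "independent B" "finite B" "card B = dim (span B)"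
proof -
  have "0 \<notin> B" using assms by force
  then show i: "independent B"
    using assms by (intro pairwise_orthogonal_independent) auto
  then show "finite B" by (rule independent_imp_finite)
  show "card B = dim (span B)"
    using dim_eq_card_independent[OF i] by simp
qed

lemma orthonormal_inner:
  assumes "orthonormal B" "a \<in> B" "b \<in> B"
  shows "a \<bullet> b = (if a = b then 1 else 0)"
  using assms by (auto simp: pairwise_def orthogonal_def norm_eq_1)

lemma inner_lin_comb:
  assumes "orthonormal B" "a \<in> B"
  shows "lin_comb B c \<bullet> a = c a"
proof -
  have fin: "finite B" using orthonormal_independent[OF assms(1)] by simp
  have "lin_comb B c \<bullet> a = (\<Sum>b\<in>B. if b = a then c b else 0)"
    unfolding inner_sum_left using assms
    by (intro sum.cong) (auto simp: orthonormal_inner[OF assms(1)])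
  then show ?thesis using fin assms by (simp add: sum.delta)
qed

lemma norm_lin_comb:
  assumes "orthonormal B"
  shows "norm (lin_comb B c) = sqrt (\<Sum>b\<in>B. (c b)\<^sup>2)"
proof -
  have "lin_comb B c \<bullet> lin_comb B c = (\<Sum>b\<in>B. (c b)\<^sup>2)"
    unfolding inner_sum_right using inner_lin_comb[OF assms]
    by (auto simp: power2_eq_square intro!: sum.cong)
  then show ?thesis by (simp add: norm_eq_sqrt_inner)
qed

lemma borel_measurable_lin_comb[measurable]:
  "lin_comb B \<in> borel_measurable (\<Pi>\<^sub>M b\<in>B. lborel)"
  by (intro borel_measurable_sum) auto

text \<open>
  Matching the orthonormal basis \<open>B\<close> with the standard one turns the coordinate map into the
  standard coordinate map followed by a rotation, which preserves Lebesgue measure.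
\<close>

lemma nn_integral_coordinates_UNIV:
  fixes f :: "'a::euclidean_space \<Rightarrow> ennreal"
  assumes B: "orthonormal B" "span B = UNIV" and [measurable]: "f \<in> borel_measurable borel"
  shows "(\<integral>\<^sup>+c. f (lin_comb B c) \<partial>(\<Pi>\<^sub>M b\<in>B. lborel)) = (\<integral>\<^sup>+x. f x \<partial>lborel)"
proof -
  interpret product_sigma_finite "\<lambda>_::'a. lborel :: real measure" by standard
  note ind = orthonormal_independent[OF B(1)]
  have fin: "finite B" and card: "card B = DIM('a)"
    using ind B(2) by auto
  obtain h where h: "bij_betw h B (Basis :: 'a set)"
    using fin card finite_same_card_bij[of B "Basis :: 'a set"] by auto
  have hB: "h b \<in> Basis" if "b \<in> B" for b using h that by (auto simp: bij_betw_def)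
  have hinj: "inj_on h B" and him: "h ` B = Basis" using h by (auto simp: bij_betw_def)
  define \<Phi> where "\<Phi> c = (\<Sum>b\<in>B. c b *\<^sub>R h b)" for c
  have [measurable]: "\<Phi> \<in> borel_measurable (\<Pi>\<^sub>M b\<in>B. lborel)"
    unfolding \<Phi>_def[abs_def] by (intro borel_measurable_sum) auto
  have \<Phi>h: "\<Phi> c \<bullet> h a = c a" if "a \<in> B" for a c
  proof -
    have "\<Phi> c \<bullet> h a = (\<Sum>b\<in>B. if b = a then c b else 0)"
      unfolding \<Phi>_def inner_sum_left using that hB hinj
      by (intro sum.cong) (auto simp: inner_Basis inj_on_def)
    then show ?thesis using fin that by (simp add: sum.delta)
  qed
  have M: "lborel = distr (\<Pi>\<^sub>M b\<in>B. lborel) borel \<Phi>"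
  proof (rule lborel_eqI)
    fix l u :: 'a assume lu: "\<And>b. b \<in> Basis \<Longrightarrow> l \<bullet> b \<le> u \<bullet> b"
    have "\<Phi> -` box l u \<inter> space (\<Pi>\<^sub>M b\<in>B. lborel) = (\<Pi>\<^sub>E b\<in>B. {l \<bullet> h b <..< u \<bullet> h b})"
      by (auto simp: space_PiM PiE_def Pi_def mem_box him[symmetric] \<Phi>h)
    then have "emeasure (distr (\<Pi>\<^sub>M b\<in>B. lborel) borel \<Phi>) (box l u) =
      (\<Prod>b\<in>B. emeasure lborel {l \<bullet> h b <..< u \<bullet> h b})"
      by (simp add: emeasure_distr emeasure_PiM fin)
    also have "\<dots> = (\<Prod>b\<in>B. ennreal ((u - l) \<bullet> h b))"
      using lu hB by (intro prod.cong) (auto simp: inner_diff_left)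
    also have "\<dots> = ennreal (\<Prod>b\<in>B. (u - l) \<bullet> h b)"
      using lu hB by (intro prod_ennreal) (auto simp: inner_diff_left)
    also have "(\<Prod>b\<in>B. (u - l) \<bullet> h b) = (\<Prod>b\<in>Basis. (u - l) \<bullet> b)"
      using h by (rule prod.reindex_bij_betw)
    finally show "emeasure (distr (\<Pi>\<^sub>M b\<in>B. lborel) borel \<Phi>) (box l u) = (\<Prod>b\<in>Basis. (u - l) \<bullet> b)" .
  qed simp
  \<comment> \<open>The rotation that carries the standard basis to \<open>B\<close>.\<close>
  define T where "T x = (\<Sum>b\<in>B. (x \<bullet> h b) *\<^sub>R b)" for x
  have T\<Phi>: "T (\<Phi> c) = lin_comb B c" for c
    unfolding T_def by (intro sum.cong) (auto simp: \<Phi>h)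
  have T: "orthogonal_transformation T"
    unfolding orthogonal_transformation
  proof (intro conjI allI)
    show "linear T"
      unfolding T_def
      by (intro linearI) (auto simp: inner_add_left scaleR_add_left sum.distrib scaleR_sum_right)
    fix x :: 'a
    have "norm (T x) = sqrt (\<Sum>b\<in>B. (x \<bullet> h b)\<^sup>2)"
      unfolding T_def using norm_lin_comb[OF B(1)] .
    also have "(\<Sum>b\<in>B. (x \<bullet> h b)\<^sup>2) = (\<Sum>b\<in>Basis. (x \<bullet> b)\<^sup>2)"
      using h by (rule sum.reindex_bij_betw)
    also have "sqrt \<dots> = norm x"
      by (simp add: norm_eq_sqrt_inner euclidean_inner[of x x] power2_eq_square)
    finally show "norm (T x) = norm x" .
  qed
  have [measurable]: "T \<in> borel_measurable borel"
    by (rule borel_measurable_orthogonal_transformation[OF T])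
  have "(\<integral>\<^sup>+c. f (lin_comb B c) \<partial>(\<Pi>\<^sub>M b\<in>B. lborel)) = (\<integral>\<^sup>+x. f (T x) \<partial>distr (\<Pi>\<^sub>M b\<in>B. lborel) borel \<Phi>)"
    by (subst nn_integral_distr) (auto simp: T\<Phi>)
  also have "\<dots> = (\<integral>\<^sup>+x. f x \<partial>lborel)"
    unfolding M[symmetric] by (rule nn_integral_lborel_orthogonal[OF T]) simp
  finally show ?thesis .
qed

text \<open>
  The complement \<open>C\<close> of \<open>B\<close> is an orthonormal basis of the orthogonal complement of \<open>V\<close> in
  \<open>W\<close>.
\<close>

lemma orthonormal_basis_obtain:
  fixes V W :: "'a::euclidean_space set"
  assumes W: "subspace W" and B: "orthonormal B" "span B = V" and "V \<subseteq> W"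
  obtains C where "orthonormal (B \<union> C)" "B \<inter> C = {}" "span (B \<union> C) = W"
    "card C = dim W - dim V" "finite C"
    "\<And>c v. c \<in> C \<Longrightarrow> v \<in> V \<Longrightarrow> v \<bullet> c = 0"
proof -
  have V: "subspace V" using B by (metis subspace_span)
  define U where "U = W \<inter> {u. \<forall>v\<in>V. v \<bullet> u = 0}"
  have "subspace U"
    unfolding U_def using W by (auto simp: subspace_def inner_add_right)
  then obtain C where C: "C \<subseteq> U" "pairwise orthogonal C" "\<And>x. x \<in> C \<Longrightarrow> norm x = 1" "span C = U"
    by (metis orthonormal_basis_subspace)
  have BC: "b \<bullet> c = 0" if "b \<in> V" "c \<in> C" for b c
    using that C by (auto simp: U_def)
  have BV: "B \<subseteq> V" using B span_superset by auto
  have on: "orthonormal (B \<union> C)"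
    using B(1) C BC BV
    by (auto simp: pairwise_def orthogonal_def) (metis inner_commute subsetD)+
  have disj: "B \<inter> C = {}"
  proof (rule ccontr)
    assume "B \<inter> C \<noteq> {}"
    then obtain b where "b \<in> B" "b \<in> C" by auto
    then have "b \<bullet> b = 0" using BC[of b b] BV[THEN subsetD, of b] by simp
    then moreover have "norm b = 1" using B(1) \<open>b \<in> B\<close> by blast
    ultimately show False by (simp add: norm_eq_sqrt_inner)
  qed
  have sp: "span (B \<union> C) = W"
  proof
    show "span (B \<union> C) \<subseteq> W"
      using W BV \<open>V \<subseteq> W\<close> C by (intro span_minimal) (auto simp: U_def)
    show "W \<subseteq> span (B \<union> C)"
    proof
      fix x assume "x \<in> W"
      define p where "p = closest_point V x"
      have p: "p \<in> V" "\<And>v. v \<in> V \<Longrightarrow> (x - p) \<bullet> v = 0"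
        using closest_point_subspace[OF V] by (auto simp: p_def)
      then have "x - p \<in> U"
        using \<open>x \<in> W\<close> \<open>V \<subseteq> W\<close> W by (auto simp: U_def subspace_diff inner_commute)
      then have "p \<in> span (B \<union> C)" "x - p \<in> span (B \<union> C)"
        using p B C by (metis (no_types) span_mono Un_upper1 Un_upper2 subsetD)+
      then have "p + (x - p) \<in> span (B \<union> C)" by (rule span_add)
      then show "x \<in> span (B \<union> C)" by simp
    qed
  qed
  have fin: "finite B" "finite C" using orthonormal_independent[OF on] by auto
  have "card B + card C = dim W"
    using orthonormal_independent[OF on] sp disj fin by (simp add: card_Un_disjoint)
  moreover have "card B = dim V" using orthonormal_independent[OF B(1)] B(2) by simp
  ultimately show ?thesis using that on disj sp fin BC by force
qed

lemma closest_point_span_lin_comb: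
  assumes "orthonormal (B \<union> C)" "B \<inter> C = {}"
  shows "closest_point (span B) (lin_comb B c + lin_comb C d) = lin_comb B c"
proof (rule closest_point_subspace_eqI)
  show "lin_comb B c \<in> span B" by (intro span_sum span_scale span_base)
  fix w assume "w \<in> span B"
  have "orthogonal (lin_comb C d) w"
    using \<open>w \<in> span B\<close>
  proof (rule orthogonal_to_span)
    fix b assume b: "b \<in> B"
    have "lin_comb C d \<bullet> b = (\<Sum>a\<in>C. 0)"
      unfolding inner_sum_left using assms b by (intro sum.cong) (auto simp: orthonormal_inner[OF assms(1)])
    then show "orthogonal (lin_comb C d) b" by (simp add: orthogonal_def)
  qed
  then show "(lin_comb B c + lin_comb C d - lin_comb B c) \<bullet> w = 0"
    by (simp add: orthogonal_def)
qed simp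

lemma nn_integral_lin_comb_Un:
  fixes f :: "'a::euclidean_space \<Rightarrow> ennreal"
  assumes "finite B" "finite C" "B \<inter> C = {}" and [measurable]: "f \<in> borel_measurable borel"
  shows "(\<integral>\<^sup>+c. f (lin_comb (B \<union> C) c) \<partial>(\<Pi>\<^sub>M b\<in>B\<union>C. lborel)) =
    (\<integral>\<^sup>+c. (\<integral>\<^sup>+d. f (lin_comb B c + lin_comb C d) \<partial>(\<Pi>\<^sub>M b\<in>C. lborel)) \<partial>(\<Pi>\<^sub>M b\<in>B. lborel))"
proof -
  interpret product_sigma_finite "\<lambda>_::'a. lborel :: real measure" by standard
  have *: "lin_comb (B \<union> C) (merge B C (c, d)) = lin_comb B c + lin_comb C d" for c d
    using assms by (subst sum.union_disjoint) (auto simp: merge_def intro!: arg_cong2[where f="(+)"] sum.cong)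
  show ?thesis
    using assms(1-3) by (subst product_nn_integral_fold) (auto simp: *)
qed

section \<open>Lebesgue measure on a subspace\<close>

text \<open>
  The uniform probability density on the unit ball of an \<open>m\<close>-dimensional space, but defined on
  the ambient space. It depends on the norm only and integrates to one over every
  \<open>m\<close>-dimensional subspace; these two properties are what it is chosen for.
\<close>

definition ball_weight :: "nat \<Rightarrow> 'a::euclidean_space \<Rightarrow> real" where
  "ball_weight m w = indicator (cball 0 1) w / unit_ball_vol (real m)"

lemma ball_weight_nonneg: "0 \<le> ball_weight m w"
  by (simp add: ball_weight_def)

lemma borel_measurable_ball_weight[measurable]: "ball_weight m \<in> borel_measurable borel"
  unfolding ball_weight_def[abs_def]
  by (intro borel_measurable_divide borel_measurable_indicator) auto

lemma emeasure_lin_comb_cball: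
  assumes "orthonormal C" "r > 0"
  shows "(\<integral>\<^sup>+d. indicator (cball 0 r) (lin_comb C d) \<partial>(\<Pi>\<^sub>M b\<in>C. lborel)) =
    ennreal (unit_ball_vol (real (card C)) * r ^ card C)"
proof -
  have fin: "finite C" using orthonormal_independent[OF assms(1)] by simp
  let ?A = "{f. sqrt (\<Sum>i\<in>C. (f i)\<^sup>2) \<le> r} \<inter> space (\<Pi>\<^sub>M b\<in>C. lborel)"
  have A: "?A = {f \<in> space (\<Pi>\<^sub>M b\<in>C. lborel). sqrt (\<Sum>i\<in>C. (f i)\<^sup>2) \<le> r}" by auto
  have [measurable]: "?A \<in> sets (\<Pi>\<^sub>M b\<in>C. lborel)"
    unfolding A by measurable
  have "(\<integral>\<^sup>+d. indicator (cball 0 r) (lin_comb C d) \<partial>(\<Pi>\<^sub>M b\<in>C. lborel)) =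
    (\<integral>\<^sup>+d. indicator ?A d \<partial>(\<Pi>\<^sub>M b\<in>C. lborel))"
    by (intro nn_integral_cong) (auto simp: indicator_def norm_lin_comb[OF assms(1)])
  also have "\<dots> = emeasure (\<Pi>\<^sub>M b\<in>C. lborel) ?A"
    by (rule nn_integral_indicator) measurable
  also have "\<dots> = ennreal (unit_ball_vol (real (card C)) * r ^ card C)"
    using emeasure_cball_aux[OF fin assms(2)] .
  finally show ?thesis .
qed

lemma nn_integral_ball_weight:
  assumes "orthonormal C"
  shows "(\<integral>\<^sup>+d. ennreal (ball_weight (card C) (lin_comb C d)) \<partial>(\<Pi>\<^sub>M b\<in>C. lborel)) = 1"
proof -
  let ?v = "unit_ball_vol (real (card C))"
  have v: "?v > 0" by (rule unit_ball_vol_pos) simp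
  have *: "ennreal (ball_weight (card C) w) = indicator (cball 0 1) w * ennreal (1 / ?v)" for w :: 'a
    by (auto simp: ball_weight_def indicator_def)
  have m: "(\<lambda>d. indicator (cball 0 1) (lin_comb C d) :: ennreal) \<in> borel_measurable (\<Pi>\<^sub>M b\<in>C. lborel)"
    by (rule measurable_compose[OF borel_measurable_lin_comb]) (intro borel_measurable_indicator, simp)
  have "(\<integral>\<^sup>+d. ennreal (ball_weight (card C) (lin_comb C d)) \<partial>(\<Pi>\<^sub>M b\<in>C. lborel)) = ennreal ?v * ennreal (1 / ?v)"
    unfolding * using emeasure_lin_comb_cball[OF assms, of 1] m by (subst nn_integral_multc) auto
  also have "\<dots> = 1"
    using v by (simp add: ennreal_mult[symmetric] less_imp_le del: unit_ball_vol_pos)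
  finally show ?thesis .
qed

text \<open>
  Integration over a subspace is rewritten as integration over the ambient space: the
  coordinates orthogonal to \<open>\<xi>\<close> are averaged out with a probability density. The right-hand
  side mentions \<open>\<xi>\<close> only through its orthogonal projection. Hence the left-hand side does not
  depend on the basis, and the integral will be a measurable function of \<open>\<xi>\<close>, because the
  Borel structure of the Grassmannian is that of the projection matrices.
\<close>

lemma nn_integral_coordinates_subspace:
  fixes f :: "'a::euclidean_space \<Rightarrow> ennreal"
  assumes B: "orthonormal B" "span B = \<xi>" and [measurable]: "f \<in> borel_measurable borel"
  shows "(\<integral>\<^sup>+c. f (lin_comb B c) \<partial>(\<Pi>\<^sub>M b\<in>B. lborel)) =
    (\<integral>\<^sup>+y. f (closest_point \<xi> y) * ball_weight (DIM('a) - dim \<xi>) (y - closest_point \<xi> y) \<partial>lborel)"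
proof -
  have \<xi>: "subspace \<xi>" using B by (metis subspace_span)
  note [measurable] = borel_measurable_closest_point[OF \<xi>]
  obtain C where C: "orthonormal (B \<union> C)" "B \<inter> C = {}" "span (B \<union> C) = UNIV"
    "card C = dim (UNIV :: 'a set) - dim \<xi>" "finite C" "\<And>c v. c \<in> C \<Longrightarrow> v \<in> \<xi> \<Longrightarrow> v \<bullet> c = 0"
    by (rule orthonormal_basis_obtain[OF subspace_UNIV B subset_UNIV]) (rule that; assumption)
  have onC: "orthonormal C" using C(1) by (auto simp: pairwise_def)
  have fin: "finite B" using orthonormal_independent[OF B(1)] by simp
  let ?g = "\<lambda>y. f (closest_point \<xi> y) * ball_weight (card C) (y - closest_point \<xi> y)"
  have cp: "closest_point \<xi> (lin_comb B c + lin_comb C d) = lin_comb B c" for c d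
    using closest_point_span_lin_comb[OF C(1,2)] B(2) by simp
  have "(\<integral>\<^sup>+y. ?g y \<partial>lborel) = (\<integral>\<^sup>+c. ?g (lin_comb (B \<union> C) c) \<partial>(\<Pi>\<^sub>M b\<in>B\<union>C. lborel))"
    by (rule nn_integral_coordinates_UNIV[symmetric, OF C(1,3)]) simp
  also have "\<dots> = (\<integral>\<^sup>+c. (\<integral>\<^sup>+d. ?g (lin_comb B c + lin_comb C d) \<partial>(\<Pi>\<^sub>M b\<in>C. lborel)) \<partial>(\<Pi>\<^sub>M b\<in>B. lborel))"
    using fin C by (intro nn_integral_lin_comb_Un) auto
  also have "\<dots> = (\<integral>\<^sup>+c. f (lin_comb B c) \<partial>(\<Pi>\<^sub>M b\<in>B. lborel))"
    by (intro nn_integral_cong) (simp add: cp nn_integral_cmult nn_integral_ball_weight[OF onC])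
  finally show ?thesis using C(4) by simp
qed

lemma orthonormal_basis_of_SOME:
  assumes "subspace \<xi>"
  shows "orthonormal (SOME B. orthonormal_basis_of \<xi> B)" "span (SOME B. orthonormal_basis_of \<xi> B) = \<xi>"
proof -
  obtain B where "orthonormal_basis_of \<xi> B"
    using orthonormal_basis_subspace[OF assms] unfolding orthonormal_basis_of_def by metis
  then have "orthonormal_basis_of \<xi> (SOME B. orthonormal_basis_of \<xi> B)" by (rule someI)
  then show "orthonormal (SOME B. orthonormal_basis_of \<xi> B)" "span (SOME B. orthonormal_basis_of \<xi> B) = \<xi>"
    by (auto simp: orthonormal_basis_of_def)
qed

lemma sets_lborel_subspace[measurable_cong]: "sets (lborel_subspace \<xi>) = sets (restrict_space borel \<xi>)"
  and space_lborel_subspace: "space (lborel_subspace \<xi>) = \<xi>"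
  by (auto simp: lborel_subspace_def Let_def space_restrict_space)

lemma measurable_lborel_subspace:
  "f \<in> measurable borel M \<Longrightarrow> f \<in> measurable (lborel_subspace \<xi>) M"
  using measurable_restrict_space1[of f borel M \<xi>] measurable_cong_sets[OF sets_lborel_subspace refl] by blast

lemma nn_integral_lborel_subspace:
  fixes f :: "real ^ 'n \<Rightarrow> ennreal"
  assumes \<xi>: "subspace \<xi>" and [measurable]: "f \<in> borel_measurable borel"
  shows "(\<integral>\<^sup>+y. f y \<partial>lborel_subspace \<xi>) =
    (\<integral>\<^sup>+y. f (closest_point \<xi> y) * ball_weight (CARD('n) - dim \<xi>) (y - closest_point \<xi> y) \<partial>lborel)"
proof -
  define B where "B = (SOME B. orthonormal_basis_of \<xi> B)"
  note B = orthonormal_basis_of_SOME[OF \<xi>, folded B_def]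
  have "lin_comb B c \<in> \<xi>" for c
    unfolding B(2)[symmetric] by (intro span_sum span_scale span_base)
  then have "lin_comb B \<in> measurable (\<Pi>\<^sub>M b\<in>B. lborel) (restrict_space borel \<xi>)"
    by (intro measurable_restrict_space2) auto
  moreover have "f \<in> borel_measurable (restrict_space borel \<xi>)"
    by (intro measurable_restrict_space1) simp
  ultimately have "(\<integral>\<^sup>+y. f y \<partial>lborel_subspace \<xi>) = (\<integral>\<^sup>+c. f (lin_comb B c) \<partial>(\<Pi>\<^sub>M b\<in>B. lborel))"
    unfolding lborel_subspace_def Let_def B_def[symmetric] by (intro nn_integral_distr) simp_all
  then show ?thesis
    using nn_integral_coordinates_subspace[OF B, of f] by simp
qed

text \<open>
  Any orthonormal basis computes the measure, not only the one selected in its definition.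
\<close>

lemma nn_integral_lborel_subspace_coordinates:
  fixes f :: "real ^ 'n \<Rightarrow> ennreal"
  assumes B: "orthonormal B" "span B = \<xi>" and f[measurable]: "f \<in> borel_measurable borel"
  shows "(\<integral>\<^sup>+y. f y \<partial>lborel_subspace \<xi>) = (\<integral>\<^sup>+c. f (lin_comb B c) \<partial>(\<Pi>\<^sub>M b\<in>B. lborel))"
proof -
  have \<xi>: "subspace \<xi>" using B by (metis subspace_span)
  show ?thesis
    using nn_integral_lborel_subspace[OF \<xi> f] nn_integral_coordinates_subspace[OF B f] by simp
qed

lemma nn_integral_lborel_subspace_UNIV:
  fixes f :: "real ^ 'n \<Rightarrow> ennreal"
  assumes f[measurable]: "f \<in> borel_measurable borel"
  shows "(\<integral>\<^sup>+y. f y \<partial>lborel_subspace UNIV) = (\<integral>\<^sup>+y. f y \<partial>lborel)"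
proof -
  obtain B :: "(real ^ 'n) set" where B: "orthonormal B" "span B = UNIV"
    using orthonormal_basis_of_SOME[OF subspace_UNIV] by blast
  show ?thesis
    using nn_integral_lborel_subspace_coordinates[OF B f] nn_integral_coordinates_UNIV[OF B f] by simp
qed

lemma sigma_finite_lborel_subspace:
  fixes \<xi> :: "(real ^ 'n) set"
  assumes \<xi>: "subspace \<xi>"
  shows "sigma_finite_measure (lborel_subspace \<xi>)"
proof
  obtain B :: "(real ^ 'n) set" where B: "orthonormal B" "span B = \<xi>"
    using orthonormal_basis_of_SOME[OF \<xi>] by blast
  define A where "A i = cball 0 (real (Suc i)) \<inter> \<xi>" for i
  have cl: "closed \<xi>" using \<xi> by (rule closed_subspace)
  have A: "A i \<in> sets (lborel_subspace \<xi>)" for i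
    using cl by (auto simp: A_def sets_lborel_subspace sets_restrict_space)
  have "emeasure (lborel_subspace \<xi>) (A i) \<noteq> \<infinity>" for i
  proof -
    have "emeasure (lborel_subspace \<xi>) (A i) = (\<integral>\<^sup>+y. indicator (A i) y \<partial>lborel_subspace \<xi>)"
      using A by simp
    also have "\<dots> = (\<integral>\<^sup>+y. indicator (cball 0 (real (Suc i))) y \<partial>lborel_subspace \<xi>)"
      by (intro nn_integral_cong) (auto simp: A_def space_lborel_subspace indicator_def)
    also have "\<dots> = (\<integral>\<^sup>+c. indicator (cball 0 (real (Suc i))) (lin_comb B c) \<partial>(\<Pi>\<^sub>M b\<in>B. lborel))"
      by (intro nn_integral_lborel_subspace_coordinates[OF B] borel_measurable_indicator) simp
    also have "\<dots> < \<infinity>"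
      by (subst emeasure_lin_comb_cball[OF B(1)]) auto
    finally show ?thesis by simp
  qed
  moreover have "\<Union>(range A) = space (lborel_subspace \<xi>)"
  proof -
    have "\<exists>i. norm x \<le> real (Suc i)" for x :: "real ^ 'n"
      using real_arch_simple[of "norm x"] by (metis le_trans less_eq_real_def linorder_not_le nat_le_linear not_less_eq_eq of_nat_le_iff order_trans)
    then show ?thesis by (auto simp: A_def space_lborel_subspace)
  qed
  ultimately show "\<exists>F. countable F \<and> F \<subseteq> sets (lborel_subspace \<xi>) \<and> \<Union>F = space (lborel_subspace \<xi>) \<and>
      (\<forall>a\<in>F. emeasure (lborel_subspace \<xi>) a \<noteq> \<infinity>)"
    using A by (intro exI[of _ "range A"]) auto
qed

section \<open>Integration in polar coordinates\<close>

text \<open>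
  The surface area of the unit sphere in dimension \<open>m\<close>.
\<close>

definition sphere_area :: "nat \<Rightarrow> real" where
  "sphere_area m = real m * unit_ball_vol (real m)"

lemma sphere_area_pos: "m > 0 \<Longrightarrow> sphere_area m > 0"
  by (simp add: sphere_area_def)

text \<open>
  The norm is distributed with density \<open>sphere_area m * r ^ (m - 1)\<close>, since the ball of radius
  \<open>r\<close> has measure proportional to \<open>r ^ m\<close> and the half-lines \<open>{..r}\<close> determine a measure.
\<close>

lemma distr_norm_lin_comb:
  fixes C :: "'a::euclidean_space set"
  assumes C: "orthonormal C" and m: "card C = m" "m > 0"
  shows "distr (\<Pi>\<^sub>M b\<in>C. lborel) borel (\<lambda>c. norm (lin_comb C c)) =
    density lborel (\<lambda>r. ennreal (sphere_area m * r ^ (m - 1)) * indicator {0..} r)"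
    (is "?M = ?N")
proof (rule measure_eqI_generator_eq)
  have [measurable]: "(\<lambda>c. norm (lin_comb C c)) \<in> borel_measurable (\<Pi>\<^sub>M b\<in>C. lborel)"
    by measurable
  let ?E = "range atMost :: real set set"
  show "Int_stable ?E" by (auto simp: Int_stable_def)
  show "?E \<subseteq> Pow UNIV" by simp
  show "sets ?M = sigma_sets UNIV ?E" "sets ?N = sigma_sets UNIV ?E"
    by (simp_all add: borel_eq_atMost)
  have pos: "emeasure ?M {..r} = ennreal (unit_ball_vol (real m) * r ^ m)" if "r > 0" for r
  proof -
    have "emeasure ?M {..r} = (\<integral>\<^sup>+x. indicator {..r} x \<partial>?M)" by simp
    also have "\<dots> = (\<integral>\<^sup>+c. indicator {..r} (norm (lin_comb C c)) \<partial>(\<Pi>\<^sub>M b\<in>C. lborel))"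
      by (subst nn_integral_distr) auto
    also have "\<dots> = (\<integral>\<^sup>+c. indicator (cball 0 r) (lin_comb C c) \<partial>(\<Pi>\<^sub>M b\<in>C. lborel))"
      by (intro nn_integral_cong) (auto simp: indicator_def)
    finally show ?thesis using emeasure_lin_comb_cball[OF C that] m by simp
  qed
  have N: "emeasure ?N {..r} = ennreal (unit_ball_vol (real m) * r ^ m)" if "r \<ge> 0" for r
  proof -
    have "emeasure ?N {..r} = (\<integral>\<^sup>+x. ennreal (sphere_area m * x ^ (m - 1)) * indicator {0..r} x \<partial>lborel)"
      by (subst emeasure_density) (auto intro!: nn_integral_cong simp: indicator_def)
    also have "\<dots> = unit_ball_vol (real m) * r ^ m - unit_ball_vol (real m) * 0 ^ m"
    proof (rule nn_integral_FTC_Icc)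
      fix x :: real assume "x \<in> {0..r}"
      show "((\<lambda>a. unit_ball_vol (real m) * a ^ m) has_real_derivative sphere_area m * x ^ (m - 1)) (at x)"
        unfolding sphere_area_def by (auto intro!: derivative_eq_intros)
    qed (use that in \<open>auto simp: sphere_area_def\<close>)
    finally show ?thesis using m by (simp add: zero_power)
  qed
  \<comment> \<open>The ball formula covers positive radii only; the remaining half-lines follow by a limit.\<close>
  have neg: "emeasure ?M {..r} = 0" if "r \<le> 0" for r
  proof -
    have small: "emeasure ?M {..r} \<le> ennreal (unit_ball_vol (real m) * e)" if e: "0 < e" "e < 1" for e
    proof -
      have "emeasure ?M {..r} \<le> emeasure ?M {..e}"
        using \<open>r \<le> 0\<close> e by (intro emeasure_mono) auto
      also have "\<dots> \<le> ennreal (unit_ball_vol (real m) * e)"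
        unfolding pos[OF e(1)] using e m power_decreasing[of 1 m e]
        by (intro ennreal_leI mult_left_mono) auto
      finally show ?thesis .
    qed
    have le: "emeasure ?M {..r} \<le> ennreal (unit_ball_vol (real m) * (1 / real (Suc (Suc n))))" for n
      by (rule small) auto
    have "(\<lambda>n. ennreal (unit_ball_vol (real m) * (1 / real (Suc (Suc n))))) \<longlonglongrightarrow> ennreal (unit_ball_vol (real m) * 0)"
      by (intro tendsto_ennrealI tendsto_mult tendsto_const)
         (use LIMSEQ_inverse_real_of_nat[THEN LIMSEQ_Suc] in \<open>simp add: inverse_eq_divide\<close>)
    then have "emeasure ?M {..r} \<le> 0"
      using le by (intro LIMSEQ_le_const) auto
    then show ?thesis by simp
  qed
  show "emeasure ?M X = emeasure ?N X" if "X \<in> ?E" for X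
  proof -
    obtain r where X: "X = {..r}" using \<open>X \<in> ?E\<close> by auto
    consider "r > 0" | "r = 0" | "r < 0" by linarith
    then show ?thesis
    proof cases
      case 3
      have "emeasure ?N {..r} = (\<integral>\<^sup>+x. ennreal (sphere_area m * x ^ (m - 1)) * indicator {0..} x * indicator {..r} x \<partial>lborel)"
        by (rule emeasure_density) simp_all
      also have "\<dots> = (\<integral>\<^sup>+(x::real). 0 \<partial>lborel)"
        by (intro nn_integral_cong) (use 3 in \<open>auto split: split_indicator\<close>)
      finally have "emeasure ?N {..r} = 0" by simp
      then show ?thesis using 3 neg[of r] by (simp add: X)
    qed (use X pos N[of r] neg[of r] m in \<open>auto simp: zero_power\<close>)
  qed
  let ?A = "\<lambda>i. {.. real (Suc i)}"
  show "range ?A \<subseteq> ?E" by auto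
  show "(\<Union>i. ?A i) = UNIV"
  proof -
    have "\<exists>i. x \<le> 1 + real i" for x
      using real_arch_simple[of x] by (metis add.commute add_increasing2 zero_le_one)
    then show ?thesis by auto
  qed
  show "emeasure ?M (?A i) \<noteq> \<infinity>" for i by (subst pos) auto
qed

lemma nn_integral_radial:
  fixes C :: "'a::euclidean_space set" and h :: "real \<Rightarrow> ennreal"
  assumes C: "orthonormal C" and m: "card C = m" "m > 0" and [measurable]: "h \<in> borel_measurable borel"
  shows "(\<integral>\<^sup>+c. h (norm (lin_comb C c)) \<partial>(\<Pi>\<^sub>M b\<in>C. lborel)) =
    (\<integral>\<^sup>+r. ennreal (sphere_area m * r ^ (m - 1)) * indicator {0..} r * h r \<partial>lborel)"
proof -
  have "(\<integral>\<^sup>+c. h (norm (lin_comb C c)) \<partial>(\<Pi>\<^sub>M b\<in>C. lborel)) =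
    (\<integral>\<^sup>+r. h r \<partial>distr (\<Pi>\<^sub>M b\<in>C. lborel) borel (\<lambda>c. norm (lin_comb C c)))"
    by (subst nn_integral_distr) auto
  also have "\<dots> = (\<integral>\<^sup>+r. ennreal (sphere_area m * r ^ (m - 1)) * indicator {0..} r * h r \<partial>lborel)"
    unfolding distr_norm_lin_comb[OF C m] by (subst nn_integral_density) auto
  finally show ?thesis .
qed

section \<open>Adding one vector: the cylindrical integral\<close>

lemma reflection_orthogonal_transformation:
  fixes u :: "'a::euclidean_space"
  shows "orthogonal_transformation (\<lambda>y. y - (2 * (y \<bullet> u) / (u \<bullet> u)) *\<^sub>R u)"
  unfolding orthogonal_transformation_def
proof (intro conjI allI)
  show "linear (\<lambda>y. y - (2 * (y \<bullet> u) / (u \<bullet> u)) *\<^sub>R u)"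
    by (intro linearI) (auto simp: inner_add_left algebra_simps add_divide_distrib)
  fix v w :: 'a
  show "(v - (2 * (v \<bullet> u) / (u \<bullet> u)) *\<^sub>R u) \<bullet> (w - (2 * (w \<bullet> u) / (u \<bullet> u)) *\<^sub>R u) = v \<bullet> w"
    by (cases "u \<bullet> u = 0") (auto simp: inner_diff_left inner_diff_right inner_commute field_simps)
qed

lemma reflection_swaps_equal_norm:
  fixes w w' :: "'a::euclidean_space"
  assumes "norm w = norm w'"
  defines "u \<equiv> w - w'"
  shows "w - (2 * (w \<bullet> u) / (u \<bullet> u)) *\<^sub>R u = w'"
proof (cases "u = 0")
  case False
  have "w \<bullet> w = w' \<bullet> w'" using assms(1) by (simp add: norm_eq)
  then have "2 * (w \<bullet> u) = u \<bullet> u"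
    by (simp add: u_def inner_diff_left inner_diff_right inner_commute)
  then show ?thesis using False by (simp add: u_def)
qed (simp add: u_def)

text \<open>
  The rotations that fix \<open>V\<close> pointwise act transitively on each sphere of the orthogonal
  complement; the reflection in \<open>w - w'\<close> is enough to see this.
\<close>

lemma invariant_fixing_subspace_eq:
  fixes V :: "'a::euclidean_space set" and g :: "'a \<Rightarrow> 'b"
  assumes inv: "\<And>T y. orthogonal_transformation T \<Longrightarrow> (\<And>v. v \<in> V \<Longrightarrow> T v = v) \<Longrightarrow> g (T y) = g y"
    and v: "v \<in> V" and w: "\<And>x. x \<in> V \<Longrightarrow> x \<bullet> w = 0" "\<And>x. x \<in> V \<Longrightarrow> x \<bullet> w' = 0"
    and eq: "norm w = norm w'"
  shows "g (v + w) = g (v + w')"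
proof -
  define u where "u = w - w'"
  define T where "T y = y - (2 * (y \<bullet> u) / (u \<bullet> u)) *\<^sub>R u" for y
  have T: "orthogonal_transformation T"
    unfolding T_def by (rule reflection_orthogonal_transformation)
  have TV: "T x = x" if "x \<in> V" for x
    using w that by (simp add: T_def u_def inner_diff_right)
  have "T w = w'"
    using reflection_swaps_equal_norm[OF eq] by (simp add: T_def u_def)
  then have "T (v + w) = v + w'"
    using TV[OF v] orthogonal_transformation_linear[OF T] by (simp add: linear_add)
  then show ?thesis using inv[OF T TV, of "v + w"] by simp
qed

text \<open>
  An integrand invariant under the rotations fixing \<open>V\<close> depends only on the component in \<open>V\<close>
  and on the distance \<open>r\<close> to \<open>V\<close>. Polar coordinates in the complement of \<open>V\<close> within \<open>\<xi>\<close>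
  therefore reduce the integral over \<open>\<xi>\<close> to one over \<open>V\<close> and \<open>r\<close>. The right-hand side depends
  on \<open>\<xi>\<close> only through \<open>m\<close>, and a power of the distance merely changes the power of \<open>r\<close>; so
  integrals over subspaces of different dimensions become comparable.
\<close>

lemma nn_integral_invariant_cylindrical:
  fixes V \<xi> :: "(real ^ 'n) set" and g :: "real ^ 'n \<Rightarrow> ennreal"
  assumes \<xi>: "subspace \<xi>" and B: "orthonormal B" "span B = V" and V\<xi>: "V \<subseteq> \<xi>"
    and m: "dim \<xi> = dim V + m" "m > 0"
    and u: "norm u = 1" "\<And>v. v \<in> V \<Longrightarrow> v \<bullet> u = 0"
    and g[measurable]: "g \<in> borel_measurable borel"
    and inv: "\<And>T y. orthogonal_transformation T \<Longrightarrow> (\<And>v. v \<in> V \<Longrightarrow> T v = v) \<Longrightarrow> g (T y) = g y"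
  shows "(\<integral>\<^sup>+y. g y * ennreal (norm (y - closest_point V y) ^ s) \<partial>lborel_subspace \<xi>) =
    ennreal (sphere_area m) * (\<integral>\<^sup>+c. (\<integral>\<^sup>+r. ennreal (r ^ (m - 1 + s)) * indicator {0..} r * g (lin_comb B c + r *\<^sub>R u)
      \<partial>lborel) \<partial>(\<Pi>\<^sub>M b\<in>B. lborel))"
proof -
  have V: "subspace V" using B by (metis subspace_span)
  note [measurable] = borel_measurable_closest_point[OF V]
  obtain C where C: "orthonormal (B \<union> C)" "B \<inter> C = {}" "span (B \<union> C) = \<xi>"
    "card C = dim \<xi> - dim V" "finite C" "\<And>c v. c \<in> C \<Longrightarrow> v \<in> V \<Longrightarrow> v \<bullet> c = 0"
    by (rule orthonormal_basis_obtain[OF \<xi> B V\<xi>]) (rule that; assumption)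
  have onC: "orthonormal C" using C(1) by (auto simp: pairwise_def)
  have finB: "finite B" using orthonormal_independent[OF B(1)] by simp
  have cC: "card C = m" using C(4) m by simp
  let ?h = "\<lambda>y. g y * ennreal (norm (y - closest_point V y) ^ s)"
  have h: "?h (lin_comb B c + lin_comb C d) = (\<lambda>r. g (lin_comb B c + r *\<^sub>R u) * ennreal (r ^ s)) (norm (lin_comb C d))"
    for c d
  proof -
    have "closest_point V (lin_comb B c + lin_comb C d) = lin_comb B c"
      using closest_point_span_lin_comb[OF C(1,2)] B(2) by simp
    moreover have "g (lin_comb B c + lin_comb C d) = g (lin_comb B c + norm (lin_comb C d) *\<^sub>R u)"
    proof (rule invariant_fixing_subspace_eq[where V = V])
      show "lin_comb B c \<in> V"
        unfolding B(2)[symmetric] by (intro span_sum span_scale span_base)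
      show "x \<bullet> lin_comb C d = 0" if "x \<in> V" for x
        using that C(6) by (simp add: inner_sum_right)
    qed (use inv u in auto)
    ultimately show ?thesis by simp
  qed
  have "(\<integral>\<^sup>+y. ?h y \<partial>lborel_subspace \<xi>) = (\<integral>\<^sup>+c. ?h (lin_comb (B \<union> C) c) \<partial>(\<Pi>\<^sub>M b\<in>B\<union>C. lborel))"
    by (rule nn_integral_lborel_subspace_coordinates[OF C(1,3)]) simp
  also have "\<dots> = (\<integral>\<^sup>+c. (\<integral>\<^sup>+d. ?h (lin_comb B c + lin_comb C d) \<partial>(\<Pi>\<^sub>M b\<in>C. lborel)) \<partial>(\<Pi>\<^sub>M b\<in>B. lborel))"
    using finB C by (intro nn_integral_lin_comb_Un) auto
  also have "\<dots> = (\<integral>\<^sup>+c. (\<integral>\<^sup>+r. ennreal (sphere_area m * r ^ (m - 1)) * indicator {0..} r *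
      (g (lin_comb B c + r *\<^sub>R u) * ennreal (r ^ s)) \<partial>lborel) \<partial>(\<Pi>\<^sub>M b\<in>B. lborel))"
    unfolding h by (intro nn_integral_cong nn_integral_radial[OF onC cC m(2)]) simp
  also have "\<dots> = (\<integral>\<^sup>+c. (\<integral>\<^sup>+r. ennreal (sphere_area m) * (ennreal (r ^ (m - 1 + s)) * indicator {0..} r *
      g (lin_comb B c + r *\<^sub>R u)) \<partial>lborel) \<partial>(\<Pi>\<^sub>M b\<in>B. lborel))"
    using sphere_area_pos[OF m(2)]
    by (intro nn_integral_cong) (auto simp: indicator_def ennreal_mult power_add mult_ac)
  also have "\<dots> = (\<integral>\<^sup>+c. ennreal (sphere_area m) * (\<integral>\<^sup>+r. (ennreal (r ^ (m - 1 + s)) * indicator {0..} r *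
      g (lin_comb B c + r *\<^sub>R u)) \<partial>lborel) \<partial>(\<Pi>\<^sub>M b\<in>B. lborel))"
    by (intro nn_integral_cong nn_integral_cmult) simp
  also have "\<dots> = ennreal (sphere_area m) * (\<integral>\<^sup>+c. (\<integral>\<^sup>+r. ennreal (r ^ (m - 1 + s)) * indicator {0..} r * g (lin_comb B c + r *\<^sub>R u)
      \<partial>lborel) \<partial>(\<Pi>\<^sub>M b\<in>B. lborel))"
    by (rule nn_integral_cmult) measurable
  finally show ?thesis .
qed

text \<open>
  The formula for a single column, relative to the span \<open>V\<close> of the columns already treated:
  the weight \<open>r ^ (n - k)\<close> makes up for the difference between the radial densities in
  dimensions \<open>n - dim V\<close> and \<open>k - dim V\<close>.
\<close>

lemma nn_integral_lborel_eq_subspace: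
  fixes V \<xi> :: "(real ^ 'n) set" and g :: "real ^ 'n \<Rightarrow> ennreal"
  assumes \<xi>: "subspace \<xi>" and V: "subspace V" "V \<subseteq> \<xi>" "dim V < dim \<xi>"
    and g[measurable]: "g \<in> borel_measurable borel"
    and inv: "\<And>T y. orthogonal_transformation T \<Longrightarrow> (\<And>v. v \<in> V \<Longrightarrow> T v = v) \<Longrightarrow> g (T y) = g y"
  shows "(\<integral>\<^sup>+y. g y \<partial>lborel) =
    ennreal (sphere_area (CARD('n) - dim V) / sphere_area (dim \<xi> - dim V)) *
    (\<integral>\<^sup>+y. g y * ennreal (norm (y - closest_point V y) ^ (CARD('n) - dim \<xi>)) \<partial>lborel_subspace \<xi>)"
proof -
  obtain B :: "(real ^ 'n) set" where B: "orthonormal B" "span B = V"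
    using orthonormal_basis_of_SOME[OF V(1)] by blast
  have "span V \<subset> span \<xi>" using V \<xi> by (auto simp: span_eq_iff[THEN iffD2])
  then obtain x where x: "x \<noteq> 0" "x \<in> span \<xi>" "\<And>y. y \<in> span V \<Longrightarrow> orthogonal x y"
    by (rule orthogonal_to_subspace_exists_gen) (rule that; assumption)
  define u where "u = x /\<^sub>R norm x"
  have u: "norm u = 1" "v \<bullet> u = 0" if "v \<in> V" for v
    using x that by (auto simp: u_def orthogonal_def span_base inner_commute)
  have u1: "norm u = 1" using x by (simp add: u_def)
  define k d n where "k = dim \<xi>" and "d = dim V" and "n = CARD('n)"
  have kd: "d < k" "k \<le> n" using V(3) dim_subset_UNIV_cart[of \<xi>] by (auto simp: k_def d_def n_def)
  let ?I = "\<lambda>e. \<integral>\<^sup>+c. (\<integral>\<^sup>+r. ennreal (r ^ e) * indicator {0..} r * g (lin_comb B c + r *\<^sub>R u)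
      \<partial>lborel) \<partial>(\<Pi>\<^sub>M b\<in>B. lborel)"
  have K: "(\<integral>\<^sup>+y. g y * ennreal (norm (y - closest_point V y) ^ s) \<partial>lborel_subspace \<eta>) =
      ennreal (sphere_area m) * ?I (m - 1 + s)"
    if "subspace \<eta>" "V \<subseteq> \<eta>" "dim \<eta> = dim V + m" "m > 0" for \<eta> m s
    using that(1) B that(2-) u1 u(2) g
    by (rule nn_integral_invariant_cylindrical) (assumption, rule inv)
  have 1: "(\<integral>\<^sup>+y. g y \<partial>lborel) = ennreal (sphere_area (n - d)) * ?I (n - d - 1)"
    using K[OF subspace_UNIV subset_UNIV, of "n - d" 0] kd
    by (simp add: nn_integral_lborel_subspace_UNIV k_def d_def n_def)
  have "k - d - 1 + (n - k) = n - d - 1" using kd by simp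
  then have 2: "(\<integral>\<^sup>+y. g y * ennreal (norm (y - closest_point V y) ^ (n - k)) \<partial>lborel_subspace \<xi>) =
    ennreal (sphere_area (k - d)) * ?I (n - d - 1)"
    using K[OF \<xi> V(2), of "k - d" "n - k"] kd
    by (simp add: k_def d_def n_def)
  have pos: "sphere_area (n - d) > 0" "sphere_area (k - d) > 0"
    using kd by (auto intro: sphere_area_pos)
  have "ennreal (sphere_area (n - d) / sphere_area (k - d)) * ennreal (sphere_area (k - d)) = ennreal (sphere_area (n - d))"
    using pos by (subst ennreal_mult[symmetric]) auto
  then show ?thesis
    unfolding 1 k_def[symmetric] d_def[symmetric] n_def[symmetric] 2
    by (simp add: mult.assoc[symmetric])
qed

section \<open>Gram determinants\<close>

text \<open>
  The Gram matrix of the family \<open>x\<close> restricted to \<open>S\<close>, padded by the identity. The padding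
  keeps the determinant of the principal minor and gives all minors the same type, so that the
  columns can be added one at a time.
\<close>

definition gram :: "'q set \<Rightarrow> ('q \<Rightarrow> 'a::euclidean_space) \<Rightarrow> real ^ 'q ^ 'q" where
  "gram S x = (\<chi> i j. if i \<in> S \<and> j \<in> S then x i \<bullet> x j else if i = j then 1 else 0)"

definition gram_vol :: "'q::finite set \<Rightarrow> ('q \<Rightarrow> 'a::euclidean_space) \<Rightarrow> real" where
  "gram_vol S x = sqrt (det (gram S x))"

text \<open>
  The squared volume grows by the squared distance of the new vector to the span of the old
  ones. The projection \<open>p\<close> of \<open>x a\<close> is a combination of the \<open>x i\<close>, and subtracting the
  corresponding combination of rows leaves only the diagonal entry \<open>|w|\<^sup>2\<close> in row \<open>a\<close>. In the
  transposed matrix the same combination of rows clears the remaining entries of index \<open>a\<close>.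
\<close>

lemma det_gram_insert:
  fixes x :: "'q::finite \<Rightarrow> 'a::euclidean_space"
  assumes a: "a \<notin> S"
  shows "det (gram (insert a S) x) =
    (norm (x a - closest_point (span (x ` S)) (x a)))\<^sup>2 * det (gram S x)"
proof -
  define p where "p = closest_point (span (x ` S)) (x a)"
  define w where "w = x a - p"
  define A where "A = gram (insert a S) x"
  define G where "G = gram S x"
  have p: "p \<in> span (x ` S)" and wS: "\<And>v. v \<in> span (x ` S) \<Longrightarrow> w \<bullet> v = 0"
    using closest_point_subspace[OF subspace_span] by (auto simp: p_def w_def)
  have wx: "w \<bullet> x i = 0" if "i \<in> S" for i
    using that by (intro wS span_base) auto
  obtain c where c: "p = (\<Sum>i\<in>S. c i *\<^sub>R x i)"
  proof -
    have "\<exists>c. p = (\<Sum>i\<in>S. c i *\<^sub>R x i)"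
      using p
    proof (induction rule: span_induct_alt)
      case base
      show ?case by (intro exI[of _ "\<lambda>_. 0"]) simp
    next
      case (step r v y)
      then obtain j c where j: "j \<in> S" "v = x j" and c: "y = (\<Sum>i\<in>S. c i *\<^sub>R x i)" by auto
      have "(\<Sum>i\<in>S. (if i = j then r else 0) *\<^sub>R x i) = (\<Sum>i\<in>S. if i = j then r *\<^sub>R x j else 0)"
        by (intro sum.cong) auto
      then have "r *\<^sub>R v + y = (\<Sum>i\<in>S. ((if i = j then r else 0) + c i) *\<^sub>R x i)"
        using j by (simp add: c scaleR_add_left sum.distrib sum.delta)
      then show ?case by (rule exI[of _ "\<lambda>i. (if i = j then r else 0) + c i"])
    qed
    then show ?thesis using that by blast
  qed
  have wa: "w \<bullet> x a = (norm w)\<^sup>2"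
    using wS[OF p] by (simp add: w_def power2_norm_eq_inner inner_diff_left inner_diff_right)
  let ?r = "(norm w)\<^sup>2 *s axis a 1 :: real ^ 'q"
  have in_span: "(\<Sum>i\<in>S. c i *s row i M) \<in> vec.span {row j M |j. j \<noteq> a}" for M :: "real ^ 'q ^ 'q"
    using a by (intro vec.span_sum vec.span_scale vec.span_base) auto
  have r: "?r = row a A - (\<Sum>i\<in>S. c i *s row i A)"
  proof (subst vec_eq_iff, rule allI)
    fix j
    show "?r $ j = (row a A - (\<Sum>i\<in>S. c i *s row i A)) $ j"
    proof (cases "j \<in> insert a S")
      case True
      have "(row a A - (\<Sum>i\<in>S. c i *s row i A)) $ j = x a \<bullet> x j - (\<Sum>i\<in>S. c i * (x i \<bullet> x j))"
        using True by (simp add: A_def gram_def row_def)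
      also have "\<dots> = w \<bullet> x j"
        by (simp add: w_def c inner_diff_left inner_sum_left)
      also have "\<dots> = ?r $ j"
        using True wx wa a by (auto simp: axis_def)
      finally show ?thesis ..
    next
      case False
      have "(\<Sum>i\<in>S. c i * A $ i $ j) = (\<Sum>i\<in>S. 0)"
        using False by (intro sum.cong) (auto simp: A_def gram_def)
      then show ?thesis
        using False by (auto simp: A_def gram_def row_def axis_def)
    qed
  qed
  \<comment> \<open>Row operations isolate the factor \<open>|w|\<^sup>2\<close>; \<open>A2\<close> is what remains of the matrix.\<close>
  define A2 where "A2 = (\<chi> k. if k = a then axis a 1 else row k A)"
  have "det A = det (\<chi> k. if k = a then row a A + - (\<Sum>i\<in>S. c i *s row i A) else row k A)"
    by (rule det_row_span[symmetric]) (intro vec.span_neg in_span)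
  also have "(\<chi> k. if k = a then row a A + - (\<Sum>i\<in>S. c i *s row i A) else row k A) =
    (\<chi> k. if k = a then ?r else row k A)"
    unfolding r diff_conv_add_uminus ..
  also have "det \<dots> = (norm w)\<^sup>2 * det A2"
    unfolding A2_def by (rule det_row_mul)
  finally have 1: "det A = (norm w)\<^sup>2 * det A2" .
  have rowa: "transpose A2 $ a = row a G + (\<Sum>i\<in>S. c i *s row i G)"
  proof (subst vec_eq_iff, rule allI)
    fix j
    show "transpose A2 $ a $ j = (row a G + (\<Sum>i\<in>S. c i *s row i G)) $ j"
    proof (cases "j \<in> S")
      case True
      then have "transpose A2 $ a $ j = x j \<bullet> x a"
        using a by (auto simp: transpose_def A2_def A_def gram_def row_def)
      also have "\<dots> = x j \<bullet> p"
        using wx[OF True] by (simp add: w_def inner_diff_left inner_commute[of "x j"])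
      also have "\<dots> = (\<Sum>i\<in>S. c i * (x i \<bullet> x j))"
        by (simp add: c inner_sum_right inner_commute)
      also have "\<dots> = (row a G + (\<Sum>i\<in>S. c i *s row i G)) $ j"
        using True a by (auto simp: G_def gram_def row_def)
      finally show ?thesis .
    next
      case False
      have "(\<Sum>i\<in>S. c i * G $ i $ j) = (\<Sum>i\<in>S. 0)"
        using False by (intro sum.cong) (auto simp: G_def gram_def)
      then show ?thesis
        using False a by (auto simp: G_def gram_def row_def transpose_def A2_def A_def axis_def)
    qed
  qed
  have "transpose A2 = (\<chi> k. if k = a then row a G + (\<Sum>i\<in>S. c i *s row i G) else row k G)"
  proof (subst vec_eq_iff, rule allI)
    fix k
    show "transpose A2 $ k = (\<chi> k. if k = a then row a G + (\<Sum>i\<in>S. c i *s row i G) else row k G) $ k"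
    proof (cases "k = a")
      case True
      then show ?thesis using rowa by simp
    next
      case False
      then show ?thesis
        using a by (auto simp: vec_eq_iff transpose_def A2_def A_def G_def gram_def row_def axis_def inner_commute)
    qed
  qed
  then have "det (transpose A2) = det G"
    by (simp add: det_row_span[OF in_span])
  then show ?thesis
    using 1 by (simp add: A_def G_def w_def p_def)
qed

lemma gram_cong: "(\<And>i. i \<in> S \<Longrightarrow> x i = y i) \<Longrightarrow> gram S x = gram S y"
  by (auto simp: gram_def vec_eq_iff)

lemma gram_vol_empty [simp]: "gram_vol {} x = 1"
proof -
  have "gram {} x = mat 1" by (simp add: gram_def mat_def)
  then show ?thesis by (simp add: gram_vol_def)
qed

lemma gram_vol_insert:
  assumes "a \<notin> S"
  shows "gram_vol (insert a S) x = norm (x a - closest_point (span (x ` S)) (x a)) * gram_vol S x"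
  unfolding gram_vol_def det_gram_insert[OF assms] by (simp add: real_sqrt_mult)

lemma gram_vol_nonneg: "0 \<le> gram_vol S x"
proof -
  have "finite S" by simp
  then show ?thesis
    by induction (auto simp: gram_vol_insert)
qed

lemma gram_vol_nonzero_dim:
  fixes x :: "'q::finite \<Rightarrow> 'a::euclidean_space"
  assumes "gram_vol S x \<noteq> 0"
  shows "dim (span (x ` S)) = card S"
proof -
  have "finite S" by simp
  then show ?thesis using assms
  proof (induction S)
    case (insert a S)
    then have "gram_vol S x \<noteq> 0" and "x a \<noteq> closest_point (span (x ` S)) (x a)"
      by (auto simp: gram_vol_insert)
    then have "x a \<notin> span (x ` S)"
      using closest_point_subspace_self[OF subspace_span] by metis
    then show ?case
      using insert \<open>gram_vol S x \<noteq> 0\<close> by (simp add: dim_insert)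
  qed simp
qed

lemma gram_vol_UNIV: "gram_vol UNIV x = column_volume (matrix_of_columns x)"
proof -
  have "gram UNIV x = transpose (matrix_of_columns x) ** matrix_of_columns x"
    by (simp add: gram_def vec_eq_iff matrix_of_columns_def matrix_matrix_mult_def transpose_def inner_vec_def)
  then show ?thesis by (simp add: gram_vol_def column_volume_def)
qed

lemma borel_measurable_gram_vol[measurable]:
  "gram_vol S \<in> borel_measurable (Pi\<^sub>M S (\<lambda>_. borel))"
proof -
  have "(\<lambda>x. gram S x $ i $ j) \<in> borel_measurable (Pi\<^sub>M S (\<lambda>_. borel))" for i j
    by (cases "i \<in> S \<and> j \<in> S") (auto simp: gram_def)
  then have "(\<lambda>x. det (gram S x)) \<in> borel_measurable (Pi\<^sub>M S (\<lambda>_. borel))"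
    unfolding det_def
    by (intro borel_measurable_sum borel_measurable_times borel_measurable_prod) auto
  then show ?thesis
    unfolding gram_vol_def[abs_def] by measurable
qed

section \<open>Rotation-invariant functions of several columns\<close>

lemma measurable_PiM_lborel_subspace:
  assumes f: "f \<in> measurable (Pi\<^sub>M S (\<lambda>_. borel)) N"
  shows "f \<in> measurable (Pi\<^sub>M S (\<lambda>_. lborel_subspace \<xi>)) N"
proof -
  have "(\<lambda>x. \<lambda>i\<in>S. x i) \<in> measurable (Pi\<^sub>M S (\<lambda>_. lborel_subspace \<xi>)) (Pi\<^sub>M S (\<lambda>_. borel))"
  proof (rule measurable_restrict)
    fix i assume "i \<in> S"
    then have "(\<lambda>x. x i) \<in> measurable (Pi\<^sub>M S (\<lambda>_. lborel_subspace \<xi>)) (lborel_subspace \<xi>)"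
      by (rule measurable_component_singleton)
    moreover have "(\<lambda>y. y) \<in> measurable (lborel_subspace \<xi>) borel"
      by (rule measurable_lborel_subspace) simp
    ultimately show "(\<lambda>x. x i) \<in> measurable (Pi\<^sub>M S (\<lambda>_. lborel_subspace \<xi>)) borel"
      by (rule measurable_compose)
  qed
  from measurable_compose[OF this f]
  have "(\<lambda>x. f (restrict x S)) \<in> measurable (Pi\<^sub>M S (\<lambda>_. lborel_subspace \<xi>)) N" .
  moreover have "f (restrict x S) = f x" if "x \<in> space (Pi\<^sub>M S (\<lambda>_. lborel_subspace \<xi>))" for x
    using that by (simp add: space_PiM PiE_restrict)
  ultimately show ?thesis
    by (subst measurable_cong) auto
qed

text \<open>
  For a rotation-invariant integrand each single \<open>\<xi>\<close> gives the formula. The columns are moved into \<open>\<xi>\<close> one at a time. Integrating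
  out the last column leaves a rotation-invariant function of the others, to which the
  induction hypothesis applies; with the others fixed in \<open>\<xi>\<close>, the integrand is invariant under
  the rotations that fix their span, so that the single-column formula applies, and the distance
  to this span completes the volume factor. If the columns are dependent, their volume is zero
  and both sides vanish, unless \<open>\<xi>\<close> is the whole space, where the formula is trivial.

  The hypothesis of invariance compares \<open>x\<close> and \<open>y\<close> on \<open>S\<close> only, because the points of the
  product space have the value \<open>undefined\<close> off \<open>S\<close>, which \<open>T\<close> need not preserve. For
  \<open>T = id\<close> it says that \<open>f\<close> depends on the columns in \<open>S\<close> alone.
\<close>

lemma nn_integral_columns_subspace:
  fixes \<xi> :: "(real ^ 'n) set" and f :: "('q::finite \<Rightarrow> real ^ 'n) \<Rightarrow> ennreal"
  assumes \<xi>: "subspace \<xi>" and "card S \<le> dim \<xi>"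
    and "f \<in> borel_measurable (Pi\<^sub>M S (\<lambda>_. borel))"
    and "\<And>T x y. orthogonal_transformation T \<Longrightarrow> (\<And>i. i \<in> S \<Longrightarrow> y i = T (x i)) \<Longrightarrow> f y = f x"
  shows "(\<integral>\<^sup>+x. f x \<partial>(\<Pi>\<^sub>M j\<in>S. lborel)) =
    ennreal (\<Prod>j<card S. sphere_area (CARD('n) - j) / sphere_area (dim \<xi> - j)) *
    (\<integral>\<^sup>+x. f x * ennreal (gram_vol S x ^ (CARD('n) - dim \<xi>)) \<partial>(\<Pi>\<^sub>M j\<in>S. lborel_subspace \<xi>))"
proof -
  let ?s = "CARD('n) - dim \<xi>"
  let ?R = "\<lambda>j. sphere_area (CARD('n) - j) / sphere_area (dim \<xi> - j)"
  let ?L = "\<lambda>S. \<Pi>\<^sub>M j\<in>S. (lborel :: (real ^ 'n) measure)" and ?X = "\<lambda>S. \<Pi>\<^sub>M j\<in>S. lborel_subspace \<xi>"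
  interpret L: product_sigma_finite "\<lambda>_::'q. lborel :: (real ^ 'n) measure" by standard
  interpret X: product_sigma_finite "\<lambda>_::'q. lborel_subspace \<xi>"
    by (simp add: product_sigma_finite_def sigma_finite_lborel_subspace[OF \<xi>])
  have kn: "dim \<xi> \<le> CARD('n)" by (rule dim_subset_UNIV_cart)
  have R_nonneg: "?R j \<ge> 0" for j by (simp add: sphere_area_def)
  have "finite S" by simp
  then show ?thesis
    using assms(2-)
  proof (induction S arbitrary: f)
    case empty
    show ?case by (simp add: L.nn_integral_empty X.nn_integral_empty)
  next
    case (insert a S f)
    note f[measurable] = insert.prems(2) and inv = insert.prems(3)
    have cS: "card S < dim \<xi>" using insert by simp
    have upd[measurable]: "(\<lambda>y. f (x(a := y))) \<in> borel_measurable borel"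
      if "x \<in> space (\<Pi>\<^sub>M j\<in>S. (borel :: (real ^ 'n) measure))" for x
      using measurable_compose[OF measurable_component_update[OF that insert.hyps(2)] f] .
    have pair[measurable]: "(\<lambda>(x, y). f (x(a := y))) \<in> borel_measurable (Pi\<^sub>M S (\<lambda>_. borel) \<Otimes>\<^sub>M borel)"
      using measurable_compose[OF measurable_add_dim f] by (simp add: case_prod_unfold)
    define f1 where "f1 x = (\<integral>\<^sup>+y. f (x(a := y)) \<partial>lborel)" for x
    have f1: "f1 \<in> borel_measurable (Pi\<^sub>M S (\<lambda>_. borel))"
      unfolding f1_def[abs_def]
      by (rule lborel.borel_measurable_nn_integral) (use pair in \<open>simp add: case_prod_unfold\<close>)
    have spX: "x \<in> space (\<Pi>\<^sub>M j\<in>S. (borel :: (real ^ 'n) measure))" if "x \<in> space (?X S)" for x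
      using that by (auto simp: space_PiM)
    have f_ext: "f y = f x" if "\<And>i. i \<in> insert a S \<Longrightarrow> y i = x i" for x y
      using that by (intro inv[of "\<lambda>x. x"]) auto
    have f1_inv: "f1 y = f1 x" if T: "orthogonal_transformation T" and y: "\<And>i. i \<in> S \<Longrightarrow> y i = T (x i)" for T x y
    proof -
      define x' where "x' = restrict x S"
      define y' where "y' = restrict y S"
      have m: "(\<lambda>z. f (y'(a := z))) \<in> borel_measurable borel"
        by (rule upd) (auto simp: y'_def space_PiM)
      have "f1 y = (\<integral>\<^sup>+z. f (y'(a := z)) \<partial>lborel)"
        unfolding f1_def by (intro nn_integral_cong f_ext) (auto simp: y'_def)
      also have "\<dots> = (\<integral>\<^sup>+z. f (y'(a := T z)) \<partial>lborel)"
        by (rule nn_integral_lborel_orthogonal[OF T m, symmetric])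
      also have "\<dots> = (\<integral>\<^sup>+z. f (x(a := z)) \<partial>lborel)"
        using insert.hyps(2)
        by (intro nn_integral_cong inv[OF T]) (auto simp: y'_def y)
      finally show ?thesis by (simp add: f1_def)
    qed
    have col: "f1 x * ennreal (gram_vol S x ^ ?s) = ennreal (?R (card S)) *
        (\<integral>\<^sup>+y. f (x(a := y)) * ennreal (gram_vol (insert a S) (x(a := y)) ^ ?s) \<partial>lborel_subspace \<xi>)"
      if x: "x \<in> space (?X S)" for x
    proof -
      define V where "V = span (x ` S)"
      have V: "subspace V" by (simp add: V_def)
      have V\<xi>: "V \<subseteq> \<xi>"
        unfolding V_def using x \<xi> by (intro span_minimal) (auto simp: space_PiM space_lborel_subspace)
      note [measurable] = borel_measurable_closest_point[OF V] upd[OF spX[OF x]]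
      have gv: "gram_vol (insert a S) (x(a := y)) = norm (y - closest_point V y) * gram_vol S x" for y
      proof -
        have "x(a := y) ` S = x ` S" using insert.hyps by auto
        moreover have "gram S (x(a := y)) = gram S x" using insert.hyps by (intro gram_cong) auto
        ultimately show ?thesis
          unfolding gram_vol_insert[OF insert.hyps(2)] by (simp add: V_def gram_vol_def)
      qed
      have "f1 x * ennreal (gram_vol S x ^ ?s) = ennreal (?R (card S)) *
        (\<integral>\<^sup>+y. f (x(a := y)) * ennreal (norm (y - closest_point V y) ^ ?s) \<partial>lborel_subspace \<xi>) * ennreal (gram_vol S x ^ ?s)"
      proof -
        \<comment> \<open>Dependent columns have no span of dimension \<open>card S\<close>, but then their volume is zero.\<close>
        consider "dim \<xi> = CARD('n)" | "?s > 0" "gram_vol S x = 0" | "gram_vol S x \<noteq> 0"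
          using kn by linarith
        then show ?thesis
        proof cases
          case 1
          then have "\<xi> = UNIV" using \<xi> by (metis dim_eq_full span_eq_iff DIM_cart DIM_real mult.right_neutral)
          moreover have "?R (card S) = 1"
            using sphere_area_pos[of "dim \<xi> - card S"] cS 1 by simp
          ultimately show ?thesis using 1
            by (simp add: nn_integral_lborel_subspace_UNIV f1_def)
        next
          case 2
          then show ?thesis by (simp add: zero_power)
        next
          case 3
          then have dV: "dim V = card S"
            unfolding V_def by (rule gram_vol_nonzero_dim)
          have "f1 x = ennreal (sphere_area (CARD('n) - dim V) / sphere_area (dim \<xi> - dim V)) *
            (\<integral>\<^sup>+y. f (x(a := y)) * ennreal (norm (y - closest_point V y) ^ ?s) \<partial>lborel_subspace \<xi>)"
            unfolding f1_def
          proof (rule nn_integral_lborel_eq_subspace[OF \<xi> V V\<xi>])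
            fix T y assume T: "orthogonal_transformation T" and TV: "\<And>v. v \<in> V \<Longrightarrow> T v = v"
            show "f (x(a := T y)) = f (x(a := y))"
            proof (rule inv[OF T])
              fix i assume i: "i \<in> insert a S"
              have "T (x i) = x i" if "i \<in> S"
                using that TV by (auto simp: V_def intro: span_base)
              then show "(x(a := T y)) i = T ((x(a := y)) i)" using i insert.hyps by auto
            qed
          qed (use dV cS in auto)
          then show ?thesis by (simp add: dV)
        qed
      qed
      also have "\<dots> = ennreal (?R (card S)) *
        (\<integral>\<^sup>+y. f (x(a := y)) * ennreal (norm (y - closest_point V y) ^ ?s) * ennreal (gram_vol S x ^ ?s) \<partial>lborel_subspace \<xi>)"
        by (subst nn_integral_multc) (auto simp: mult.assoc intro!: measurable_lborel_subspace)
      also have "(\<lambda>y. f (x(a := y)) * ennreal (norm (y - closest_point V y) ^ ?s) * ennreal (gram_vol S x ^ ?s)) =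
        (\<lambda>y. f (x(a := y)) * ennreal (gram_vol (insert a S) (x(a := y)) ^ ?s))"
        by (auto simp: gv power_mult_distrib ennreal_mult gram_vol_nonneg mult.assoc)
      finally show ?thesis .
    qed
    have "(\<integral>\<^sup>+x. f x \<partial>?L (insert a S)) = (\<integral>\<^sup>+x. f1 x \<partial>?L S)"
      unfolding f1_def using insert.hyps f by (subst L.product_nn_integral_insert) (auto simp: measurable_cong_sets[OF sets_PiM_cong[OF refl sets_lborel] refl])
    also have "\<dots> = ennreal (\<Prod>j<card S. ?R j) *
      (\<integral>\<^sup>+x. f1 x * ennreal (gram_vol S x ^ ?s) \<partial>?X S)"
      using cS by (intro insert.IH f1 f1_inv) auto
    also have "(\<integral>\<^sup>+x. f1 x * ennreal (gram_vol S x ^ ?s) \<partial>?X S) =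
      (\<integral>\<^sup>+x. ennreal (?R (card S)) *
        (\<integral>\<^sup>+y. f (x(a := y)) * ennreal (gram_vol (insert a S) (x(a := y)) ^ ?s) \<partial>lborel_subspace \<xi>) \<partial>?X S)"
      by (intro nn_integral_cong col)
    also have "\<dots> = ennreal (?R (card S)) *
      (\<integral>\<^sup>+x. f x * ennreal (gram_vol (insert a S) x ^ ?s) \<partial>?X (insert a S))"
    proof -
      have F: "(\<lambda>x. f x * ennreal (gram_vol (insert a S) x ^ ?s)) \<in> borel_measurable (?X (insert a S))"
        by (rule measurable_PiM_lborel_subspace) measurable
      have add: "(\<lambda>(x, y). x(a := y)) \<in> measurable (?X S \<Otimes>\<^sub>M lborel_subspace \<xi>) (?X (insert a S))"
        by (rule measurable_add_dim)
      have "(\<lambda>x. \<integral>\<^sup>+y. f (x(a := y)) * ennreal (gram_vol (insert a S) (x(a := y)) ^ ?s) \<partial>lborel_subspace \<xi>)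
        \<in> borel_measurable (?X S)"
        using measurable_compose[OF add F]
        by (intro sigma_finite_measure.borel_measurable_nn_integral sigma_finite_lborel_subspace[OF \<xi>])
           (simp add: case_prod_unfold)
      then show ?thesis
        using insert.hyps F by (simp add: X.product_nn_integral_insert nn_integral_cmult)
    qed
    finally show ?case
      using insert.hyps by (simp add: mult.assoc[symmetric] ennreal_mult[symmetric] prod_nonneg R_nonneg mult.commute)
  qed
qed

section \<open>Products of subspace measures\<close>

lemma distr_PiM_componentwise:
  assumes I: "finite I" and M: "sigma_finite_measure M" and N: "sigma_finite_measure N"
    and t[measurable]: "t \<in> measurable M N" and eq: "distr M N t = N"
  shows "distr (\<Pi>\<^sub>M i\<in>I. M) (\<Pi>\<^sub>M i\<in>I. N) (\<lambda>x. \<lambda>i\<in>I. t (x i)) = (\<Pi>\<^sub>M i\<in>I. N)"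
proof -
  interpret M: product_sigma_finite "\<lambda>_. M" by (simp add: product_sigma_finite_def M)
  interpret N: product_sigma_finite "\<lambda>_. N" by (simp add: product_sigma_finite_def N)
  have t': "(\<lambda>x. \<lambda>i\<in>I. t (x i)) \<in> measurable (\<Pi>\<^sub>M i\<in>I. M) (\<Pi>\<^sub>M i\<in>I. N)"
    by measurable
  show ?thesis
  proof (rule N.PiM_eqI[OF I])
    fix A assume A: "\<And>i. i \<in> I \<Longrightarrow> A i \<in> sets N"
    have "(\<lambda>x. \<lambda>i\<in>I. t (x i)) -` Pi\<^sub>E I A \<inter> space (\<Pi>\<^sub>M i\<in>I. M) = (\<Pi>\<^sub>E i\<in>I. t -` A i \<inter> space M)"
      by (auto simp: space_PiM PiE_def Pi_def)
    then have "emeasure (distr (\<Pi>\<^sub>M i\<in>I. M) (\<Pi>\<^sub>M i\<in>I. N) (\<lambda>x. \<lambda>i\<in>I. t (x i))) (Pi\<^sub>E I A) =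
      (\<Prod>i\<in>I. emeasure M (t -` A i \<inter> space M))"
      using A I t' by (subst emeasure_distr) (auto intro!: M.emeasure_PiM sets_PiM_I_finite)
    also have "\<dots> = (\<Prod>i\<in>I. emeasure (distr M N t) (A i))"
      using A by (intro prod.cong) (auto simp: emeasure_distr)
    finally show "emeasure (distr (\<Pi>\<^sub>M i\<in>I. M) (\<Pi>\<^sub>M i\<in>I. N) (\<lambda>x. \<lambda>i\<in>I. t (x i))) (Pi\<^sub>E I A) =
      (\<Prod>i\<in>I. emeasure N (A i))"
      by (simp add: eq)
  qed simp
qed

lemma distr_lborel_orthogonal:
  fixes T :: "'a::euclidean_space \<Rightarrow> 'a"
  assumes T: "orthogonal_transformation T"
  shows "distr lborel lborel T = lborel"
proof (rule measure_eqI)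
  note [measurable] = borel_measurable_orthogonal_transformation[OF T]
  fix A assume "A \<in> sets (distr lborel lborel T)"
  then have A[measurable]: "A \<in> sets borel" by simp
  have "emeasure (distr lborel lborel T) A = (\<integral>\<^sup>+x. indicator A x \<partial>distr lborel lborel T)"
    by simp
  also have "\<dots> = (\<integral>\<^sup>+x. indicator A (T x) \<partial>lborel)"
    by (subst nn_integral_distr) auto
  also have "\<dots> = emeasure lborel A"
    by (subst nn_integral_lborel_orthogonal[OF T]) auto
  finally show "emeasure (distr lborel lborel T) A = emeasure lborel A" .
qed simp

lemma dim_orthogonal_image:
  fixes T :: "'a::euclidean_space \<Rightarrow> 'a"
  assumes "orthogonal_transformation T"
  shows "dim (T ` \<xi>) = dim \<xi>"
  using assms by (intro dim_image_eq orthogonal_transformation_linear inj_on_subset[OF orthogonal_transformation_inj]) auto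

lemma emeasure_lborel_subspace:
  fixes \<xi> :: "(real ^ 'n) set"
  assumes \<xi>: "subspace \<xi>" and A: "A \<in> sets (lborel_subspace \<xi>)"
  shows "A \<in> sets borel" "emeasure (lborel_subspace \<xi>) A =
    (\<integral>\<^sup>+y. indicator A (closest_point \<xi> y) * ennreal (ball_weight (CARD('n) - dim \<xi>) (y - closest_point \<xi> y)) \<partial>lborel)"
proof -
  have "\<xi> \<in> sets borel" using closed_subspace[OF \<xi>] by simp
  then show A'[measurable]: "A \<in> sets borel"
    using A by (auto simp: sets_lborel_subspace sets_restrict_space)
  show "emeasure (lborel_subspace \<xi>) A =
    (\<integral>\<^sup>+y. indicator A (closest_point \<xi> y) * ennreal (ball_weight (CARD('n) - dim \<xi>) (y - closest_point \<xi> y)) \<partial>lborel)"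
    using A by (subst nn_integral_lborel_subspace[OF \<xi>, symmetric]) auto
qed

lemma distr_lborel_subspace_orthogonal:
  fixes T :: "real ^ 'n \<Rightarrow> real ^ 'n"
  assumes T: "orthogonal_transformation T" and \<xi>: "subspace \<xi>"
  shows "T \<in> measurable (lborel_subspace \<xi>) (lborel_subspace (T ` \<xi>))"
    "distr (lborel_subspace \<xi>) (lborel_subspace (T ` \<xi>)) T = lborel_subspace (T ` \<xi>)"
proof -
  have lin: "linear T" using T by (rule orthogonal_transformation_linear)
  have T\<xi>: "subspace (T ` \<xi>)" using lin \<xi> by (rule linear_subspace_image)
  note [measurable] = borel_measurable_orthogonal_transformation[OF T]
    borel_measurable_closest_point[OF \<xi>] borel_measurable_closest_point[OF T\<xi>]
  have "T \<in> measurable (lborel_subspace \<xi>) (restrict_space borel (T ` \<xi>))"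
    by (rule measurable_restrict_space2) (auto simp: space_lborel_subspace intro!: measurable_lborel_subspace)
  then show m: "T \<in> measurable (lborel_subspace \<xi>) (lborel_subspace (T ` \<xi>))"
    using measurable_cong_sets[OF refl sets_lborel_subspace] by blast
  show "distr (lborel_subspace \<xi>) (lborel_subspace (T ` \<xi>)) T = lborel_subspace (T ` \<xi>)"
  proof (rule measure_eqI)
    fix A assume "A \<in> sets (distr (lborel_subspace \<xi>) (lborel_subspace (T ` \<xi>)) T)"
    then have A: "A \<in> sets (lborel_subspace (T ` \<xi>))" by simp
    note [measurable] = emeasure_lborel_subspace(1)[OF T\<xi> A]
    have w: "ball_weight m (T z) = ball_weight m z" for m z
      using T by (simp add: ball_weight_def indicator_def orthogonal_transformation_norm)
    have "emeasure (lborel_subspace (T ` \<xi>)) A =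
      (\<integral>\<^sup>+y. indicator A (closest_point (T ` \<xi>) (T y)) *
        ennreal (ball_weight (CARD('n) - dim \<xi>) (T y - closest_point (T ` \<xi>) (T y))) \<partial>lborel)"
      unfolding emeasure_lborel_subspace(2)[OF T\<xi> A] dim_orthogonal_image[OF T]
      by (subst nn_integral_lborel_orthogonal[OF T]) auto
    also have "\<dots> = (\<integral>\<^sup>+y. indicator A (T (closest_point \<xi> y)) *
        ennreal (ball_weight (CARD('n) - dim \<xi>) (y - closest_point \<xi> y)) \<partial>lborel)"
      by (simp add: closest_point_orthogonal_image[OF \<xi> T] linear_diff[OF lin, symmetric] w)
    also have "\<dots> = (\<integral>\<^sup>+y. indicator A (T y) \<partial>lborel_subspace \<xi>)"
      by (subst nn_integral_lborel_subspace[OF \<xi>]) auto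
    also have "\<dots> = (\<integral>\<^sup>+y. indicator A y \<partial>distr (lborel_subspace \<xi>) (lborel_subspace (T ` \<xi>)) T)"
      using A m by (subst nn_integral_distr) auto
    also have "\<dots> = emeasure (distr (lborel_subspace \<xi>) (lborel_subspace (T ` \<xi>)) T) A"
      using A by simp
    finally show "emeasure (distr (lborel_subspace \<xi>) (lborel_subspace (T ` \<xi>)) T) A =
      emeasure (lborel_subspace (T ` \<xi>)) A" ..
  qed simp
qed

text \<open>
  The averaging formula for one subspace, for all columns at once and as an identity of
  measures, so that it serves non-negative and vector-valued integrands alike.
\<close>

lemma PiM_lborel_subspace_eq_distr:
  fixes \<xi> :: "(real ^ 'n) set" and S :: "'q::finite set"
  assumes \<xi>: "subspace \<xi>"
  shows "(\<lambda>y. \<lambda>i\<in>S. closest_point \<xi> (y i)) \<in> measurable (\<Pi>\<^sub>M i\<in>S. lborel) (\<Pi>\<^sub>M i\<in>S. lborel_subspace \<xi>)"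
    "(\<Pi>\<^sub>M i\<in>S. lborel_subspace \<xi>) =
      distr (density (\<Pi>\<^sub>M i\<in>S. lborel) (\<lambda>y. ennreal (\<Prod>i\<in>S. ball_weight (CARD('n) - dim \<xi>) (y i - closest_point \<xi> (y i)))))
        (\<Pi>\<^sub>M i\<in>S. lborel_subspace \<xi>) (\<lambda>y. \<lambda>i\<in>S. closest_point \<xi> (y i))"
proof -
  interpret L: product_sigma_finite "\<lambda>_::'q. lborel :: (real ^ 'n) measure" by standard
  interpret X: product_sigma_finite "\<lambda>_::'q. lborel_subspace \<xi>"
    by (simp add: product_sigma_finite_def sigma_finite_lborel_subspace[OF \<xi>])
  note [measurable] = borel_measurable_closest_point[OF \<xi>]
  let ?w = "\<lambda>z. ball_weight (CARD('n) - dim \<xi>) (z - closest_point \<xi> z)"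
  have "closest_point \<xi> \<in> measurable borel (restrict_space borel \<xi>)"
    using closest_point_mem_subspace[OF \<xi>] by (intro measurable_restrict_space2) auto
  then have cp[measurable]: "closest_point \<xi> \<in> measurable borel (lborel_subspace \<xi>)"
    using measurable_cong_sets[OF refl sets_lborel_subspace] by blast
  show P[measurable]: "(\<lambda>y. \<lambda>i\<in>S. closest_point \<xi> (y i)) \<in> measurable (\<Pi>\<^sub>M i\<in>S. lborel) (\<Pi>\<^sub>M i\<in>S. lborel_subspace \<xi>)"
    by measurable
  show "(\<Pi>\<^sub>M i\<in>S. lborel_subspace \<xi>) =
      distr (density (\<Pi>\<^sub>M i\<in>S. lborel) (\<lambda>y. ennreal (\<Prod>i\<in>S. ?w (y i))))
        (\<Pi>\<^sub>M i\<in>S. lborel_subspace \<xi>) (\<lambda>y. \<lambda>i\<in>S. closest_point \<xi> (y i))" (is "_ = ?D")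
  proof (rule X.PiM_eqI[symmetric])
    fix A assume A: "\<And>i. i \<in> S \<Longrightarrow> A i \<in> sets (lborel_subspace \<xi>)"
    have A': "A i \<in> sets borel" if "i \<in> S" for i
      using emeasure_lborel_subspace(1)[OF \<xi> A[OF that]] .
    have AE: "Pi\<^sub>E S A \<in> sets (\<Pi>\<^sub>M i\<in>S. lborel_subspace \<xi>)"
      using A by (intro sets_PiM_I_finite) auto
    have "emeasure ?D (Pi\<^sub>E S A) = (\<integral>\<^sup>+x. indicator (Pi\<^sub>E S A) x \<partial>?D)"
      using AE by simp
    also have "\<dots> = (\<integral>\<^sup>+y. ennreal (\<Prod>i\<in>S. ?w (y i)) *
        indicator (Pi\<^sub>E S A) (\<lambda>i\<in>S. closest_point \<xi> (y i)) \<partial>(\<Pi>\<^sub>M i\<in>S. lborel))"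
      using AE by (subst nn_integral_distr, simp, simp, subst nn_integral_density) (auto intro!: measurable_compose[OF P])
    also have "\<dots> = (\<integral>\<^sup>+y. (\<Prod>i\<in>S. indicator (A i) (closest_point \<xi> (y i)) * ennreal (?w (y i))) \<partial>(\<Pi>\<^sub>M i\<in>S. lborel))"
    proof (intro nn_integral_cong)
      fix y :: "'q \<Rightarrow> real ^ 'n"
      have "indicator (Pi\<^sub>E S A) (\<lambda>i\<in>S. closest_point \<xi> (y i)) = (\<Prod>i\<in>S. indicator (A i) (closest_point \<xi> (y i)) :: ennreal)"
        by (auto simp: indicator_def PiE_def Pi_def prod_eq_1_iff prod_zero_iff intro!: prod_zero[symmetric])
      then show "ennreal (\<Prod>i\<in>S. ?w (y i)) * indicator (Pi\<^sub>E S A) (\<lambda>i\<in>S. closest_point \<xi> (y i)) =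
        (\<Prod>i\<in>S. indicator (A i) (closest_point \<xi> (y i)) * ennreal (?w (y i)))"
        by (simp add: prod.distrib prod_ennreal ball_weight_nonneg mult.commute)
    qed
    also have "\<dots> = (\<Prod>i\<in>S. \<integral>\<^sup>+y. indicator (A i) (closest_point \<xi> y) * ennreal (?w y) \<partial>lborel)"
      by (rule L.product_nn_integral_prod) (use A' in auto)
    also have "\<dots> = (\<Prod>i\<in>S. emeasure (lborel_subspace \<xi>) (A i))"
      using emeasure_lborel_subspace(2)[OF \<xi> A] by (intro prod.cong) auto
    finally show "emeasure ?D (Pi\<^sub>E S A) = (\<Prod>i\<in>S. emeasure (lborel_subspace \<xi>) (A i))" .
  qed simp_all
qed

lemma gram_vol_orthogonal:
  assumes "orthogonal_transformation T"
  shows "gram_vol S (\<lambda>i. T (x i)) = gram_vol S x"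
proof -
  have "gram S (\<lambda>i. T (x i)) = gram S x"
    using assms by (simp add: gram_def orthogonal_transformation_def vec_eq_iff)
  then show ?thesis by (simp add: gram_vol_def)
qed

section \<open>The Borel structure of the Grassmannian\<close>

lemma borel_measurable_vec_iff:
  fixes f :: "'a \<Rightarrow> 'b::euclidean_space ^ 'n"
  shows "f \<in> borel_measurable M \<longleftrightarrow> (\<forall>i. (\<lambda>x. f x $ i) \<in> borel_measurable M)"
proof
  assume f: "f \<in> borel_measurable M"
  have "(\<lambda>v :: 'b ^ 'n. v $ i) \<in> borel_measurable borel" for i
    by (intro borel_measurable_continuous_onI continuous_on_component continuous_on_id)
  then show "\<forall>i. (\<lambda>x. f x $ i) \<in> borel_measurable M"
    using measurable_compose[OF f] by blast
next
  assume "\<forall>i. (\<lambda>x. f x $ i) \<in> borel_measurable M"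
  then show "f \<in> borel_measurable M"
    by (subst borel_measurable_euclidean_space)
       (auto simp: Basis_vec_def inner_axis intro!: borel_measurable_inner)
qed

lemma borel_measurable_vec_nth[measurable (raw)]:
  fixes f :: "'a \<Rightarrow> 'b::euclidean_space ^ 'n"
  shows "f \<in> borel_measurable M \<Longrightarrow> (\<lambda>x. f x $ i) \<in> borel_measurable M"
  by (simp add: borel_measurable_vec_iff)

lemma borel_measurable_matrix_vector_mult[measurable (raw)]:
  fixes A :: "'a \<Rightarrow> real ^ 'm ^ 'n" and x :: "'a \<Rightarrow> real ^ 'm"
  assumes [measurable]: "A \<in> borel_measurable M" "x \<in> borel_measurable M"
  shows "(\<lambda>z. A z *v x z) \<in> borel_measurable M"
  by (subst borel_measurable_vec_iff) (simp add: matrix_vector_mult_def)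

lemma grassmann_opens_subset: "{U. openin (grassmann_topology k) U} \<subseteq> Pow (grassmannian k)"
  by (auto simp: grassmann_topology_def openin_pullback_topology)

lemma space_grassmann_borel: "space (grassmann_borel k) = grassmannian k"
  unfolding grassmann_borel_def using grassmann_opens_subset by (rule space_measure_of)

lemma sets_grassmann_borel:
  "sets (grassmann_borel k) = sigma_sets (grassmannian k) {U. openin (grassmann_topology k) U}"
  unfolding grassmann_borel_def using grassmann_opens_subset by (rule sets_measure_of)

text \<open>
  The topology of the Grassmannian is pulled back along the projection matrix, so measurability
  into it is measurability of that matrix.
\<close>

lemma measurable_grassmann_borelI:
  fixes g :: "'a \<Rightarrow> (real ^ 'n) set"
  assumes "\<And>x. x \<in> space M \<Longrightarrow> g x \<in> grassmannian k"
    and [measurable]: "(\<lambda>x. matrix (closest_point (g x))) \<in> borel_measurable M"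
  shows "g \<in> measurable M (grassmann_borel k)"
  unfolding grassmann_borel_def
proof (rule measurable_measure_of)
  show "{U. openin (grassmann_topology k) U} \<subseteq> Pow (grassmannian k :: (real ^ 'n) set set)"
    by (rule grassmann_opens_subset)
  show "g \<in> space M \<rightarrow> grassmannian k" using assms by auto
  fix U :: "(real ^ 'n) set set" assume "U \<in> {U. openin (grassmann_topology k) U}"
  then obtain V :: "(real ^ 'n ^ 'n) set" where V: "open V"
    and U: "U = (\<lambda>\<xi>. matrix (closest_point \<xi>)) -` V \<inter> grassmannian k"
    by (auto simp: grassmann_topology_def openin_pullback_topology)
  have "g -` U \<inter> space M = (\<lambda>x. matrix (closest_point (g x))) -` V \<inter> space M"
    using assms(1) by (auto simp: U)
  then show "g -` U \<inter> space M \<in> sets M"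
    using V measurable_sets[OF assms(2), of V] by simp
qed

lemma borel_measurable_projection_matrix[measurable]:
  "(\<lambda>\<xi>. matrix (closest_point \<xi>)) \<in> borel_measurable (grassmann_borel k)"
proof (rule borel_measurableI)
  fix V :: "(real ^ 'a ^ 'a) set" assume "open V"
  then have "openin (grassmann_topology k) ((\<lambda>\<xi>. matrix (closest_point \<xi>)) -` V \<inter> grassmannian k)"
    by (auto simp: grassmann_topology_def openin_pullback_topology)
  then show "(\<lambda>\<xi>. matrix (closest_point \<xi>)) -` V \<inter> space (grassmann_borel k) \<in> sets (grassmann_borel k)"
    by (auto simp: space_grassmann_borel sets_grassmann_borel)
qed

lemma grassmannianD: "\<xi> \<in> grassmannian k \<Longrightarrow> subspace \<xi>" "\<xi> \<in> grassmannian k \<Longrightarrow> dim \<xi> = k"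
  by (auto simp: grassmannian_def)

lemma closest_point_eq_matrix:
  "subspace \<xi> \<Longrightarrow> closest_point \<xi> y = matrix (closest_point \<xi>) *v (y :: real ^ 'n)"
  using matrix_vector_mul(2)[OF linear_closest_point] by metis

lemma borel_measurable_closest_point_pair:
  fixes \<xi> :: "'a \<Rightarrow> (real ^ 'n) set"
  assumes [measurable]: "\<xi> \<in> measurable M (grassmann_borel k)" "y \<in> borel_measurable M"
  shows "(\<lambda>z. closest_point (\<xi> z) (y z)) \<in> borel_measurable M"
proof -
  have "closest_point (\<xi> z) (y z) = matrix (closest_point (\<xi> z)) *v y z" if "z \<in> space M" for z
    using measurable_space[OF assms(1) that] by (intro closest_point_eq_matrix) (simp add: space_grassmann_borel grassmannianD)
  moreover have "(\<lambda>z. matrix (closest_point (\<xi> z)) *v y z) \<in> borel_measurable M"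
    by measurable
  ultimately show ?thesis by (subst measurable_cong) auto
qed

section \<open>A random rotation from Gram-Schmidt orthogonalisation\<close>

text \<open>
  The Gram-Schmidt step, written with the projection onto the span of all previous vectors
  instead of a recursion. This makes the equivariance under rotations immediate.
\<close>

definition gs_residual :: "(nat \<Rightarrow> 'a::euclidean_space) \<Rightarrow> nat \<Rightarrow> 'a" where
  "gs_residual v i = v i - closest_point (span (v ` {..<i})) (v i)"

text \<open>
  The update formula for projections. If \<open>a\<close> already lies in the span then \<open>w = 0\<close>, and the
  correction term vanishes because \<open>0 / 0 = 0\<close>.
\<close>

lemma closest_point_span_insert:
  fixes a y :: "'a::euclidean_space" and A :: "'a set"
  defines "w \<equiv> a - closest_point (span A) a"
  shows "closest_point (span (insert a A)) y = closest_point (span A) y + ((y \<bullet> w) / (w \<bullet> w)) *\<^sub>R w"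
proof (rule closest_point_subspace_eqI)
  let ?P = "closest_point (span A)"
  note m = closest_point_mem_subspace[OF subspace_span, of A]
  note o = closest_point_residual_orthogonal[OF subspace_span, of _ A]
  have sub: "span A \<subseteq> span (insert a A)" by (intro span_mono) auto
  have wA: "w \<bullet> v = 0" if "v \<in> span A" for v
    using o[OF that] by (simp add: w_def)
  have w: "w \<in> span (insert a A)"
    unfolding w_def
  proof (rule span_diff)
    show "a \<in> span (insert a A)" by (simp add: span_base)
    show "?P a \<in> span (insert a A)" using m sub by blast
  qed
  show "subspace (span (insert a A))" by simp
  show "?P y + ((y \<bullet> w) / (w \<bullet> w)) *\<^sub>R w \<in> span (insert a A)"
    using m sub w by (intro span_add span_scale) auto
  let ?r = "y - (?P y + ((y \<bullet> w) / (w \<bullet> w)) *\<^sub>R w)"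
  have rA: "?r \<bullet> v = 0" if "v \<in> span A" for v
    using o[OF that, of y] wA[OF that] by (simp add: inner_diff_left inner_add_left)
  have rw: "?r \<bullet> w = 0"
  proof -
    have "?P y \<bullet> w = 0" using wA[OF m, of y] by (simp add: inner_commute)
    then show ?thesis by (cases "w = 0") (simp_all add: inner_diff_left inner_add_left)
  qed
  have "orthogonal ?r v" if "v \<in> span (insert a A)" for v
    using that
  proof (rule orthogonal_to_span)
    fix x assume "x \<in> insert a A"
    then show "orthogonal ?r x"
    proof
      assume "x = a"
      then have "x = w + ?P a" by (simp add: w_def)
      then show ?thesis using rA[OF m] rw by (simp add: orthogonal_def inner_add_right)
    next
      assume "x \<in> A"
      then show ?thesis using rA by (simp add: orthogonal_def span_base)
    qed
  qed
  then show "?r \<bullet> v = 0" if "v \<in> span (insert a A)" for v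
    using that by (simp add: orthogonal_def)
qed

text \<open>
  The span varies with \<open>v\<close>. The update formula builds the projection onto it from arithmetic
  operations, adding one vector at a time.
\<close>

lemma borel_measurable_closest_point_span:
  fixes Y :: "(nat \<Rightarrow> 'a::euclidean_space) \<Rightarrow> 'a"
  assumes "i \<le> n" "Y \<in> borel_measurable (\<Pi>\<^sub>M j\<in>{..<n}. borel)"
  shows "(\<lambda>v. closest_point (span (v ` {..<i})) (Y v)) \<in> borel_measurable (\<Pi>\<^sub>M j\<in>{..<n}. borel)"
  using assms
proof (induction i arbitrary: Y)
  case 0
  have "closest_point {0} y = (0 :: 'a)" for y
    using closest_point_mem_subspace[OF subspace_single_0, of y] by simp
  then show ?case by simp
next
  case (Suc i)
  note [measurable] = Suc.prems(2)
  have vi[measurable]: "(\<lambda>v. v i) \<in> borel_measurable (\<Pi>\<^sub>M j\<in>{..<n}. (borel :: 'a measure))"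
    using Suc.prems by (intro measurable_component_singleton) auto
  have [measurable]: "(\<lambda>v. closest_point (span (v ` {..<i})) (Y v)) \<in> borel_measurable (\<Pi>\<^sub>M j\<in>{..<n}. borel)"
    "(\<lambda>v. closest_point (span (v ` {..<i})) (v i :: 'a)) \<in> borel_measurable (\<Pi>\<^sub>M j\<in>{..<n}. borel)"
    using Suc.IH[OF _ Suc.prems(2)] Suc.IH[OF _ vi] Suc.prems(1) by simp_all
  show ?case
    unfolding lessThan_Suc image_insert closest_point_span_insert
    by measurable
qed

lemma borel_measurable_gs_residual:
  assumes "i < n"
  shows "(\<lambda>v. gs_residual v i :: 'a::euclidean_space) \<in> borel_measurable (\<Pi>\<^sub>M j\<in>{..<n}. borel)"
proof -
  have [measurable]: "(\<lambda>v. v i) \<in> borel_measurable (\<Pi>\<^sub>M j\<in>{..<n}. (borel :: 'a measure))"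
    using assms by (intro measurable_component_singleton) auto
  note [measurable] = borel_measurable_closest_point_span[of i n "\<lambda>v. v i"]
  show ?thesis
    unfolding gs_residual_def using assms by simp
qed

lemma gs_residual_orthogonal:
  assumes "i < j"
  shows "gs_residual v i \<bullet> gs_residual v j = 0"
proof -
  have "span (v ` {..<i}) \<subseteq> span (v ` {..<j})" using assms by (intro span_mono) auto
  then have "gs_residual v i \<in> span (v ` {..<j})"
    unfolding gs_residual_def
  proof (intro span_diff)
    show "v i \<in> span (v ` {..<j})" using assms by (intro span_base) auto
    show "closest_point (span (v ` {..<i})) (v i) \<in> span (v ` {..<j})"
      using \<open>span (v ` {..<i}) \<subseteq> span (v ` {..<j})\<close> closest_point_mem_subspace[OF subspace_span] by blast
  qed
  then show ?thesis
    using closest_point_residual_orthogonal[OF subspace_span] by (simp add: gs_residual_def inner_commute)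
qed

lemma gs_residual_orthogonal_image:
  fixes T :: "'a::euclidean_space \<Rightarrow> 'a"
  assumes T: "orthogonal_transformation T" and "\<And>j. j \<le> i \<Longrightarrow> v' j = T (v j)"
  shows "gs_residual v' i = T (gs_residual v i)"
proof -
  have lin: "linear T" using T by (rule orthogonal_transformation_linear)
  have "v' ` {..<i} = T ` v ` {..<i}"
    using assms(2) by (auto simp: image_image intro!: image_cong)
  then have "span (v' ` {..<i}) = T ` span (v ` {..<i})"
    using span_linear_image[OF lin] by simp
  moreover have "closest_point (T ` span (v ` {..<i})) (T (v i)) = T (closest_point (span (v ` {..<i})) (v i))"
    using subspace_span T by (rule closest_point_orthogonal_image)
  ultimately show ?thesis
    by (simp add: gs_residual_def assms(2) linear_diff[OF lin])
qed

text \<open>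
  Fixes the order in which the Gram-Schmidt vectors become matrix rows.
\<close>

definition row_index :: "'n::finite \<Rightarrow> nat" where
  "row_index = (SOME h. bij_betw h UNIV {..<CARD('n)})"

lemma bij_betw_row_index: "bij_betw (row_index :: 'n::finite \<Rightarrow> nat) UNIV {..<CARD('n)}"
proof -
  have "\<exists>h :: 'n \<Rightarrow> nat. bij_betw h UNIV {..<CARD('n)}"
    by (rule finite_same_card_bij) auto
  then show ?thesis unfolding row_index_def by (rule someI_ex)
qed

lemma row_index_less: "row_index (i :: 'n::finite) < CARD('n)"
  using bij_betw_row_index by (auto simp: bij_betw_def)

lemma row_index_eq_iff: "row_index i = row_index j \<longleftrightarrow> i = j"
  using bij_betw_row_index by (auto simp: bij_betw_def inj_on_def)

definition gs_independent :: "(nat \<Rightarrow> real ^ 'n) \<Rightarrow> bool" where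
  "gs_independent v \<longleftrightarrow> (\<forall>i<CARD('n). gs_residual v i \<noteq> 0)"

text \<open>
  The orthogonal matrix whose rows are the orthonormalised vectors. Dependent families, which
  are negligible, receive the identity, so that the matrix is orthogonal in all cases.
\<close>

definition gs_matrix :: "(nat \<Rightarrow> real ^ 'n) \<Rightarrow> real ^ 'n ^ 'n" where
  "gs_matrix v = (if gs_independent v
     then (\<chi> i. gs_residual v (row_index i) /\<^sub>R norm (gs_residual v (row_index i))) else mat 1)"

lemma orthogonal_matrix_gs_matrix:
  fixes v :: "nat \<Rightarrow> real ^ 'n"
  shows "orthogonal_matrix (gs_matrix v)"
proof (cases "gs_independent v")
  case True
  then have nz: "gs_residual v (row_index i) \<noteq> 0" for i :: 'n
    using row_index_less by (auto simp: gs_independent_def)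
  have orth: "gs_residual v (row_index i) \<bullet> gs_residual v (row_index j) = 0" if "i \<noteq> j" for i j :: 'n
    using that row_index_eq_iff[of i j] gs_residual_orthogonal[of "row_index i" "row_index j" v]
      gs_residual_orthogonal[of "row_index j" "row_index i" v]
    by (metis inner_commute nat_neq_iff)
  have "row i (gs_matrix v) = gs_residual v (row_index i) /\<^sub>R norm (gs_residual v (row_index i))" for i
    using True by (simp add: gs_matrix_def row_def vec_eq_iff)
  then show ?thesis
    using nz orth by (auto simp: orthogonal_matrix_orthonormal_rows orthogonal_def)
next
  case False
  then show ?thesis by (simp add: gs_matrix_def orthogonal_matrix_id)
qed

lemma orthogonal_transformation_gs_matrix: "orthogonal_transformation (\<lambda>x. gs_matrix v *v x)"
  using orthogonal_matrix_gs_matrix[of v] by (simp add: orthogonal_transformation_matrix)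

lemma borel_measurable_gs_matrix[measurable]:
  "(gs_matrix :: _ \<Rightarrow> real ^ 'n ^ 'n) \<in> borel_measurable (\<Pi>\<^sub>M j\<in>{..<CARD('n)}. borel)"
proof -
  let ?M = "\<Pi>\<^sub>M j\<in>{..<CARD('n)}. (borel :: (real ^ 'n) measure)"
  have [measurable]: "(\<lambda>v. gs_residual v (row_index i)) \<in> borel_measurable ?M" for i :: 'n
    by (rule borel_measurable_gs_residual[OF row_index_less])
  have g: "(\<lambda>v. gs_residual v i) \<in> borel_measurable ?M" if "i < CARD('n)" for i
    by (rule borel_measurable_gs_residual[OF that])
  have [measurable]: "Measurable.pred ?M gs_independent"
    unfolding gs_independent_def[abs_def] using g by measurable
  have [measurable]: "(\<lambda>v. (\<chi> i. gs_residual v (row_index i) /\<^sub>R norm (gs_residual v (row_index i))) :: real ^ 'n ^ 'n) \<in> borel_measurable ?M"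
    by (subst borel_measurable_vec_iff) simp
  show ?thesis
    unfolding gs_matrix_def[abs_def] by measurable
qed

text \<open>
  The inner products of \<open>x\<close> with the frame do not change when both are rotated. This is the
  invariance that turns the distribution of \<open>gs_matrix\<close> into Haar measure.
\<close>

lemma gs_matrix_equivariant:
  fixes T :: "real ^ 'n \<Rightarrow> real ^ 'n"
  assumes T: "orthogonal_transformation T" and v': "\<And>j. j < CARD('n) \<Longrightarrow> v' j = T (v j)"
    and v: "gs_independent v"
  shows "gs_matrix v' *v T x = gs_matrix v *v x"
proof -
  have r: "gs_residual v' i = T (gs_residual v i)" if "i < CARD('n)" for i
    using that v' by (intro gs_residual_orthogonal_image[OF T]) auto
  have n: "norm (T z) = norm z" for z using T by (rule orthogonal_transformation_norm)
  have nz: "T z = 0 \<longleftrightarrow> z = 0" for z using n[of z] by (metis norm_eq_zero)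
  have v'i: "gs_independent v'" using v by (simp add: gs_independent_def r nz)
  have d: "T a \<bullet> T b = a \<bullet> b" for a b using T by (simp add: orthogonal_transformation_def)
  show ?thesis
    using v v'i by (simp add: vec_eq_iff gs_matrix_def matrix_vector_mul_component r[OF row_index_less] n d)
qed

text \<open>
  Independent uniform points of the unit ball: a probability measure on \<open>n\<close>-tuples that is
  invariant under simultaneous rotation and gives no mass to the dependent tuples.
\<close>

definition ball_frames :: "(nat \<Rightarrow> real ^ 'n) measure" where
  "ball_frames = (\<Pi>\<^sub>M j\<in>{..<CARD('n)}. uniform_measure lborel (ball 0 1))"

lemma prob_space_uniform_ball: "prob_space (uniform_measure lborel (ball 0 1 :: (real ^ 'n) set))"
proof (rule prob_space_uniform_measure)
  show "emeasure lborel (ball 0 1 :: (real ^ 'n) set) \<noteq> 0"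
    using unit_ball_vol_pos[of "real CARD('n)"] by (subst emeasure_ball) (auto simp del: unit_ball_vol_pos)
  show "emeasure lborel (ball 0 1 :: (real ^ 'n) set) \<noteq> \<infinity>"
    by (subst emeasure_ball) auto
qed

lemma prob_space_ball_frames: "prob_space (ball_frames :: (nat \<Rightarrow> real ^ 'n) measure)"
  unfolding ball_frames_def by (intro prob_space_PiM prob_space_uniform_ball)

lemma sets_ball_frames[measurable_cong]:
  "sets (ball_frames :: (nat \<Rightarrow> real ^ 'n) measure) = sets (\<Pi>\<^sub>M j\<in>{..<CARD('n)}. borel)"
  unfolding ball_frames_def by (intro sets_PiM_cong) auto

lemma distr_uniform_ball_orthogonal:
  fixes T :: "real ^ 'n \<Rightarrow> real ^ 'n"
  assumes T: "orthogonal_transformation T"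
  shows "distr (uniform_measure lborel (ball 0 1)) (uniform_measure lborel (ball 0 1)) T = uniform_measure lborel (ball 0 1)"
    (is "distr ?U ?U T = ?U")
proof (rule measure_eqI)
  note [measurable] = borel_measurable_orthogonal_transformation[OF T]
  fix A assume "A \<in> sets (distr ?U ?U T)"
  then have [measurable]: "A \<in> sets borel" by simp
  have [measurable]: "(indicator (ball 0 1) :: real ^ 'n \<Rightarrow> ennreal) \<in> borel_measurable borel"
    by (intro borel_measurable_indicator) simp
  have ind: "indicator (ball 0 1) (T x) = (indicator (ball 0 1) x :: ennreal)" for x
    using T by (simp add: indicator_def orthogonal_transformation_norm)
  have "emeasure (distr ?U ?U T) A = (\<integral>\<^sup>+x. indicator A x \<partial>distr ?U ?U T)" by simp
  also have "\<dots> = (\<integral>\<^sup>+x. indicator A (T x) \<partial>?U)"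
    by (subst nn_integral_distr) auto
  also have "\<dots> = (\<integral>\<^sup>+x. indicator A (T x) * indicator (ball 0 1) (T x) \<partial>lborel) / emeasure lborel (ball 0 1 :: (real ^ 'n) set)"
    unfolding ind by (subst nn_integral_uniform_measure) auto
  also have "(\<integral>\<^sup>+x. indicator A (T x) * indicator (ball 0 1) (T x) \<partial>lborel) = (\<integral>\<^sup>+x. indicator A x * indicator (ball 0 1) x \<partial>lborel :: ennreal)"
    by (rule nn_integral_lborel_orthogonal[OF T]) simp
  also have "\<dots> / emeasure lborel (ball 0 1 :: (real ^ 'n) set) = (\<integral>\<^sup>+x. indicator A x \<partial>?U)"
    by (subst nn_integral_uniform_measure) auto
  finally show "emeasure (distr ?U ?U T) A = emeasure ?U A" by simp
qed simp

lemma distr_ball_frames_orthogonal: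
  fixes T :: "real ^ 'n \<Rightarrow> real ^ 'n"
  assumes T: "orthogonal_transformation T"
  shows "(\<lambda>v. \<lambda>j\<in>{..<CARD('n)}. T (v j)) \<in> measurable ball_frames ball_frames"
    "distr ball_frames ball_frames (\<lambda>v. \<lambda>j\<in>{..<CARD('n)}. T (v j)) = ball_frames"
proof -
  let ?U = "uniform_measure lborel (ball 0 1) :: (real ^ 'n) measure"
  note [measurable] = borel_measurable_orthogonal_transformation[OF T]
  interpret prob_space ?U by (rule prob_space_uniform_ball)
  have sf: "sigma_finite_measure ?U" by unfold_locales
  have m: "T \<in> measurable ?U ?U" by simp
  show "(\<lambda>v. \<lambda>j\<in>{..<CARD('n)}. T (v j)) \<in> measurable ball_frames ball_frames"
    unfolding ball_frames_def using m by (intro measurable_restrict) (auto intro!: measurable_compose[OF measurable_component_singleton])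
  show "distr ball_frames ball_frames (\<lambda>v. \<lambda>j\<in>{..<CARD('n)}. T (v j)) = ball_frames"
    unfolding ball_frames_def by (intro distr_PiM_componentwise sf m distr_uniform_ball_orthogonal[OF T]) auto
qed

text \<open>
  Given the other vectors, a vanishing residual confines the \<open>i\<close>-th vector to a subspace of
  dimension at most \<open>i < n\<close>, which is negligible.
\<close>

lemma AE_gs_independent: "AE v in ball_frames. gs_independent (v :: nat \<Rightarrow> real ^ 'n)"
proof -
  let ?U = "uniform_measure lborel (ball 0 1) :: (real ^ 'n) measure"
  have sf: "sigma_finite_measure ?U"
    using prob_space_uniform_ball prob_space_imp_sigma_finite by blast
  interpret product_sigma_finite "\<lambda>_::nat. ?U"
    by (simp add: product_sigma_finite_def sf)
  have "AE v in ball_frames. gs_residual v i \<noteq> (0 :: real ^ 'n)" if i: "i < CARD('n)" for i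
  proof -
    define I where "I = {..<CARD('n)} - {i}"
    have ins: "insert i I = {..<CARD('n)}" using i by (auto simp: I_def)
    have I: "finite I" "i \<notin> I" by (auto simp: I_def)
    have sI: "{..<i} \<subseteq> I" using i by (auto simp: I_def)
    note [measurable] = borel_measurable_gs_residual[OF i, where 'a = "real ^ 'n"]
    let ?N = "{v \<in> space ball_frames. gs_residual v i = (0 :: real ^ 'n)}"
    have N: "?N \<in> sets ball_frames" by measurable
    have "emeasure ball_frames ?N = (\<integral>\<^sup>+v. indicator ?N v \<partial>ball_frames)"
      using N by simp
    also have "\<dots> = (\<integral>\<^sup>+x. (\<integral>\<^sup>+y. indicator ?N (x(i := y)) \<partial>?U) \<partial>(\<Pi>\<^sub>M j\<in>I. ?U))"
      unfolding ball_frames_def ins[symmetric]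
      by (rule product_nn_integral_insert[OF I]) (use N in \<open>simp add: ball_frames_def ins\<close>)
    also have "\<dots> = (\<integral>\<^sup>+x. 0 \<partial>(\<Pi>\<^sub>M j\<in>I. ?U))"
    proof (rule nn_integral_cong)
      fix x :: "nat \<Rightarrow> real ^ 'n"
      define W where "W = span (x ` {..<i})"
      have W: "subspace W" by (simp add: W_def)
      have "dim W \<le> card (x ` {..<i})" unfolding W_def by (simp add: dim_le_card')
      also have "\<dots> \<le> i" using card_image_le[of "{..<i}" x] by simp
      finally have "dim W < DIM(real ^ 'n)" using i by simp
      then have "negligible W" by (rule negligible_lowdim)
      then have "W \<in> null_sets lborel"
        using closed_subspace[OF W]
        by (auto simp: negligible_iff_null_sets null_sets_completion_iff)
      then have "AE y in lborel. y \<notin> W" by (rule AE_not_in)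
      then have "AE y in ?U. y \<notin> W" by (intro AE_uniform_measureI) auto
      then have "AE y in ?U. indicator ?N (x(i := y)) = (0 :: ennreal)"
      proof eventually_elim
        case (elim y)
        have "gs_residual (x(i := y)) i = y - closest_point W y"
          unfolding gs_residual_def W_def by (simp add: image_def)
        then show ?case
          using elim closest_point_mem_subspace[OF W, of y] by (auto simp: indicator_def)
      qed
      then have "(\<integral>\<^sup>+y. indicator ?N (x(i := y)) \<partial>?U) = (\<integral>\<^sup>+y. 0 \<partial>?U)"
        by (rule nn_integral_cong_AE)
      then show "(\<integral>\<^sup>+y. indicator ?N (x(i := y)) \<partial>?U) = 0" by simp
    qed
    finally have "?N \<in> null_sets ball_frames" using N by (auto simp: null_sets_def)
    then show ?thesis by (rule AE_I'[where N = ?N]) auto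
  qed
  then have "AE v in ball_frames. \<forall>i\<in>{..<CARD('n)}. gs_residual v i \<noteq> (0 :: real ^ 'n)"
    by (intro AE_finite_allI) auto
  then show ?thesis by eventually_elim (auto simp: gs_independent_def)
qed

declare restrict_UNIV [simp]

section \<open>Averaging over rotations\<close>

lemma measurable_gs_matrix_columns:
  "(\<lambda>(v, x). \<lambda>j\<in>UNIV. gs_matrix v *v x j) \<in>
    measurable ((ball_frames :: (nat \<Rightarrow> real ^ 'n) measure) \<Otimes>\<^sub>M (\<Pi>\<^sub>M j\<in>(UNIV :: 'q::finite set). borel)) (\<Pi>\<^sub>M j\<in>(UNIV :: 'q set). borel)"
  unfolding case_prod_unfold
proof (rule measurable_restrict)
  fix j :: 'q
  have [measurable]: "gs_matrix \<in> borel_measurable (ball_frames :: (nat \<Rightarrow> real ^ 'n) measure)"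
    using borel_measurable_gs_matrix measurable_cong_sets[OF sets_ball_frames refl] by blast
  have [measurable]: "(\<lambda>p. snd p j) \<in> borel_measurable ((ball_frames :: (nat \<Rightarrow> real ^ 'n) measure) \<Otimes>\<^sub>M
      (\<Pi>\<^sub>M j\<in>(UNIV :: 'q set). (borel :: (real ^ 'n) measure)))"
    by (rule measurable_compose[OF measurable_snd]) (rule measurable_component_singleton, simp)
  show "(\<lambda>p. gs_matrix (fst p) *v snd p j) \<in> borel_measurable ((ball_frames :: (nat \<Rightarrow> real ^ 'n) measure) \<Otimes>\<^sub>M
      (\<Pi>\<^sub>M j\<in>(UNIV :: 'q set). borel))"
    by measurable
qed

definition frame_average :: "(('q \<Rightarrow> real ^ 'n) \<Rightarrow> ennreal) \<Rightarrow> ('q \<Rightarrow> real ^ 'n) \<Rightarrow> ennreal" where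
  "frame_average f x = (\<integral>\<^sup>+v. f (\<lambda>j. gs_matrix v *v x j) \<partial>ball_frames)"

lemma measurable_frame_average_integrand:
  fixes f :: "('q::finite \<Rightarrow> real ^ 'n) \<Rightarrow> ennreal"
  assumes f: "f \<in> borel_measurable (\<Pi>\<^sub>M j\<in>UNIV. borel)"
  shows "(\<lambda>(v, x). f (\<lambda>j. gs_matrix v *v x j)) \<in>
    borel_measurable (ball_frames \<Otimes>\<^sub>M (\<Pi>\<^sub>M j\<in>UNIV. borel))"
  using measurable_compose[OF measurable_gs_matrix_columns f]
  by (simp add: case_prod_unfold)

lemma borel_measurable_frame_average:
  fixes f :: "('q::finite \<Rightarrow> real ^ 'n) \<Rightarrow> ennreal"
  assumes f: "f \<in> borel_measurable (\<Pi>\<^sub>M j\<in>UNIV. borel)"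
  shows "frame_average f \<in> borel_measurable (\<Pi>\<^sub>M j\<in>UNIV. borel)"
proof -
  interpret prob_space "ball_frames :: (nat \<Rightarrow> real ^ 'n) measure" by (rule prob_space_ball_frames)
  show ?thesis
    unfolding frame_average_def[abs_def]
    using measurable_compose[OF measurable_pair_swap' measurable_frame_average_integrand[OF f]]
    by (intro borel_measurable_nn_integral) (simp add: case_prod_unfold)
qed

text \<open>
  The tuples \<open>v\<close> and \<open>T v\<close> have the same distribution, and rotating the columns together with
  the tuple does not change the coordinates.
\<close>

lemma frame_average_invariant:
  fixes f :: "('q::finite \<Rightarrow> real ^ 'n) \<Rightarrow> ennreal" and T :: "real ^ 'n \<Rightarrow> real ^ 'n"
  assumes f: "f \<in> borel_measurable (\<Pi>\<^sub>M j\<in>UNIV. borel)" and T: "orthogonal_transformation T"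
  shows "frame_average f (\<lambda>j. T (x j)) = frame_average f x"
proof -
  let ?t = "\<lambda>v. \<lambda>j\<in>{..<CARD('n)}. T (v j) :: real ^ 'n"
  note t = distr_ball_frames_orthogonal[OF T]
  have m: "(\<lambda>v. f (\<lambda>j. gs_matrix v *v T (x j))) \<in> borel_measurable ball_frames"
    using measurable_compose[OF measurable_Pair2' measurable_frame_average_integrand[OF f], of "\<lambda>j. T (x j)"]
    by (simp add: space_PiM)
  have "frame_average f (\<lambda>j. T (x j)) = (\<integral>\<^sup>+v. f (\<lambda>j. gs_matrix v *v T (x j)) \<partial>distr ball_frames ball_frames ?t)"
    by (simp only: frame_average_def t(2))
  also have "\<dots> = (\<integral>\<^sup>+v. f (\<lambda>j. gs_matrix (?t v) *v T (x j)) \<partial>ball_frames)"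
    using t(1) m by (intro nn_integral_distr) simp_all
  also have "\<dots> = (\<integral>\<^sup>+v. f (\<lambda>j. gs_matrix v *v x j) \<partial>ball_frames)"
  proof (rule nn_integral_cong_AE, rule AE_mp[OF AE_gs_independent], rule AE_I2, rule impI)
    fix v :: "nat \<Rightarrow> real ^ 'n" assume "gs_independent v"
    then have "gs_matrix (?t v) *v T (x j) = gs_matrix v *v x j" for j
      by (intro gs_matrix_equivariant[OF T]) auto
    then show "f (\<lambda>j. gs_matrix (?t v) *v T (x j)) = f (\<lambda>j. gs_matrix v *v x j)" by simp
  qed
  finally show ?thesis by (simp add: frame_average_def)
qed

lemma nn_integral_PiM_lborel_orthogonal:
  fixes f :: "('q::finite \<Rightarrow> real ^ 'n) \<Rightarrow> ennreal" and T :: "real ^ 'n \<Rightarrow> real ^ 'n"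
  assumes f: "f \<in> borel_measurable (\<Pi>\<^sub>M j\<in>UNIV. borel)" and T: "orthogonal_transformation T"
  shows "(\<integral>\<^sup>+x. f (\<lambda>j. T (x j)) \<partial>(\<Pi>\<^sub>M j\<in>UNIV. lborel)) = (\<integral>\<^sup>+x. f x \<partial>(\<Pi>\<^sub>M j\<in>UNIV. lborel))"
proof -
  note [measurable] = borel_measurable_orthogonal_transformation[OF T]
  let ?L = "\<Pi>\<^sub>M j\<in>(UNIV :: 'q set). (lborel :: (real ^ 'n) measure)"
  have m: "(\<lambda>x. \<lambda>j\<in>UNIV. T (x j)) \<in> measurable ?L ?L" by measurable
  have f': "f \<in> borel_measurable ?L"
    using f measurable_cong_sets[OF sets_PiM_cong[OF refl sets_lborel] refl] by blast
  have "(\<integral>\<^sup>+x. f x \<partial>?L) = (\<integral>\<^sup>+x. f x \<partial>distr ?L ?L (\<lambda>x. \<lambda>j\<in>UNIV. T (x j)))"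
    by (subst distr_PiM_componentwise) (auto simp: distr_lborel_orthogonal[OF T] lborel.sigma_finite_measure_axioms)
  also have "\<dots> = (\<integral>\<^sup>+x. f (\<lambda>j. T (x j)) \<partial>?L)"
    using m f' by (subst nn_integral_distr) auto
  finally show ?thesis ..
qed

lemma nn_integral_subspace_power_orthogonal:
  fixes f :: "('q::finite \<Rightarrow> real ^ 'n) \<Rightarrow> ennreal" and T :: "real ^ 'n \<Rightarrow> real ^ 'n"
  assumes f: "f \<in> borel_measurable (\<Pi>\<^sub>M j\<in>UNIV. borel)" and T: "orthogonal_transformation T" and \<xi>: "subspace \<xi>"
  shows "(\<integral>\<^sup>+x. f x \<partial>(\<Pi>\<^sub>M j\<in>UNIV. lborel_subspace (T ` \<xi>))) =
    (\<integral>\<^sup>+x. f (\<lambda>j. T (x j)) \<partial>(\<Pi>\<^sub>M j\<in>UNIV. lborel_subspace \<xi>))"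
proof -
  let ?X = "\<Pi>\<^sub>M j\<in>(UNIV :: 'q set). lborel_subspace \<xi>" and ?Y = "\<Pi>\<^sub>M j\<in>(UNIV :: 'q set). lborel_subspace (T ` \<xi>)"
  have T\<xi>: "subspace (T ` \<xi>)" using orthogonal_transformation_linear[OF T] \<xi> by (rule linear_subspace_image)
  note t = distr_lborel_subspace_orthogonal[OF T \<xi>]
  have m: "(\<lambda>x. \<lambda>j\<in>UNIV. T (x j)) \<in> measurable ?X ?Y"
    by (intro measurable_restrict measurable_compose[OF _ t(1)] measurable_component_singleton)
  have "(\<integral>\<^sup>+x. f x \<partial>?Y) = (\<integral>\<^sup>+x. f x \<partial>distr ?X ?Y (\<lambda>x. \<lambda>j\<in>UNIV. T (x j)))"
    using sigma_finite_lborel_subspace[OF \<xi>] sigma_finite_lborel_subspace[OF T\<xi>] t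
    by (subst distr_PiM_componentwise) auto
  also have "\<dots> = (\<integral>\<^sup>+x. f (\<lambda>j. T (x j)) \<partial>?X)"
    using m measurable_PiM_lborel_subspace[OF f] by (subst nn_integral_distr) auto
  finally show ?thesis .
qed

lemma frame_average_integral:
  fixes f :: "('q::finite \<Rightarrow> real ^ 'n) \<Rightarrow> ennreal"
  assumes f: "f \<in> borel_measurable (\<Pi>\<^sub>M j\<in>UNIV. borel)"
  shows "(\<integral>\<^sup>+x. frame_average f x \<partial>(\<Pi>\<^sub>M j\<in>UNIV. lborel)) = (\<integral>\<^sup>+x. f x \<partial>(\<Pi>\<^sub>M j\<in>UNIV. lborel))"
proof -
  let ?L = "\<Pi>\<^sub>M j\<in>(UNIV :: 'q set). (lborel :: (real ^ 'n) measure)"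
  interpret L: product_sigma_finite "\<lambda>_::'q. lborel :: (real ^ 'n) measure" by standard
  interpret R: prob_space "ball_frames :: (nat \<Rightarrow> real ^ 'n) measure" by (rule prob_space_ball_frames)
  interpret P: pair_sigma_finite "ball_frames :: (nat \<Rightarrow> real ^ 'n) measure" ?L
    using L.sigma_finite[of UNIV] R.sigma_finite_measure_axioms by (simp add: pair_sigma_finite_def)
  have "sets (ball_frames \<Otimes>\<^sub>M ?L) = sets (ball_frames \<Otimes>\<^sub>M (\<Pi>\<^sub>M j\<in>(UNIV :: 'q set). (borel :: (real ^ 'n) measure)))"
    by (intro sets_pair_measure_cong sets_PiM_cong) auto
  then have "(\<lambda>(v, x). f (\<lambda>j. gs_matrix v *v x j)) \<in> borel_measurable (ball_frames \<Otimes>\<^sub>M ?L)"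
    using measurable_frame_average_integrand[OF f] measurable_cong_sets by blast
  then have "(\<integral>\<^sup>+x. frame_average f x \<partial>?L) = (\<integral>\<^sup>+v. (\<integral>\<^sup>+x. f (\<lambda>j. gs_matrix v *v x j) \<partial>?L) \<partial>ball_frames)"
    unfolding frame_average_def by (intro P.Fubini') (simp add: case_prod_unfold)
  also have "\<dots> = (\<integral>\<^sup>+v. (\<integral>\<^sup>+x. f x \<partial>?L) \<partial>(ball_frames :: (nat \<Rightarrow> real ^ 'n) measure))"
    by (intro nn_integral_cong nn_integral_PiM_lborel_orthogonal[OF f] orthogonal_transformation_gs_matrix)
  also have "\<dots> = (\<integral>\<^sup>+x. f x \<partial>?L)"
    by (simp add: R.emeasure_space_1)
  finally show ?thesis .
qed

lemma nn_integral_subspace_power_smear: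
  fixes f :: "('q::finite \<Rightarrow> real ^ 'n) \<Rightarrow> ennreal"
  assumes f: "f \<in> borel_measurable (\<Pi>\<^sub>M j\<in>UNIV. borel)" and \<xi>: "subspace \<xi>"
  shows "(\<integral>\<^sup>+x. f x \<partial>(\<Pi>\<^sub>M j\<in>UNIV. lborel_subspace \<xi>)) =
    (\<integral>\<^sup>+y. ennreal (\<Prod>j\<in>UNIV. ball_weight (CARD('n) - dim \<xi>) (y j - closest_point \<xi> (y j))) *
      f (\<lambda>j. closest_point \<xi> (y j)) \<partial>(\<Pi>\<^sub>M j\<in>UNIV. lborel))"
proof -
  let ?L = "\<Pi>\<^sub>M j\<in>(UNIV :: 'q set). (lborel :: (real ^ 'n) measure)"
  let ?X = "\<Pi>\<^sub>M j\<in>(UNIV :: 'q set). lborel_subspace \<xi>"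
  let ?w = "\<lambda>y. ennreal (\<Prod>j\<in>UNIV. ball_weight (CARD('n) - dim \<xi>) (y j - closest_point \<xi> (y j)))"
  note p = PiM_lborel_subspace_eq_distr[OF \<xi>, of "UNIV :: 'q set"]
  note [measurable] = borel_measurable_closest_point[OF \<xi>] p(1)[unfolded restrict_UNIV] measurable_PiM_lborel_subspace[OF f]
  have "(\<integral>\<^sup>+x. f x \<partial>?X) = (\<integral>\<^sup>+x. f x \<partial>distr (density ?L ?w) ?X (\<lambda>y. \<lambda>i\<in>UNIV. closest_point \<xi> (y i)))"
    by (subst p(2)) simp
  also have "\<dots> = (\<integral>\<^sup>+y. f (\<lambda>i\<in>UNIV. closest_point \<xi> (y i)) \<partial>density ?L ?w)"
    by (subst nn_integral_distr) auto
  also have "\<dots> = (\<integral>\<^sup>+y. ?w y * f (\<lambda>i\<in>UNIV. closest_point \<xi> (y i)) \<partial>?L)"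
    by (subst nn_integral_density) auto
  finally show ?thesis by simp
qed

lemma measurable_grassmann_projection:
  "(\<lambda>(\<xi>, y). \<lambda>j\<in>UNIV. closest_point \<xi> (y j :: real ^ 'n)) \<in>
    measurable (grassmann_borel k \<Otimes>\<^sub>M (\<Pi>\<^sub>M j\<in>(UNIV :: 'q::finite set). borel)) (\<Pi>\<^sub>M j\<in>UNIV. borel)"
  unfolding case_prod_unfold
proof (rule measurable_restrict)
  fix j :: 'q
  show "(\<lambda>p. closest_point (fst p) (snd p j)) \<in> borel_measurable (grassmann_borel k \<Otimes>\<^sub>M
      (\<Pi>\<^sub>M j\<in>(UNIV :: 'q set). (borel :: (real ^ 'n) measure)))"
    by (rule borel_measurable_closest_point_pair[OF measurable_fst])
       (rule measurable_compose[OF measurable_snd], rule measurable_component_singleton, simp)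
qed

lemma measurable_grassmann_weight:
  "(\<lambda>(\<xi>, y). \<Prod>j\<in>UNIV. ball_weight m (y j - closest_point \<xi> (y j :: real ^ 'n))) \<in>
    borel_measurable (grassmann_borel k \<Otimes>\<^sub>M (\<Pi>\<^sub>M j\<in>(UNIV :: 'q::finite set). borel))"
  unfolding case_prod_unfold
proof (rule borel_measurable_prod)
  fix j :: 'q
  have [measurable]: "(\<lambda>p. snd p j) \<in> borel_measurable (grassmann_borel k \<Otimes>\<^sub>M
      (\<Pi>\<^sub>M j\<in>(UNIV :: 'q set). (borel :: (real ^ 'n) measure)))"
    by (rule measurable_compose[OF measurable_snd], rule measurable_component_singleton, simp)
  note [measurable] = borel_measurable_closest_point_pair[OF measurable_fst this]
  show "(\<lambda>p. ball_weight m (snd p j - closest_point (fst p) (snd p j))) \<in> borel_measurable (grassmann_borel k \<Otimes>\<^sub>M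
      (\<Pi>\<^sub>M j\<in>(UNIV :: 'q set). (borel :: (real ^ 'n) measure)))"
    by measurable
qed

lemma measurable_PiM_lborel_pair:
  "measurable (N \<Otimes>\<^sub>M (\<Pi>\<^sub>M j\<in>I. lborel)) K = measurable (N \<Otimes>\<^sub>M (\<Pi>\<^sub>M j\<in>I. borel)) K"
  by (intro measurable_cong_sets sets_pair_measure_cong sets_PiM_cong) auto

lemma borel_measurable_subspace_power_integral:
  fixes f :: "('q::finite \<Rightarrow> real ^ 'n) \<Rightarrow> ennreal"
  assumes f: "f \<in> borel_measurable (\<Pi>\<^sub>M j\<in>UNIV. borel)"
  shows "(\<lambda>\<xi>. \<integral>\<^sup>+x. f x \<partial>(\<Pi>\<^sub>M j\<in>UNIV. lborel_subspace \<xi>)) \<in> borel_measurable (grassmann_borel k)"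
proof -
  interpret L: product_sigma_finite "\<lambda>_::'q. lborel :: (real ^ 'n) measure" by standard
  interpret LU: sigma_finite_measure "\<Pi>\<^sub>M j\<in>(UNIV :: 'q set). (lborel :: (real ^ 'n) measure)"
    by (rule L.sigma_finite) simp
  have [measurable]: "(\<lambda>p. f (\<lambda>j. closest_point (fst p) (snd p j))) \<in>
      borel_measurable (grassmann_borel k \<Otimes>\<^sub>M (\<Pi>\<^sub>M j\<in>UNIV. borel))"
    using measurable_compose[OF measurable_grassmann_projection f] by (simp add: case_prod_unfold)
  note [measurable] = measurable_grassmann_weight[unfolded case_prod_unfold]
  have "(\<lambda>\<xi>. \<integral>\<^sup>+y. ennreal (\<Prod>j\<in>UNIV. ball_weight (CARD('n) - k) (y j - closest_point \<xi> (y j))) *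
      f (\<lambda>j. closest_point \<xi> (y j)) \<partial>(\<Pi>\<^sub>M j\<in>UNIV. lborel)) \<in> borel_measurable (grassmann_borel k)"
    by (rule LU.borel_measurable_nn_integral) (simp add: measurable_PiM_lborel_pair case_prod_unfold)
  then show ?thesis
    by (subst measurable_cong) (auto simp: space_grassmann_borel grassmannianD nn_integral_subspace_power_smear[OF f])
qed

text \<open>
  The projection onto the rotated subspace is \<open>Q P Q\<^sup>T\<close>, where \<open>P\<close> is the projection onto
  \<open>\<xi>\<close> and \<open>Q\<close> the Gram-Schmidt matrix.
\<close>

lemma measurable_gs_matrix_grassmann:
  "(\<lambda>(v, \<xi>). (\<lambda>x. gs_matrix v *v x) ` \<xi>) \<in>
    measurable ((ball_frames :: (nat \<Rightarrow> real ^ 'n) measure) \<Otimes>\<^sub>M grassmann_borel k) (grassmann_borel k)"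
  unfolding case_prod_unfold
proof (rule measurable_grassmann_borelI)
  let ?M = "(ball_frames :: (nat \<Rightarrow> real ^ 'n) measure) \<Otimes>\<^sub>M (grassmann_borel k :: (real ^ 'n) set measure)"
  fix p assume "p \<in> space ?M"
  then have \<xi>: "snd p \<in> grassmannian k" by (auto simp: space_pair_measure space_grassmann_borel)
  then show "(\<lambda>x. gs_matrix (fst p) *v x) ` snd p \<in> grassmannian k"
    using dim_orthogonal_image[OF orthogonal_transformation_gs_matrix[of "fst p"]]
    by (auto simp: grassmannian_def intro!: linear_subspace_image)
next
  let ?M = "(ball_frames :: (nat \<Rightarrow> real ^ 'n) measure) \<Otimes>\<^sub>M (grassmann_borel k :: (real ^ 'n) set measure)"
  have g[measurable]: "gs_matrix \<in> borel_measurable (ball_frames :: (nat \<Rightarrow> real ^ 'n) measure)"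
    using borel_measurable_gs_matrix measurable_cong_sets[OF sets_ball_frames refl] by blast
  have [measurable]: "(\<lambda>p. transpose (gs_matrix (fst p)) :: real ^ 'n ^ 'n) \<in> borel_measurable ?M"
    by (simp add: borel_measurable_vec_iff transpose_def)
  have eq: "matrix (closest_point ((\<lambda>x. gs_matrix (fst p) *v x) ` snd p)) =
      (\<chi> i j. (gs_matrix (fst p) *v closest_point (snd p) (transpose (gs_matrix (fst p)) *v axis j 1)) $ i)"
    if "p \<in> space ?M" for p
  proof -
    have \<xi>: "subspace (snd p)"
      using that by (auto simp: space_pair_measure space_grassmann_borel grassmannianD)
    let ?T = "\<lambda>x. gs_matrix (fst p) *v x"
    have "?T (transpose (gs_matrix (fst p)) *v y) = y" for y
      using orthogonal_matrix_gs_matrix[of "fst p"]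
      by (simp add: matrix_vector_mul_assoc orthogonal_matrix_def del: transpose_matrix_vector)
    then have "closest_point (?T ` snd p) y = ?T (closest_point (snd p) (transpose (gs_matrix (fst p)) *v y))" for y
      using closest_point_orthogonal_image[OF \<xi> orthogonal_transformation_gs_matrix] by metis
    then show ?thesis by (simp add: matrix_def)
  qed
  have [measurable]: "(\<lambda>p. closest_point (snd p) (transpose (gs_matrix (fst p)) *v axis j 1)) \<in> borel_measurable ?M" for j
    by (rule borel_measurable_closest_point_pair[OF measurable_snd]) measurable
  have "(\<lambda>p. \<chi> i j. (gs_matrix (fst p) *v closest_point (snd p) (transpose (gs_matrix (fst p)) *v axis j 1)) $ i) \<in> borel_measurable ?M"
    by (intro borel_measurable_vec_iff[THEN iffD2] allI) (simp del: transpose_matrix_vector)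
  then show "(\<lambda>p. matrix (closest_point ((\<lambda>x. gs_matrix (fst p) *v x) ` snd p))) \<in> borel_measurable ?M"
    by (subst measurable_cong[OF eq]) auto
qed

text \<open>
  Invariance under each single rotation implies invariance under the random rotation; then the
  order of integration is exchanged. The inner integral on the right will turn out to be the same
  for all \<open>\<xi>\<close>, which expresses the uniqueness of the invariant probability measure.
\<close>

lemma nn_integral_grassmann_average:
  fixes h :: "(real ^ 'n) set \<Rightarrow> ennreal"
  assumes \<mu>: "invariant_grassmann_measure k \<mu>" and h: "h \<in> borel_measurable (grassmann_borel k)"
  shows "(\<integral>\<^sup>+\<xi>. h \<xi> \<partial>\<mu>) = (\<integral>\<^sup>+\<xi>. (\<integral>\<^sup>+v. h ((\<lambda>x. gs_matrix v *v x) ` \<xi>) \<partial>ball_frames) \<partial>\<mu>)"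
proof -
  let ?Q = "\<lambda>v x. gs_matrix v *v (x :: real ^ 'n)"
  have prob: "prob_space \<mu>" and sets[measurable_cong]: "sets \<mu> = sets (grassmann_borel k)"
    and inv: "\<And>T. orthogonal_transformation T \<Longrightarrow> distr \<mu> \<mu> (\<lambda>\<xi>. T ` \<xi>) = \<mu>"
    using \<mu> by (auto simp: invariant_grassmann_measure_def)
  interpret R: prob_space "ball_frames :: (nat \<Rightarrow> real ^ 'n) measure" by (rule prob_space_ball_frames)
  interpret M: prob_space \<mu> by (rule prob)
  interpret P: pair_sigma_finite "ball_frames :: (nat \<Rightarrow> real ^ 'n) measure" \<mu>
    by (simp add: pair_sigma_finite_def R.sigma_finite_measure_axioms M.sigma_finite_measure_axioms)
  have h'[measurable]: "h \<in> borel_measurable \<mu>" using h measurable_cong_sets[OF sets refl] by blast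
  have G: "(\<lambda>(v, \<xi>). ?Q v ` \<xi>) \<in> measurable (ball_frames \<Otimes>\<^sub>M \<mu>) \<mu>"
    using measurable_gs_matrix_grassmann[of k] measurable_cong_sets[OF sets_pair_measure_cong[OF refl sets] sets] by blast
  have Gv: "(\<lambda>\<xi>. ?Q v ` \<xi>) \<in> measurable \<mu> \<mu>" if "v \<in> space ball_frames" for v
    using measurable_compose[OF measurable_Pair1'[OF that] G] by simp
  have "(\<integral>\<^sup>+\<xi>. h \<xi> \<partial>\<mu>) = (\<integral>\<^sup>+v. (\<integral>\<^sup>+\<xi>. h \<xi> \<partial>\<mu>) \<partial>(ball_frames :: (nat \<Rightarrow> real ^ 'n) measure))"
    by (simp add: R.emeasure_space_1)
  also have "\<dots> = (\<integral>\<^sup>+v. (\<integral>\<^sup>+\<xi>. h (?Q v ` \<xi>) \<partial>\<mu>) \<partial>ball_frames)"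
  proof (rule nn_integral_cong)
    fix v :: "nat \<Rightarrow> real ^ 'n" assume v: "v \<in> space ball_frames"
    have "(\<integral>\<^sup>+\<xi>. h \<xi> \<partial>\<mu>) = (\<integral>\<^sup>+\<xi>. h \<xi> \<partial>distr \<mu> \<mu> (\<lambda>\<xi>. ?Q v ` \<xi>))"
      by (simp only: inv[OF orthogonal_transformation_gs_matrix])
    also have "\<dots> = (\<integral>\<^sup>+\<xi>. h (?Q v ` \<xi>) \<partial>\<mu>)"
      using Gv[OF v] by (intro nn_integral_distr) auto
    finally show "(\<integral>\<^sup>+\<xi>. h \<xi> \<partial>\<mu>) = (\<integral>\<^sup>+\<xi>. h (?Q v ` \<xi>) \<partial>\<mu>)" .
  qed
  also have "\<dots> = (\<integral>\<^sup>+\<xi>. (\<integral>\<^sup>+v. h (?Q v ` \<xi>) \<partial>ball_frames) \<partial>\<mu>)"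
    using measurable_compose[OF G h'] by (intro P.Fubini'[symmetric]) (simp add: case_prod_unfold)
  finally show ?thesis .
qed

text \<open>
  The formula for non-negative integrands. Averaging over rotations replaces \<open>f\<close> by
  \<open>frame_average f\<close>, which is invariant and has the same integral; for it the formula holds on
  each single subspace.
\<close>

lemma nn_integral_columns_grassmann:
  fixes f :: "('q::finite \<Rightarrow> real ^ 'n) \<Rightarrow> ennreal"
  assumes q: "CARD('q) \<le> k" and \<mu>: "invariant_grassmann_measure k \<mu>"
    and f: "f \<in> borel_measurable (\<Pi>\<^sub>M j\<in>UNIV. borel)"
  shows "(\<integral>\<^sup>+x. f x \<partial>(\<Pi>\<^sub>M j\<in>UNIV. lborel)) =
    ennreal (\<Prod>j<CARD('q). sphere_area (CARD('n) - j) / sphere_area (k - j)) *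
    (\<integral>\<^sup>+\<xi>. (\<integral>\<^sup>+x. f x * ennreal (gram_vol UNIV x ^ (CARD('n) - k)) \<partial>(\<Pi>\<^sub>M j\<in>UNIV. lborel_subspace \<xi>)) \<partial>\<mu>)"
proof -
  let ?s = "CARD('n) - k"
  let ?c = "ennreal (\<Prod>j<CARD('q). sphere_area (CARD('n) - j) / sphere_area (k - j))"
  let ?L = "\<Pi>\<^sub>M j\<in>(UNIV :: 'q set). (lborel :: (real ^ 'n) measure)"
  let ?X = "\<lambda>\<xi>. \<Pi>\<^sub>M j\<in>(UNIV :: 'q set). lborel_subspace \<xi>"
  let ?Q = "\<lambda>v x. gs_matrix v *v (x :: real ^ 'n)"
  let ?F = "\<lambda>x. f x * ennreal (gram_vol UNIV x ^ ?s)"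
  let ?h = "\<lambda>\<xi>. \<integral>\<^sup>+x. ?F x \<partial>?X \<xi>"
  have prob: "prob_space \<mu>" and sets: "sets \<mu> = sets (grassmann_borel k)"
    using \<mu> by (auto simp: invariant_grassmann_measure_def)
  interpret M: prob_space \<mu> by (rule prob)
  interpret R: prob_space "ball_frames :: (nat \<Rightarrow> real ^ 'n) measure" by (rule prob_space_ball_frames)
  have space: "space \<mu> = grassmannian k"
    using sets_eq_imp_space_eq[OF sets] by (simp add: space_grassmann_borel)
  note [measurable] = f borel_measurable_gram_vol[where S = UNIV]
  have F: "?F \<in> borel_measurable (\<Pi>\<^sub>M j\<in>UNIV. borel)" by measurable
  have h: "?h \<in> borel_measurable (grassmann_borel k)"
    by (rule borel_measurable_subspace_power_integral[OF F])
  have h': "?h \<in> borel_measurable \<mu>" using h measurable_cong_sets[OF sets refl] by blast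
  have one: "?c * (\<integral>\<^sup>+v. ?h (?Q v ` \<xi>) \<partial>ball_frames) = (\<integral>\<^sup>+x. f x \<partial>?L)" if \<xi>: "\<xi> \<in> space \<mu>" for \<xi>
  proof -
    have sub: "subspace \<xi>" and dim: "dim \<xi> = k" using \<xi> by (auto simp: space grassmannianD)
    interpret X: product_sigma_finite "\<lambda>_::'q. lborel_subspace \<xi>"
      by (simp add: product_sigma_finite_def sigma_finite_lborel_subspace[OF sub])
    interpret P: pair_sigma_finite "?X \<xi>" "ball_frames :: (nat \<Rightarrow> real ^ 'n) measure"
      using X.sigma_finite[of UNIV] R.sigma_finite_measure_axioms by (simp add: pair_sigma_finite_def)
    have id: "(\<lambda>x. x) \<in> measurable (?X \<xi>) (\<Pi>\<^sub>M j\<in>UNIV. borel)"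
      by (rule measurable_PiM_lborel_subspace) simp
    have "(\<lambda>p. f (\<lambda>j. ?Q (snd p) (fst p j))) \<in> borel_measurable ((\<Pi>\<^sub>M j\<in>(UNIV :: 'q set). borel) \<Otimes>\<^sub>M ball_frames)"
      using measurable_compose[OF measurable_pair_swap' measurable_frame_average_integrand[OF f]]
      by (simp add: case_prod_unfold)
    from measurable_compose[OF measurable_Pair[OF measurable_compose[OF measurable_fst id] measurable_snd] this]
    have fm: "(\<lambda>p. f (\<lambda>j. ?Q (snd p) (fst p j))) \<in> borel_measurable (?X \<xi> \<Otimes>\<^sub>M ball_frames)"
      by simp
    have gm[measurable]: "gram_vol UNIV \<in> borel_measurable (?X \<xi>)"
      by (rule measurable_PiM_lborel_subspace) measurable
    have "(\<integral>\<^sup>+v. ?h (?Q v ` \<xi>) \<partial>ball_frames) =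
      (\<integral>\<^sup>+v. (\<integral>\<^sup>+x. f (\<lambda>j. ?Q v (x j)) * ennreal (gram_vol UNIV x ^ ?s) \<partial>?X \<xi>) \<partial>ball_frames)"
      by (simp add: nn_integral_subspace_power_orthogonal[OF F orthogonal_transformation_gs_matrix sub]
          gram_vol_orthogonal[OF orthogonal_transformation_gs_matrix])
    also have "\<dots> = (\<integral>\<^sup>+x. (\<integral>\<^sup>+v. f (\<lambda>j. ?Q v (x j)) * ennreal (gram_vol UNIV x ^ ?s) \<partial>ball_frames) \<partial>?X \<xi>)"
    proof (rule P.Fubini')
      have [measurable]: "(\<lambda>p. gram_vol UNIV (fst p)) \<in> borel_measurable (?X \<xi> \<Otimes>\<^sub>M ball_frames)"
        by (rule measurable_compose[OF measurable_fst gm])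
      show "(\<lambda>(x, v). f (\<lambda>j. ?Q v (x j)) * ennreal (gram_vol UNIV x ^ ?s)) \<in> borel_measurable (?X \<xi> \<Otimes>\<^sub>M ball_frames)"
        unfolding case_prod_unfold using fm by measurable
    qed
    also have "\<dots> = (\<integral>\<^sup>+x. frame_average f x * ennreal (gram_vol UNIV x ^ ?s) \<partial>?X \<xi>)"
    proof (rule nn_integral_cong)
      fix x :: "'q \<Rightarrow> real ^ 'n"
      have "(\<lambda>v. f (\<lambda>j. ?Q v (x j))) \<in> borel_measurable ball_frames"
        using measurable_compose[OF measurable_Pair2' measurable_frame_average_integrand[OF f], of x]
        by (simp add: space_PiM)
      then show "(\<integral>\<^sup>+v. f (\<lambda>j. ?Q v (x j)) * ennreal (gram_vol UNIV x ^ ?s) \<partial>ball_frames) =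
        frame_average f x * ennreal (gram_vol UNIV x ^ ?s)"
        unfolding frame_average_def by (rule nn_integral_multc)
    qed
    finally have "?c * (\<integral>\<^sup>+v. ?h (?Q v ` \<xi>) \<partial>ball_frames) =
      ?c * (\<integral>\<^sup>+x. frame_average f x * ennreal (gram_vol UNIV x ^ ?s) \<partial>?X \<xi>)" by simp
    also have "\<dots> = (\<integral>\<^sup>+x. frame_average f x \<partial>?L)"
    proof -
      have "(\<integral>\<^sup>+x. frame_average f x \<partial>(\<Pi>\<^sub>M j\<in>UNIV. lborel)) =
        ennreal (\<Prod>j<card (UNIV :: 'q set). sphere_area (CARD('n) - j) / sphere_area (dim \<xi> - j)) *
        (\<integral>\<^sup>+x. frame_average f x * ennreal (gram_vol UNIV x ^ (CARD('n) - dim \<xi>)) \<partial>?X \<xi>)"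
      proof (rule nn_integral_columns_subspace[OF sub _ borel_measurable_frame_average[OF f]])
        fix T and x y :: "'q \<Rightarrow> real ^ 'n"
        assume T: "orthogonal_transformation T" and "\<And>i. i \<in> UNIV \<Longrightarrow> y i = T (x i)"
        then have "y = (\<lambda>j. T (x j))" by auto
        then show "frame_average f y = frame_average f x"
          using frame_average_invariant[OF f T] by simp
      qed (use q dim in simp)
      then show ?thesis by (simp add: dim)
    qed
    also have "\<dots> = (\<integral>\<^sup>+x. f x \<partial>?L)" by (rule frame_average_integral[OF f])
    finally show ?thesis .
  qed
  have avg: "(\<lambda>\<xi>. \<integral>\<^sup>+v. ?h (?Q v ` \<xi>) \<partial>ball_frames) \<in> borel_measurable \<mu>"
  proof -
    have "(\<lambda>(v, \<xi>). ?h (?Q v ` \<xi>)) \<in> borel_measurable ((ball_frames :: (nat \<Rightarrow> real ^ 'n) measure) \<Otimes>\<^sub>M grassmann_borel k)"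
      using measurable_compose[OF measurable_gs_matrix_grassmann h] by (simp add: case_prod_unfold)
    from measurable_compose[OF measurable_pair_swap' this]
    have "(\<lambda>(\<xi>, v). ?h (?Q v ` \<xi>)) \<in> borel_measurable (grassmann_borel k \<Otimes>\<^sub>M (ball_frames :: (nat \<Rightarrow> real ^ 'n) measure))"
      by (simp add: case_prod_unfold)
    then have "(\<lambda>\<xi>. \<integral>\<^sup>+v. ?h (?Q v ` \<xi>) \<partial>ball_frames) \<in> borel_measurable (grassmann_borel k)"
      by (intro R.borel_measurable_nn_integral) (simp add: case_prod_unfold)
    then show ?thesis using measurable_cong_sets[OF sets refl] by blast
  qed
  have "?c * (\<integral>\<^sup>+\<xi>. ?h \<xi> \<partial>\<mu>) = ?c * (\<integral>\<^sup>+\<xi>. (\<integral>\<^sup>+v. ?h (?Q v ` \<xi>) \<partial>ball_frames) \<partial>\<mu>)"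
    by (subst nn_integral_grassmann_average[OF \<mu> h]) simp
  also have "\<dots> = (\<integral>\<^sup>+\<xi>. ?c * (\<integral>\<^sup>+v. ?h (?Q v ` \<xi>) \<partial>ball_frames) \<partial>\<mu>)"
    using avg by (intro nn_integral_cmult[symmetric])
  also have "\<dots> = (\<integral>\<^sup>+\<xi>. (\<integral>\<^sup>+x. f x \<partial>?L) \<partial>\<mu>)"
    by (intro nn_integral_cong one)
  also have "\<dots> = (\<integral>\<^sup>+x. f x \<partial>?L)" by (simp add: M.emeasure_space_1)
  finally show ?thesis ..
qed

section \<open>The constant\<close>

lemma sphere_area_Gamma:
  assumes "m > 0"
  shows "sphere_area m = 2 * pi powr (real m / 2) / Gamma (real m / 2)"
proof -
  have *: "Gamma (real m / 2 + 1) = (real m / 2) * Gamma (real m / 2)"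
    using assms by (intro Gamma_plus1) (auto dest: nonpos_Ints_nonpos)
  have "Gamma (real m / 2) > 0" using assms by (intro Gamma_real_pos) simp
  then show ?thesis
    unfolding sphere_area_def unit_ball_vol_def * using assms by (simp add: field_simps)
qed

text \<open>
  A frame is chosen one vector at a time, each on the unit sphere of the complement of the
  previous ones.
\<close>

lemma stiefel_mass_eq_prod:
  "q \<le> m \<Longrightarrow> stiefel_mass m q = (\<Prod>j<q. sphere_area (m - j))"
proof (induction q)
  case 0
  show ?case by (simp add: stiefel_mass_def multivariate_Gamma_def)
next
  case (Suc q)
  have IH: "stiefel_mass m q = (\<Prod>j<q. sphere_area (m - j))" using Suc by simp
  have a: "pi powr (real m * real (Suc q) / 2) = pi powr (real m * real q / 2) * pi powr (real m / 2)"
    by (simp add: powr_add[symmetric] field_simps)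
  have b: "pi powr (real (Suc q) * (real (Suc q) - 1) / 4) = pi powr (real q * (real q - 1) / 4) * pi powr (real q / 2)"
    by (simp add: powr_add[symmetric] field_simps)
  have c: "pi powr (real (m - q) / 2) = pi powr (real m / 2) / pi powr (real q / 2)"
    using Suc.prems by (simp add: powr_diff[symmetric] of_nat_diff diff_divide_distrib)
  have d: "Gamma (real m / 2 - real q / 2) = Gamma (real (m - q) / 2)"
    using Suc.prems by (simp add: of_nat_diff diff_divide_distrib)
  have "stiefel_mass m (Suc q) = stiefel_mass m q * (2 * pi powr (real (m - q) / 2) / Gamma (real (m - q) / 2))"
    unfolding stiefel_mass_def multivariate_Gamma_def a b c prod.lessThan_Suc d
    by (simp add: field_simps)
  also have "\<dots> = (\<Prod>j<Suc q. sphere_area (m - j))"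
    using Suc.prems by (simp add: IH sphere_area_Gamma)
  finally show ?case .
qed

section \<open>Bochner integrals\<close>

lemma distr_matrix_of_columns:
  "(matrix_of_columns :: ('q \<Rightarrow> real ^ 'n) \<Rightarrow> real ^ 'q ^ 'n) \<in> borel_measurable (\<Pi>\<^sub>M j\<in>UNIV. borel)"
  "distr (\<Pi>\<^sub>M j\<in>(UNIV :: 'q set). lborel) borel (matrix_of_columns :: _ \<Rightarrow> real ^ 'q ^ 'n) = lborel"
proof -
  let ?L = "\<Pi>\<^sub>M j\<in>(UNIV :: 'q set). (lborel :: (real ^ 'n) measure)"
  interpret L: product_sigma_finite "\<lambda>_::'q. lborel :: (real ^ 'n) measure" by standard
  have [measurable]: "(\<lambda>x. x j) \<in> borel_measurable (\<Pi>\<^sub>M j\<in>(UNIV :: 'q set). (borel :: (real ^ 'n) measure))" for j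
    by (rule measurable_component_singleton) simp
  show m: "(matrix_of_columns :: ('q \<Rightarrow> real ^ 'n) \<Rightarrow> real ^ 'q ^ 'n) \<in> borel_measurable (\<Pi>\<^sub>M j\<in>UNIV. borel)"
    unfolding matrix_of_columns_def[abs_def]
    by (subst borel_measurable_vec_iff, rule allI, subst borel_measurable_vec_iff) simp
  have m': "(matrix_of_columns :: ('q \<Rightarrow> real ^ 'n) \<Rightarrow> real ^ 'q ^ 'n) \<in> borel_measurable ?L"
    using m measurable_cong_sets[OF sets_PiM_cong[OF refl sets_lborel] refl] by blast
  show "distr ?L borel (matrix_of_columns :: _ \<Rightarrow> real ^ 'q ^ 'n) = lborel"
  proof (rule lborel_eqI[symmetric])
    fix l u :: "real ^ 'q ^ 'n" assume lu: "\<And>b. b \<in> Basis \<Longrightarrow> l \<bullet> b \<le> u \<bullet> b"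
    have lu': "l $ i $ j \<le> u $ i $ j" for i j
      using lu[of "axis i (axis j 1)"] by (auto simp: inner_axis Basis_vec_def)
    have box: "x \<in> box l u \<longleftrightarrow> (\<forall>j. column j x \<in> box (column j l) (column j u))" for x :: "real ^ 'q ^ 'n"
      by (auto simp: mem_box_cart column_def mem_box Basis_vec_def inner_axis)
    have "matrix_of_columns -` box l u \<inter> space ?L = (\<Pi>\<^sub>E j\<in>UNIV. box (column j l) (column j u))"
    proof -
      have "column j (matrix_of_columns x) = x j" for j and x :: "'q \<Rightarrow> real ^ 'n"
        by (simp add: column_def matrix_of_columns_def vec_eq_iff)
      then show ?thesis by (auto simp: box space_PiM PiE_def Pi_def)
    qed
    then have "emeasure (distr ?L borel matrix_of_columns) (box l u) =
      (\<Prod>j\<in>UNIV. emeasure lborel (box (column j l) (column j u)))"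
      using m' by (simp add: emeasure_distr L.emeasure_PiM)
    also have "\<dots> = (\<Prod>j\<in>UNIV. ennreal (\<Prod>i\<in>UNIV. u $ i $ j - l $ i $ j))"
    proof (rule prod.cong[OF refl])
      fix j :: 'q
      have "emeasure lborel (box (column j l) (column j u)) = ennreal (\<Prod>b\<in>Basis. (column j u - column j l) \<bullet> b)"
        using lu' by (intro emeasure_lborel_box) (auto simp: Basis_vec_def inner_axis column_def)
      also have "(\<Prod>b\<in>Basis. (column j u - column j l) \<bullet> b) = (\<Prod>i\<in>UNIV. u $ i $ j - l $ i $ j)"
        by (simp add: Basis_vec_def UNION_singleton_eq_range prod.reindex inj_on_def axis_eq_axis inner_axis column_def)
      finally show "emeasure lborel (box (column j l) (column j u)) = ennreal (\<Prod>i\<in>UNIV. u $ i $ j - l $ i $ j)" .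
    qed
    also have "\<dots> = ennreal (\<Prod>j\<in>UNIV. \<Prod>i\<in>UNIV. u $ i $ j - l $ i $ j)"
      using lu' by (intro prod_ennreal) (auto intro!: prod_nonneg)
    also have "(\<Prod>j\<in>UNIV. \<Prod>i\<in>UNIV. u $ i $ j - l $ i $ j) = (\<Prod>b\<in>Basis. (u - l) \<bullet> b)"
    proof -
      have B: "(Basis :: (real ^ 'q ^ 'n) set) = (\<lambda>(j, i). axis i (axis j 1)) ` (UNIV \<times> UNIV)"
        by (auto simp: Basis_vec_def)
      have inj: "inj_on (\<lambda>(j, i). axis i (axis j (1::real)) :: real ^ 'q ^ 'n) (UNIV \<times> UNIV)"
        by (auto simp: inj_on_def axis_eq_axis)
      show ?thesis
        unfolding B prod.reindex[OF inj] by (simp add: prod.cartesian_product case_prod_unfold inner_axis o_def)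
    qed
    finally show "emeasure (distr ?L borel matrix_of_columns) (box l u) = (\<Prod>b\<in>Basis. (u - l) \<bullet> b)" .
  qed simp
qed

text \<open>
  The completion makes a function measurable as soon as it agrees almost everywhere with a
  measurable one.
\<close>

lemma measurable_completion_AE_eq:
  assumes g: "g \<in> measurable M N" and eq: "AE x in M. f x = g x" and sp: "\<And>x. x \<in> space M \<Longrightarrow> f x \<in> space N"
  shows "f \<in> measurable (completion M) N"
proof (rule measurableI)
  fix A assume A: "A \<in> sets N"
  have gA: "g -` A \<inter> space M \<in> sets (completion M)"
    using measurable_sets[OF measurable_completion[OF g] A] by simp
  have "AE x in completion M. x \<in> g -` A \<inter> space M \<longleftrightarrow> x \<in> f -` A \<inter> space M"
    using AE_completion[OF eq] by eventually_elim auto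
  then show "f -` A \<inter> space (completion M) \<in> sets (completion M)"
    using completion.in_sets_AE[OF _ gA] by simp
qed (use sp in simp)

lemma subspace_power_bochner:
  fixes H :: "('q::finite \<Rightarrow> real ^ 'n) \<Rightarrow> 'b::{banach, second_countable_topology}"
  assumes H: "H \<in> borel_measurable (\<Pi>\<^sub>M j\<in>UNIV. borel)" and \<xi>: "subspace \<xi>"
  defines "W \<equiv> \<lambda>y. \<Prod>j\<in>(UNIV :: 'q set). ball_weight (CARD('n) - dim \<xi>) (y j - closest_point \<xi> (y j))"
  shows "integrable (\<Pi>\<^sub>M j\<in>UNIV. lborel_subspace \<xi>) H \<longleftrightarrow>
      integrable (\<Pi>\<^sub>M j\<in>UNIV. lborel) (\<lambda>y. W y *\<^sub>R H (\<lambda>j. closest_point \<xi> (y j)))"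
    "(\<integral>x. H x \<partial>(\<Pi>\<^sub>M j\<in>UNIV. lborel_subspace \<xi>)) =
      (\<integral>y. W y *\<^sub>R H (\<lambda>j. closest_point \<xi> (y j)) \<partial>(\<Pi>\<^sub>M j\<in>UNIV. lborel))"
proof -
  let ?L = "\<Pi>\<^sub>M j\<in>(UNIV :: 'q set). (lborel :: (real ^ 'n) measure)"
  let ?X = "\<Pi>\<^sub>M j\<in>(UNIV :: 'q set). lborel_subspace \<xi>"
  note p = PiM_lborel_subspace_eq_distr[OF \<xi>, of "UNIV :: 'q set", unfolded restrict_UNIV]
  have H'[measurable]: "H \<in> borel_measurable ?X" by (rule measurable_PiM_lborel_subspace[OF H])
  note [measurable] = borel_measurable_closest_point[OF \<xi>] p(1) measurable_compose[OF p(1) H']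
  have [measurable]: "W \<in> borel_measurable ?L" unfolding W_def by measurable
  have W0: "W y \<ge> 0" for y unfolding W_def by (intro prod_nonneg) (auto simp: ball_weight_nonneg)
  have "integrable ?X H \<longleftrightarrow> integrable (distr (density ?L W) ?X (\<lambda>y i. closest_point \<xi> (y i))) H"
    unfolding W_def by (subst p(2)) simp
  also have "\<dots> \<longleftrightarrow> integrable (density ?L W) (\<lambda>y. H (\<lambda>j. closest_point \<xi> (y j)))"
    by (rule integrable_distr_eq) auto
  also have "\<dots> \<longleftrightarrow> integrable ?L (\<lambda>y. W y *\<^sub>R H (\<lambda>j. closest_point \<xi> (y j)))"
    by (rule integrable_density) (auto simp: W0)
  finally show "integrable ?X H \<longleftrightarrow> integrable ?L (\<lambda>y. W y *\<^sub>R H (\<lambda>j. closest_point \<xi> (y j)))" .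
  have "(\<integral>x. H x \<partial>?X) = (\<integral>x. H x \<partial>distr (density ?L W) ?X (\<lambda>y i. closest_point \<xi> (y i)))"
    unfolding W_def by (subst p(2)) simp
  also have "\<dots> = (\<integral>y. H (\<lambda>j. closest_point \<xi> (y j)) \<partial>density ?L W)"
    by (rule integral_distr) auto
  also have "\<dots> = (\<integral>y. W y *\<^sub>R H (\<lambda>j. closest_point \<xi> (y j)) \<partial>?L)"
    by (rule integral_density) (auto simp: W0)
  finally show "(\<integral>x. H x \<partial>?X) = (\<integral>y. W y *\<^sub>R H (\<lambda>j. closest_point \<xi> (y j)) \<partial>?L)" .
qed

lemma sigma_finite_PiM_lborel:
  "finite I \<Longrightarrow> sigma_finite_measure (\<Pi>\<^sub>M j\<in>I. (lborel :: 'a::euclidean_space measure))"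
  by (intro product_sigma_finite.sigma_finite) (simp add: product_sigma_finite_def lborel.sigma_finite_measure_axioms)

text \<open>
  The formula for indicator functions, stated as an identity of measures: Lebesgue measure on
  matrices is the image of a weighted product measure. Fubini's theorem on that product then
  yields integrability on almost every fibre and the formula for vector-valued functions.
\<close>

lemma lborel_eq_grassmann_distr:
  fixes \<mu> :: "(real ^ 'n) set measure"
  assumes q: "CARD('q) \<le> k" and \<mu>: "invariant_grassmann_measure k \<mu>"
  defines "c \<equiv> \<Prod>j<CARD('q). sphere_area (CARD('n) - j) / sphere_area (k - j)"
    and "D \<equiv> \<lambda>(\<xi>, y). (\<Prod>j\<in>(UNIV :: 'q set). ball_weight (CARD('n) - k) (y j - closest_point \<xi> (y j))) *
      gram_vol UNIV (\<lambda>j. closest_point \<xi> (y j)) ^ (CARD('n) - k)"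
    and "\<Phi> \<equiv> \<lambda>(\<xi>, y). matrix_of_columns (\<lambda>j::'q. closest_point \<xi> (y j)) :: real ^ 'q ^ 'n"
    and "L \<equiv> \<Pi>\<^sub>M j\<in>(UNIV :: 'q set). (lborel :: (real ^ 'n) measure)"
  shows "D \<in> borel_measurable (\<mu> \<Otimes>\<^sub>M L)" "\<Phi> \<in> borel_measurable (\<mu> \<Otimes>\<^sub>M L)"
    "distr (density (\<mu> \<Otimes>\<^sub>M L) (\<lambda>p. ennreal (c * D p))) borel \<Phi> = lborel"
proof -
  have prob: "prob_space \<mu>" and sets: "sets \<mu> = sets (grassmann_borel k)"
    using \<mu> by (auto simp: invariant_grassmann_measure_def)
  interpret M: prob_space \<mu> by (rule prob)
  interpret L: sigma_finite_measure L unfolding L_def by (rule sigma_finite_PiM_lborel) simp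
  interpret P: pair_sigma_finite \<mu> L
    by (simp add: pair_sigma_finite_def M.sigma_finite_measure_axioms L.sigma_finite_measure_axioms)
  have space: "space \<mu> = grassmannian k"
    using sets_eq_imp_space_eq[OF sets] by (simp add: space_grassmann_borel)
  have spair: "sets (\<mu> \<Otimes>\<^sub>M L) = sets (grassmann_borel k \<Otimes>\<^sub>M (\<Pi>\<^sub>M j\<in>(UNIV :: 'q set). (borel :: (real ^ 'n) measure)))"
    unfolding L_def by (intro sets_pair_measure_cong sets sets_PiM_cong) auto
  note mpair = measurable_cong_sets[OF spair refl]
  have LB: "sets L = sets (\<Pi>\<^sub>M j\<in>(UNIV :: 'q set). (borel :: (real ^ 'n) measure))"
    unfolding L_def by (intro sets_PiM_cong) auto
  note pr = measurable_grassmann_projection[where 'q = 'q and 'n = 'n and k = k, unfolded restrict_UNIV]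
  show D[measurable]: "D \<in> borel_measurable (\<mu> \<Otimes>\<^sub>M L)"
    unfolding mpair D_def
    using measurable_grassmann_weight[where 'q = 'q and 'n = 'n and k = k and m = "CARD('n) - k"]
      measurable_compose[OF pr borel_measurable_gram_vol]
    by (simp add: case_prod_unfold)
  show \<Phi>[measurable]: "\<Phi> \<in> borel_measurable (\<mu> \<Otimes>\<^sub>M L)"
    unfolding mpair \<Phi>_def using measurable_compose[OF pr distr_matrix_of_columns(1)] by (simp add: case_prod_unfold)
  have c0: "c \<ge> 0" unfolding c_def by (intro prod_nonneg) (auto simp: sphere_area_def)
  have D0: "D p \<ge> 0" for p
    by (auto simp: D_def case_prod_unfold intro!: mult_nonneg_nonneg prod_nonneg zero_le_power ball_weight_nonneg gram_vol_nonneg)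
  show "distr (density (\<mu> \<Otimes>\<^sub>M L) (\<lambda>p. ennreal (c * D p))) borel \<Phi> = lborel"
  proof (rule measure_eqI)
    fix A assume "A \<in> sets (distr (density (\<mu> \<Otimes>\<^sub>M L) (\<lambda>p. ennreal (c * D p))) borel \<Phi>)"
    then have A[measurable]: "A \<in> sets (borel :: (real ^ 'q ^ 'n) measure)" by simp
    let ?f = "\<lambda>x. indicator A (matrix_of_columns x) :: ennreal"
    have f: "?f \<in> borel_measurable (\<Pi>\<^sub>M j\<in>(UNIV :: 'q set). borel)"
      by (rule measurable_compose[OF distr_matrix_of_columns(1)]) simp
    note [measurable] = f borel_measurable_gram_vol[where S = "UNIV :: 'q set"]
    have F: "(\<lambda>x. ?f x * ennreal (gram_vol UNIV x ^ (CARD('n) - k))) \<in> borel_measurable (\<Pi>\<^sub>M j\<in>(UNIV :: 'q set). borel)"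
      by measurable
    have inner: "(\<integral>\<^sup>+y. ennreal (D (\<xi>, y)) * indicator A (\<Phi> (\<xi>, y)) \<partial>L) =
        (\<integral>\<^sup>+x. ?f x * ennreal (gram_vol UNIV x ^ (CARD('n) - k)) \<partial>(\<Pi>\<^sub>M j\<in>UNIV. lborel_subspace \<xi>))"
      if "\<xi> \<in> space \<mu>" for \<xi>
    proof -
      have \<xi>: "subspace \<xi>" "dim \<xi> = k" using that by (auto simp: space grassmannianD)
      show ?thesis
        unfolding nn_integral_subspace_power_smear[OF F \<xi>(1)] L_def \<xi>(2)
        by (intro nn_integral_cong)
           (simp add: D_def \<Phi>_def ennreal_mult prod_nonneg ball_weight_nonneg gram_vol_nonneg mult_ac)
    qed
    have "emeasure (distr (density (\<mu> \<Otimes>\<^sub>M L) (\<lambda>p. ennreal (c * D p))) borel \<Phi>) A =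
      (\<integral>\<^sup>+x. indicator A x \<partial>distr (density (\<mu> \<Otimes>\<^sub>M L) (\<lambda>p. ennreal (c * D p))) borel \<Phi>)"
      by simp
    also have "\<dots> = (\<integral>\<^sup>+p. indicator A (\<Phi> p) \<partial>density (\<mu> \<Otimes>\<^sub>M L) (\<lambda>p. ennreal (c * D p)))"
      by (rule nn_integral_distr) auto
    also have "\<dots> = (\<integral>\<^sup>+p. ennreal (c * D p) * indicator A (\<Phi> p) \<partial>(\<mu> \<Otimes>\<^sub>M L))"
      by (rule nn_integral_density) auto
    also have "\<dots> = ennreal c * (\<integral>\<^sup>+p. ennreal (D p) * indicator A (\<Phi> p) \<partial>(\<mu> \<Otimes>\<^sub>M L))"
      using c0 D0 by (subst nn_integral_cmult[symmetric]) (auto simp: ennreal_mult mult.assoc)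
    also have "(\<integral>\<^sup>+p. ennreal (D p) * indicator A (\<Phi> p) \<partial>(\<mu> \<Otimes>\<^sub>M L)) =
      (\<integral>\<^sup>+\<xi>. (\<integral>\<^sup>+y. ennreal (D (\<xi>, y)) * indicator A (\<Phi> (\<xi>, y)) \<partial>L) \<partial>\<mu>)"
      by (rule L.nn_integral_fst[symmetric]) measurable
    also have "\<dots> = (\<integral>\<^sup>+\<xi>. (\<integral>\<^sup>+x. ?f x * ennreal (gram_vol UNIV x ^ (CARD('n) - k)) \<partial>(\<Pi>\<^sub>M j\<in>UNIV. lborel_subspace \<xi>)) \<partial>\<mu>)"
      by (intro nn_integral_cong inner)
    also have "ennreal c * \<dots> = (\<integral>\<^sup>+x. ?f x \<partial>L)"
      unfolding c_def L_def by (rule nn_integral_columns_grassmann[OF q \<mu> f, symmetric])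
    also have "\<dots> = (\<integral>\<^sup>+x. indicator A x \<partial>distr L borel matrix_of_columns)"
      using distr_matrix_of_columns(1) measurable_cong_sets[OF LB refl] by (subst nn_integral_distr) auto
    also have "\<dots> = emeasure lborel A"
      unfolding L_def distr_matrix_of_columns(2) by simp
    finally show "emeasure (distr (density (\<mu> \<Otimes>\<^sub>M L) (\<lambda>p. ennreal (c * D p))) borel \<Phi>) A = emeasure lborel A" .
  qed simp
qed

lemma integrable_scaleR_iff:
  fixes f :: "'a \<Rightarrow> 'b::{banach, second_countable_topology}"
  assumes "c \<noteq> 0"
  shows "integrable M (\<lambda>x. c *\<^sub>R f x) \<longleftrightarrow> integrable M f"
proof
  assume "integrable M (\<lambda>x. c *\<^sub>R f x)"
  then have "integrable M (\<lambda>x. (1 / c) *\<^sub>R (c *\<^sub>R f x))" by (rule integrable_scaleR_right[OF _, of "1 / c"])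
  moreover have "(\<lambda>x. (1 / c) *\<^sub>R (c *\<^sub>R f x)) = f" using assms by auto
  ultimately show "integrable M f" by (simp only:)
qed simp

text \<open>
  Fubini's theorem for the weighted product measure. On each fibre the weight is undone by the
  averaging formula, which leaves an integral over the power of the subspace.
\<close>

lemma integral_columns_grassmann:
  fixes \<mu> :: "(real ^ 'n) set measure" and F :: "real ^ 'q ^ 'n \<Rightarrow> 'b::{banach, second_countable_topology}"
  assumes q: "CARD('q) \<le> k" and kn: "k \<le> CARD('n)" and \<mu>: "invariant_grassmann_measure k \<mu>"
    and F: "integrable lborel F"
  defines "c \<equiv> \<Prod>j<CARD('q). sphere_area (CARD('n) - j) / sphere_area (k - j)"
    and "H \<equiv> \<lambda>x :: 'q \<Rightarrow> real ^ 'n. gram_vol UNIV x ^ (CARD('n) - k) *\<^sub>R F (matrix_of_columns x)"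
  shows "AE \<xi> in \<mu>. integrable (\<Pi>\<^sub>M j\<in>UNIV. lborel_subspace \<xi>) H"
    "integrable \<mu> (\<lambda>\<xi>. \<integral>x. H x \<partial>(\<Pi>\<^sub>M j\<in>UNIV. lborel_subspace \<xi>))"
    "(\<integral>x. F x \<partial>lborel) = c *\<^sub>R (\<integral>\<xi>. (\<integral>x. H x \<partial>(\<Pi>\<^sub>M j\<in>UNIV. lborel_subspace \<xi>)) \<partial>\<mu>)"
proof -
  define L where "L = (\<Pi>\<^sub>M j\<in>(UNIV :: 'q set). (lborel :: (real ^ 'n) measure))"
  define D where "D = (\<lambda>(\<xi>, y). (\<Prod>j\<in>(UNIV :: 'q set). ball_weight (CARD('n) - k) (y j - closest_point \<xi> (y j))) *
      gram_vol UNIV (\<lambda>j. closest_point \<xi> (y j :: real ^ 'n)) ^ (CARD('n) - k))"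
  define \<Phi> where "\<Phi> = (\<lambda>(\<xi>, y). matrix_of_columns (\<lambda>j::'q. closest_point \<xi> (y j)) :: real ^ 'q ^ 'n)"
  note * = lborel_eq_grassmann_distr[OF q \<mu>, folded c_def D_def \<Phi>_def L_def]
  note [measurable] = *(1,2)
  have prob: "prob_space \<mu>" and sets: "sets \<mu> = sets (grassmann_borel k)"
    using \<mu> by (auto simp: invariant_grassmann_measure_def)
  interpret M: prob_space \<mu> by (rule prob)
  interpret L: sigma_finite_measure L unfolding L_def by (rule sigma_finite_PiM_lborel) simp
  interpret P: pair_sigma_finite \<mu> L
    by (simp add: pair_sigma_finite_def M.sigma_finite_measure_axioms L.sigma_finite_measure_axioms)
  have space: "space \<mu> = grassmannian k"
    using sets_eq_imp_space_eq[OF sets] by (simp add: space_grassmann_borel)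
  have c0: "c > 0"
    unfolding c_def using q kn by (intro prod_pos) (auto intro!: divide_pos_pos sphere_area_pos)
  have D0: "D p \<ge> 0" for p
    by (auto simp: D_def case_prod_unfold intro!: mult_nonneg_nonneg prod_nonneg zero_le_power ball_weight_nonneg gram_vol_nonneg)
  have Fm[measurable]: "F \<in> borel_measurable borel" using F by simp
  have H: "H \<in> borel_measurable (\<Pi>\<^sub>M j\<in>UNIV. borel)"
    unfolding H_def using measurable_compose[OF distr_matrix_of_columns(1) Fm]
    by (intro borel_measurable_scaleR borel_measurable_power borel_measurable_gram_vol) auto
  let ?K = "\<lambda>p. (c * D p) *\<^sub>R F (\<Phi> p)"
  have int: "integrable (\<mu> \<Otimes>\<^sub>M L) ?K" and eq: "(\<integral>x. F x \<partial>lborel) = (\<integral>p. ?K p \<partial>(\<mu> \<Otimes>\<^sub>M L))"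
  proof -
    let ?N = "density (\<mu> \<Otimes>\<^sub>M L) (\<lambda>p. ennreal (c * D p))"
    have "integrable lborel F \<longleftrightarrow> integrable (distr ?N borel \<Phi>) F" by (simp add: *(3))
    also have "\<dots> \<longleftrightarrow> integrable ?N (\<lambda>p. F (\<Phi> p))" by (rule integrable_distr_eq) auto
    also have "\<dots> \<longleftrightarrow> integrable (\<mu> \<Otimes>\<^sub>M L) ?K"
      using c0 D0 by (intro integrable_density) auto
    finally show "integrable (\<mu> \<Otimes>\<^sub>M L) ?K" using F by simp
    have "(\<integral>x. F x \<partial>lborel) = (\<integral>x. F x \<partial>distr ?N borel \<Phi>)" by (simp add: *(3))
    also have "\<dots> = (\<integral>p. F (\<Phi> p) \<partial>?N)" by (rule integral_distr) auto
    also have "\<dots> = (\<integral>p. ?K p \<partial>(\<mu> \<Otimes>\<^sub>M L))"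
      using c0 D0 by (intro integral_density) auto
    finally show "(\<integral>x. F x \<partial>lborel) = (\<integral>p. ?K p \<partial>(\<mu> \<Otimes>\<^sub>M L))" .
  qed
  let ?I = "\<lambda>\<xi>. \<integral>x. H x \<partial>(\<Pi>\<^sub>M j\<in>UNIV. lborel_subspace \<xi>)"
  let ?J = "\<lambda>\<xi>. \<integral>y. ?K (\<xi>, y) \<partial>L"
  have fibre: "integrable (\<Pi>\<^sub>M j\<in>UNIV. lborel_subspace \<xi>) H \<longleftrightarrow> integrable L (\<lambda>y. ?K (\<xi>, y))"
      "?J \<xi> = c *\<^sub>R ?I \<xi>" if "\<xi> \<in> space \<mu>" for \<xi>
  proof -
    have \<xi>: "subspace \<xi>" "dim \<xi> = k" using that by (auto simp: space grassmannianD)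
    note b = subspace_power_bochner[OF H \<xi>(1), unfolded \<xi>(2), folded L_def]
    have K: "?K (\<xi>, y) = c *\<^sub>R ((\<Prod>j\<in>UNIV. ball_weight (CARD('n) - k) (y j - closest_point \<xi> (y j))) *\<^sub>R
        H (\<lambda>j. closest_point \<xi> (y j)))" for y
      by (simp add: D_def \<Phi>_def H_def mult.assoc)
    show "integrable (\<Pi>\<^sub>M j\<in>UNIV. lborel_subspace \<xi>) H \<longleftrightarrow> integrable L (\<lambda>y. ?K (\<xi>, y))"
      unfolding b(1) K using c0
      by (subst integrable_scaleR_iff) auto
    show "?J \<xi> = c *\<^sub>R ?I \<xi>"
      unfolding b(2) K by (simp del: scaleR_scaleR)
  qed
  show "AE \<xi> in \<mu>. integrable (\<Pi>\<^sub>M j\<in>UNIV. lborel_subspace \<xi>) H"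
    using P.AE_integrable_fst'[OF int] AE_space by eventually_elim (simp add: fibre)
  have "integrable \<mu> ?J \<longleftrightarrow> integrable \<mu> (\<lambda>\<xi>. c *\<^sub>R ?I \<xi>)"
    by (intro Bochner_Integration.integrable_cong refl fibre(2))
  then show "integrable \<mu> ?I"
    using P.integrable_fst'[OF int] c0 by (simp only: integrable_scaleR_iff)
  have "(\<integral>x. F x \<partial>lborel) = (\<integral>\<xi>. ?J \<xi> \<partial>\<mu>)"
    unfolding eq by (rule P.integral_fst'[symmetric, OF int])
  also have "\<dots> = (\<integral>\<xi>. c *\<^sub>R ?I \<xi> \<partial>\<mu>)"
    by (intro Bochner_Integration.integral_cong refl fibre(2))
  also have "\<dots> = c *\<^sub>R (\<integral>\<xi>. ?I \<xi> \<partial>\<mu>)" by simp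
  finally show "(\<integral>x. F x \<partial>lborel) = c *\<^sub>R (\<integral>\<xi>. ?I \<xi> \<partial>\<mu>)" .
qed

lemma completion_ex_borel_measurable_complex:
  fixes g :: "'a \<Rightarrow> complex"
  assumes g: "g \<in> borel_measurable (completion M)"
  obtains g' where "g' \<in> borel_measurable M" "AE x in M. g x = g' x"
proof -
  have "(\<lambda>x. Re (g x)) \<in> borel_measurable (completion M)" "(\<lambda>x. Im (g x)) \<in> borel_measurable (completion M)"
    using g by measurable
  from this[THEN completion_ex_borel_measurable_real]
  obtain a b where ab[measurable]: "a \<in> borel_measurable M" "b \<in> borel_measurable M"
    and eq: "AE x in M. Re (g x) = a x" "AE x in M. Im (g x) = b x"
    by blast
  show thesis
  proof
    show "(\<lambda>x. complex_of_real (a x) + \<i> * complex_of_real (b x)) \<in> borel_measurable M" by measurable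
    show "AE x in M. g x = complex_of_real (a x) + \<i> * complex_of_real (b x)"
      using eq by eventually_elim (simp add: complex_eq_iff)
  qed
qed

text \<open>
  A null set of matrices may fill the power of an exceptional subspace, but by the formula for
  its indicator function this happens, up to matrices of volume zero, for almost no subspace.
  This is what allows Lebesgue measurable integrands.
\<close>

lemma AE_columns_grassmann:
  fixes \<mu> :: "(real ^ 'n) set measure" and N :: "(real ^ 'q ^ 'n) set"
  assumes q: "CARD('q) \<le> k" and kn: "k \<le> CARD('n)" and \<mu>: "invariant_grassmann_measure k \<mu>"
    and N: "N \<in> null_sets lborel"
  shows "AE \<xi> in \<mu>. AE x in (\<Pi>\<^sub>M j\<in>UNIV. lborel_subspace \<xi>).
    matrix_of_columns x \<in> N \<longrightarrow> gram_vol UNIV x ^ (CARD('n) - k) = 0"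
proof -
  have sets: "sets \<mu> = sets (grassmann_borel k)"
    using \<mu> by (auto simp: invariant_grassmann_measure_def)
  have [measurable]: "N \<in> sets borel" using N by auto
  let ?f = "\<lambda>x :: 'q \<Rightarrow> real ^ 'n. indicator N (matrix_of_columns x) :: ennreal"
  let ?F = "\<lambda>x :: 'q \<Rightarrow> real ^ 'n. ?f x * ennreal (gram_vol UNIV x ^ (CARD('n) - k))"
  let ?c = "\<Prod>j<CARD('q). sphere_area (CARD('n) - j) / sphere_area (k - j)"
  have f: "?f \<in> borel_measurable (\<Pi>\<^sub>M j\<in>UNIV. borel)"
    by (rule measurable_compose[OF distr_matrix_of_columns(1)]) simp
  note [measurable] = f borel_measurable_gram_vol[where S = "UNIV :: 'q set"]
  have F: "?F \<in> borel_measurable (\<Pi>\<^sub>M j\<in>UNIV. borel)" by measurable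
  have c0: "?c > 0"
    using q kn by (intro prod_pos) (auto intro!: divide_pos_pos sphere_area_pos)
  have mc: "matrix_of_columns \<in> borel_measurable (\<Pi>\<^sub>M j\<in>(UNIV :: 'q set). (lborel :: (real ^ 'n) measure))"
    using distr_matrix_of_columns(1) measurable_cong_sets[OF sets_PiM_cong[OF refl sets_lborel] refl] by blast
  have "(\<integral>\<^sup>+x. ?f x \<partial>(\<Pi>\<^sub>M j\<in>UNIV. lborel)) = (\<integral>\<^sup>+x. indicator N x \<partial>distr (\<Pi>\<^sub>M j\<in>UNIV. lborel) borel (matrix_of_columns :: ('q \<Rightarrow> real ^ 'n) \<Rightarrow> _))"
    using mc by (subst nn_integral_distr) auto
  also have "\<dots> = 0" unfolding distr_matrix_of_columns(2) using N by auto
  finally have "ennreal ?c * (\<integral>\<^sup>+\<xi>. (\<integral>\<^sup>+x. ?F x \<partial>(\<Pi>\<^sub>M j\<in>UNIV. lborel_subspace \<xi>)) \<partial>\<mu>) = 0"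
    by (simp add: nn_integral_columns_grassmann[OF q \<mu> f])
  then have "(\<integral>\<^sup>+\<xi>. (\<integral>\<^sup>+x. ?F x \<partial>(\<Pi>\<^sub>M j\<in>UNIV. lborel_subspace \<xi>)) \<partial>\<mu>) = 0"
    using c0 by (simp only: mult_eq_0_iff ennreal_eq_0_iff) linarith
  moreover have "(\<lambda>\<xi>. \<integral>\<^sup>+x. ?F x \<partial>(\<Pi>\<^sub>M j\<in>UNIV. lborel_subspace \<xi>)) \<in> borel_measurable \<mu>"
    using borel_measurable_subspace_power_integral[OF F] measurable_cong_sets[OF sets refl] by blast
  ultimately have ae: "AE \<xi> in \<mu>. (\<integral>\<^sup>+x. ?F x \<partial>(\<Pi>\<^sub>M j\<in>UNIV. lborel_subspace \<xi>)) = 0"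
    by (simp add: nn_integral_0_iff_AE)
  show ?thesis
  proof (rule AE_mp[OF ae], rule AE_I2, rule impI)
    fix \<xi> assume "(\<integral>\<^sup>+x. ?F x \<partial>(\<Pi>\<^sub>M j\<in>UNIV. lborel_subspace \<xi>)) = 0"
    then have ae': "AE x in (\<Pi>\<^sub>M j\<in>UNIV. lborel_subspace \<xi>). ?F x = 0"
      using measurable_PiM_lborel_subspace[OF F] by (simp only: nn_integral_0_iff_AE)
    show "AE x in (\<Pi>\<^sub>M j\<in>UNIV. lborel_subspace \<xi>).
        matrix_of_columns x \<in> N \<longrightarrow> gram_vol UNIV x ^ (CARD('n) - k) = 0"
    proof (rule AE_mp[OF ae'], rule AE_I2, intro impI)
      fix x :: "'q \<Rightarrow> real ^ 'n" assume "?F x = 0" "matrix_of_columns x \<in> N"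
      then have "ennreal (gram_vol UNIV x ^ (CARD('n) - k)) = 0" by simp
      then show "gram_vol UNIV x ^ (CARD('n) - k) = 0"
        using zero_le_power[OF gram_vol_nonneg[of UNIV x], of "CARD('n) - k"]
        by (simp only: ennreal_eq_0_iff)
    qed
  qed
qed

section \<open>The integral formula\<close>

theorem theorem2p2:
  fixes F :: "real ^ 'q ^ 'n \<Rightarrow> complex"
    and k :: nat
    and \<mu> :: "(real ^ 'n) set measure"
  assumes "CARD('q) \<le> k" and "k \<le> CARD('n)"
    and "invariant_grassmann_measure k \<mu>"
    and "integrable lebesgue F"
  defines "G \<equiv> (\<lambda>x :: 'q \<Rightarrow> real ^ 'n. F (matrix_of_columns x) *
                  of_real (column_volume (matrix_of_columns x) ^ (CARD('n) - k)))"
  shows "(AE \<xi> in completion \<mu>. integrable (lebesgue_subspace_power \<xi>) G) \<and>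
         integrable (completion \<mu>) (\<lambda>\<xi>. \<integral>x. G x \<partial>lebesgue_subspace_power \<xi>) \<and>
         (\<integral>x. F x \<partial>lebesgue) =
           of_real (stiefel_mass (CARD('n)) (CARD('q)) / stiefel_mass k (CARD('q))) *
           (\<integral>\<xi>. (\<integral>x. G x \<partial>lebesgue_subspace_power \<xi>) \<partial>completion \<mu>)"
proof -
  note q = assms(1) and kn = assms(2) and \<mu> = assms(3) and F = assms(4)
  let ?X = "\<lambda>\<xi>. \<Pi>\<^sub>M j\<in>(UNIV :: 'q set). lborel_subspace \<xi>"
  let ?c = "\<Prod>j<CARD('q). sphere_area (CARD('n) - j) / sphere_area (k - j)"
  have c: "stiefel_mass (CARD('n)) (CARD('q)) / stiefel_mass k (CARD('q)) = ?c"
    using q kn by (simp add: stiefel_mass_eq_prod prod_dividef)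
  obtain F' where F'm: "F' \<in> borel_measurable lborel" and FF': "AE x in lborel. F x = F' x"
    by (rule completion_ex_borel_measurable_complex[OF borel_measurable_integrable[OF F]]) (rule that; assumption)
  have F'leb: "F' \<in> borel_measurable lebesgue" by (rule measurable_completion[OF F'm])
  have F'int: "integrable lborel F'"
    using integrable_cong_AE_imp[OF F F'leb AE_completion[OF FF']] integrable_completion[OF F'm] by simp
  have intF: "(\<integral>x. F x \<partial>lebesgue) = (\<integral>x. F' x \<partial>lborel)"
    using integral_cong_AE[OF _ F'leb AE_completion[OF FF']] F integral_completion[OF F'm] by auto
  define H where "H = (\<lambda>x :: 'q \<Rightarrow> real ^ 'n. gram_vol UNIV x ^ (CARD('n) - k) *\<^sub>R F' (matrix_of_columns x))"
  note main = integral_columns_grassmann[OF q kn \<mu> F'int, folded H_def]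
  have Hm: "H \<in> borel_measurable (?X \<xi>)" for \<xi>
    unfolding H_def using F'm
    by (intro measurable_PiM_lborel_subspace borel_measurable_scaleR borel_measurable_power borel_measurable_gram_vol
        measurable_compose[OF distr_matrix_of_columns(1)]) simp
  from FF' obtain N where N: "{x \<in> space lborel. F x \<noteq> F' x} \<subseteq> N" "N \<in> null_sets lborel"
    by (auto elim!: AE_E simp: null_sets_def)
  \<comment> \<open>At almost every point of \<open>N\<close> the two integrands agree because the volume factor is zero.\<close>
  have GH: "AE \<xi> in \<mu>. AE x in ?X \<xi>. G x = H x"
  proof (rule AE_mp[OF AE_columns_grassmann[OF q kn \<mu> N(2)]], rule AE_I2, rule impI)
    fix \<xi> assume ae: "AE x in ?X \<xi>. matrix_of_columns x \<in> N \<longrightarrow> gram_vol UNIV x ^ (CARD('n) - k) = 0"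
    show "AE x in ?X \<xi>. G x = H x"
    proof (rule AE_mp[OF ae], rule AE_I2, rule impI)
      fix x assume *: "matrix_of_columns x \<in> N \<longrightarrow> gram_vol UNIV x ^ (CARD('n) - k) = 0"
      show "G x = H x"
      proof (cases "matrix_of_columns x \<in> N")
        case True
        then have "column_volume (matrix_of_columns x) ^ (CARD('n) - k) = 0"
          using * by (simp only: gram_vol_UNIV)
        then show ?thesis unfolding G_def H_def gram_vol_UNIV by (simp only: of_real_0 mult_zero_right scaleR_zero_left)
      next
        case False
        then have "F (matrix_of_columns x) = F' (matrix_of_columns x)" using N(1) by auto
        then show ?thesis by (simp add: G_def H_def gram_vol_UNIV scaleR_conv_of_real mult.commute)
      qed
    qed
  qed
  have fibre: "G \<in> borel_measurable (completion (?X \<xi>))" "AE x in completion (?X \<xi>). H x = G x"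
    if "AE x in ?X \<xi>. G x = H x" for \<xi>
  proof -
    show "G \<in> borel_measurable (completion (?X \<xi>))"
      by (rule measurable_completion_AE_eq[OF Hm that]) simp
    show "AE x in completion (?X \<xi>). H x = G x"
      using AE_completion[OF that] by eventually_elim simp
  qed
  have int: "AE \<xi> in \<mu>. integrable (lebesgue_subspace_power \<xi>) G"
    using GH main(1)
  proof eventually_elim
    case (elim \<xi>)
    then show ?case
      using integrable_cong_AE_imp[OF _ fibre[OF elim(1)]] integrable_completion[OF Hm]
      by (simp add: lebesgue_subspace_power_def)
  qed
  have eq: "AE \<xi> in \<mu>. (\<integral>x. G x \<partial>lebesgue_subspace_power \<xi>) = (\<integral>x. H x \<partial>?X \<xi>)"
    using GH
  proof eventually_elim
    case (elim \<xi>)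
    then show ?case
      using integral_cong_AE[OF measurable_completion[OF Hm] fibre[OF elim]] integral_completion[OF Hm]
      by (simp add: lebesgue_subspace_power_def)
  qed
  let ?I = "\<lambda>\<xi>. \<integral>x. H x \<partial>?X \<xi>" and ?J = "\<lambda>\<xi>. \<integral>x. G x \<partial>lebesgue_subspace_power \<xi>"
  have Im: "?I \<in> borel_measurable \<mu>" using main(2) by (rule borel_measurable_integrable)
  have Jm: "?J \<in> borel_measurable (completion \<mu>)"
    by (rule measurable_completion_AE_eq[OF Im eq]) simp
  have IJ: "AE \<xi> in completion \<mu>. ?I \<xi> = ?J \<xi>"
    using AE_completion[OF eq] by eventually_elim simp
  have "integrable (completion \<mu>) ?J"
    using main(2) integrable_completion[OF Im] by (intro integrable_cong_AE_imp[OF _ Jm IJ]) simp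
  moreover have "(\<integral>\<xi>. ?J \<xi> \<partial>completion \<mu>) = (\<integral>\<xi>. ?I \<xi> \<partial>\<mu>)"
    using integral_cong_AE[OF measurable_completion[OF Im] Jm IJ] integral_completion[OF Im] by simp
  ultimately show ?thesis
    using AE_completion[OF int] main(3) unfolding intF c by (simp add: scaleR_conv_of_real)
qed

end
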